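(* Let $G$ be a finitely generated group of zero entropy, i.e. $h(G)=0$, and let $H$ be a normal subgroup of $G$ such that the quotient group $G/H$ is elementary amenable. Then $H$ is finitely generated.
   Context: For a group $G$ generated by a finite set $X$, $\|g\|_X$ denotes the length of a shortest word over $X\cup X^{-1}$ representing $g\in G$, and $\gamma_G^X(n)=\mathrm{card}\{g\in G : \|g\|_X\le n\}$. The exponential growth rate of $G$ with respect to $X$ is $\omega(G,X)=\lim_{n\to\infty}\sqrt[n]{\gamma_G^X(n)}$ (the limit exists). The minimal exponential growth rate is $\omega(G)=\inf_X\omega(G,X)$, the infimum over all finite generating sets $X$ of $G$. The (algebraic) entropy is $h(G)=\log\omega(G)$; zero entropy means $\omega(G)=1$. The class $EG$ of elementary amenable groups is the smallest class of groups that contains all abelian groups and all finite groups and is closed under taking subgroups, quotient groups, group extensions, and direct limits in the sense of directed unions (i.e. if $\{G_\lambda\}_{\lambda\in\Lambda}$ is a family of groups in the class such that for all $\lambda,\mu\in\Lambda$ there is $\nu\in\Lambda$ with $G_\lambda\cup G_\mu\subseteq G_\nu$ as subgroups, then $\bigcup_{\lambda\in\Lambda}G_\lambda$ is in the class). *)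

theory Defs
  imports Complex_Main "HOL-Algebra.Generated_Groups" "HOL-Algebra.Coset"
begin

section \<open>Generating sets and word length\<close>

definition generates :: "('a, 'b) monoid_scheme \<Rightarrow> 'a set \<Rightarrow> bool" where
  "generates G X \<longleftrightarrow> X \<subseteq> carrier G \<and> generate G X = carrier G"

definition finitely_generated :: "('a, 'b) monoid_scheme \<Rightarrow> bool" where
  "finitely_generated G \<longleftrightarrow> (\<exists>X. finite X \<and> generates G X)"

definition word_value :: "('a, 'b) monoid_scheme \<Rightarrow> 'a list \<Rightarrow> 'a" where
  "word_value G ws = foldr (\<otimes>\<^bsub>G\<^esub>) ws \<one>\<^bsub>G\<^esub>"

text \<open>The following two notions are only meaningful if \<open>X\<close> generates \<open>G\<close>; otherwise
  the \<open>LEAST\<close> below may range over the empty set.\<close>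

definition word_length :: "('a, 'b) monoid_scheme \<Rightarrow> 'a set \<Rightarrow> 'a \<Rightarrow> nat" where
  "word_length G X g =
     (LEAST n. \<exists>ws. set ws \<subseteq> X \<union> m_inv G ` X \<and> length ws = n \<and> word_value G ws = g)"

definition growth_function :: "('a, 'b) monoid_scheme \<Rightarrow> 'a set \<Rightarrow> nat \<Rightarrow> nat" where
  "growth_function G X n = card {g \<in> carrier G. word_length G X g \<le> n}"

section \<open>Exponential growth rates and entropy\<close>

text \<open>For a finite generating set the limit exists, because the growth function is
  submultiplicative.\<close>

definition growth_rate :: "('a, 'b) monoid_scheme \<Rightarrow> 'a set \<Rightarrow> real" where
  "growth_rate G X = lim (\<lambda>n. root n (real (growth_function G X n)))"

text \<open>For finitely generated \<open>G\<close> the infimum is over a nonempty set of reals bounded below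
  by 1.\<close>

definition minimal_growth_rate :: "('a, 'b) monoid_scheme \<Rightarrow> real" where
  "minimal_growth_rate G = (INF X \<in> {X. finite X \<and> generates G X}. growth_rate G X)"

definition entropy :: "('a, 'b) monoid_scheme \<Rightarrow> real" where
  "entropy G = ln (minimal_growth_rate G)"

section \<open>Elementary amenable groups\<close>

text \<open>
  A class of groups cannot range over all types, so the smallest class is formed among the
  groups whose elements lie in a fixed, arbitrary type \<open>'u\<close>. Quotients live in \<open>'u set\<close>, so
  they enter through isomorphic copies in \<open>'u\<close>. The class is closed under isomorphism (take
  the trivial subgroup in \<open>quotient\<close>). In \<open>directed_union\<close>, the member groups are subgroups
  of their union and are represented by their carriers.

  The choice of \<open>'u\<close> is harmless: a subgroup, quotient or extension kernel of a group in \<open>'u\<close>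
  has at most the cardinality of \<open>'u\<close>, and every elementary amenable group can be built from
  abelian and finite groups by extensions and directed unions alone, so without passing
  through groups larger than itself.
\<close>

inductive EG :: "'u monoid \<Rightarrow> bool" where
  abelian: "comm_group G \<Longrightarrow> EG G"
| finite: "group G \<Longrightarrow> finite (carrier G) \<Longrightarrow> EG G"
| subgroup: "EG G \<Longrightarrow> subgroup K G \<Longrightarrow> EG (G\<lparr>carrier := K\<rparr>)"
| quotient: "EG G \<Longrightarrow> N \<lhd> G \<Longrightarrow> group Q \<Longrightarrow> G Mod N \<cong> Q \<Longrightarrow> EG Q"
| extension: "group G \<Longrightarrow> N \<lhd> G \<Longrightarrow> EG (G\<lparr>carrier := N\<rparr>) \<Longrightarrow>
    group Q \<Longrightarrow> G Mod N \<cong> Q \<Longrightarrow> EG Q \<Longrightarrow> EG G"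
| directed_union: "group G \<Longrightarrow>
    (\<And>K. K \<in> \<F> \<Longrightarrow> subgroup K G \<and> EG (G\<lparr>carrier := K\<rparr>)) \<Longrightarrow>
    (\<And>K L. K \<in> \<F> \<Longrightarrow> L \<in> \<F> \<Longrightarrow> \<exists>M \<in> \<F>. K \<union> L \<subseteq> M) \<Longrightarrow>
    \<Union>\<F> = carrier G \<Longrightarrow> EG G"

definition elementary_amenable :: "'u itself \<Rightarrow> ('a, 'b) monoid_scheme \<Rightarrow> bool" where
  "elementary_amenable _ G \<longleftrightarrow> group G \<and> (\<exists>E :: 'u monoid. EG E \<and> G \<cong> E)"

end

theory Submission
  imports Defs "HOL-Computational_Algebra.Fundamental_Theorem_Algebra"
begin

text \<open>Zero entropy provides, for every \<open>C\<close>, a finite generating set in which the ball of radius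
  \<open>C n\<close> has fewer than \<open>2 ^ n\<close> elements for large \<open>n\<close>. Hence an infinite process that inserts
  new elements into a subgroup, while walking through the Cayley graph at bounded cost per insertion,
  must stop. If \<open>G / M\<close> is virtually nilpotent, then all the required relators and group elements are
  commutators of bounded weight in the generators, hence short uniformly in \<open>C\<close>; walking along a
  comb in a polycyclic series then shows that \<open>M\<close> is finitely generated.

  If moreover \<open>M / H\<close> is abelian, then \<open>G / H\<close> is virtually nilpotent again: on an irreducible
  section, short elements satisfy polynomial relations with coefficients in \<open>{-1, 0, 1}\<close>, so that their
  eigenvalues are bounded, and by Kronecker's argument these are roots of unity of bounded order.

  The elementary amenable quotient enters by induction on its construction. A group \<open>E\<close> is tame
  if, whenever \<open>G / M\<close> is virtually nilpotent and \<open>M / N\<close> is a section of \<open>E\<close>, some \<open>H \<le> N\<close> has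
  a virtually nilpotent quotient \<open>G / H\<close>.\<close>

section \<open>Words, balls and subgroups of finite index\<close>

text \<open>The infimum that defines the entropy need not be attained, so a single generating set of
  subexponential growth may not exist: \<open>X\<close> is chosen only after the constant
  \<open>C\<close>. Every length that is measured against \<open>X\<close> must therefore be bounded
  by data fixed beforehand. This is why relators are bracketed commutators, of length at most
  \<open>4 ^ n\<close> in weight \<open>n\<close> whatever \<open>X\<close> is; why Schreier
  generators are bounded by the index alone; and why Kronecker's theorem is needed with exponents up
  to \<open>power_bound r\<close>, which depends on the rank only. The polycyclic series of
  \<open>P / M\<close> is rebuilt from each \<open>X\<close>, and its number of steps is not bounded
  beforehand. Hence the cost of a walk is charged to the insertions it makes and never to the length
  of the series.\<close>

context group
begin

lemma inv_mult_cancel: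
  assumes "x \<in> carrier G" "y \<in> carrier G"
  shows "inv x \<otimes> (x \<otimes> y) = y" and "x \<otimes> (inv x \<otimes> y) = y"
  using assms by (simp_all flip: m_assoc)

lemmas group_simps = m_assoc inv_mult_group inv_mult_cancel

section \<open>Conjugation, commutators and normalizers\<close>

definition conjg :: "'a \<Rightarrow> 'a \<Rightarrow> 'a" where
  "conjg g x = g \<otimes> x \<otimes> inv g"

definition commutator :: "'a \<Rightarrow> 'a \<Rightarrow> 'a" where
  "commutator x y = x \<otimes> y \<otimes> inv x \<otimes> inv y"

text \<open>An equivalence instead of an implication: conjugation by \<open>g\<close> could map an
  infinite \<open>L\<close> properly into itself, and then \<open>inv g\<close> would fail.\<close>

definition normalizes :: "'a \<Rightarrow> 'a set \<Rightarrow> bool" where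
  "normalizes g L \<longleftrightarrow> (\<forall>x\<in>carrier G. conjg g x \<in> L \<longleftrightarrow> x \<in> L)"

lemma conjg_closed [simp]: "g \<in> carrier G \<Longrightarrow> x \<in> carrier G \<Longrightarrow> conjg g x \<in> carrier G"
  by (simp add: conjg_def)

lemma conjg_one [simp]: "x \<in> carrier G \<Longrightarrow> conjg \<one> x = x"
  by (simp add: conjg_def)

lemma conjg_one_right [simp]: "g \<in> carrier G \<Longrightarrow> conjg g \<one> = \<one>"
  by (simp add: conjg_def)

lemma conjg_mult_left:
  "g \<in> carrier G \<Longrightarrow> h \<in> carrier G \<Longrightarrow> x \<in> carrier G \<Longrightarrow> conjg (g \<otimes> h) x = conjg g (conjg h x)"
  by (simp add: conjg_def group_simps)

lemma conjg_mult:
  "g \<in> carrier G \<Longrightarrow> x \<in> carrier G \<Longrightarrow> y \<in> carrier G \<Longrightarrow> conjg g (x \<otimes> y) = conjg g x \<otimes> conjg g y"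
  by (simp add: conjg_def group_simps)

lemma conjg_inv:
  "g \<in> carrier G \<Longrightarrow> x \<in> carrier G \<Longrightarrow> conjg g (inv x) = inv (conjg g x)"
  by (simp add: conjg_def group_simps)

lemma conjg_inv_cancel [simp]:
  "g \<in> carrier G \<Longrightarrow> x \<in> carrier G \<Longrightarrow> conjg (inv g) (conjg g x) = x"
  "g \<in> carrier G \<Longrightarrow> x \<in> carrier G \<Longrightarrow> conjg g (conjg (inv g) x) = x"
  by (simp_all add: conjg_def group_simps)

lemma commutator_closed [simp]:
  "x \<in> carrier G \<Longrightarrow> y \<in> carrier G \<Longrightarrow> commutator x y \<in> carrier G"
  by (simp add: commutator_def)

lemma inv_commutator:
  "x \<in> carrier G \<Longrightarrow> y \<in> carrier G \<Longrightarrow> inv (commutator x y) = commutator y x"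
  by (simp add: commutator_def group_simps)

lemma conjg_commutator:
  "g \<in> carrier G \<Longrightarrow> x \<in> carrier G \<Longrightarrow> y \<in> carrier G \<Longrightarrow>
    conjg g (commutator x y) = commutator (conjg g x) (conjg g y)"
  by (simp add: conjg_def commutator_def group_simps)

lemma conjg_eq_commutator:
  "g \<in> carrier G \<Longrightarrow> x \<in> carrier G \<Longrightarrow> conjg g x = commutator g x \<otimes> x"
  by (simp add: conjg_def commutator_def group_simps)

lemma normalizes_mult:
  assumes "g \<in> carrier G" "h \<in> carrier G" "normalizes g L" "normalizes h L"
  shows "normalizes (g \<otimes> h) L"
  using assms by (simp add: normalizes_def conjg_mult_left)

lemma normalizes_inv:
  assumes "g \<in> carrier G" "normalizes g L"
  shows "normalizes (inv g) L"
  using assms unfolding normalizes_def by (metis conjg_closed conjg_inv_cancel(2) inv_closed)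

lemma normalizes_one [simp]: "normalizes \<one> L"
  by (simp add: normalizes_def)

lemma normalizesI:
  assumes "g \<in> carrier G"
    and "\<And>x. x \<in> carrier G \<Longrightarrow> x \<in> L \<Longrightarrow> conjg g x \<in> L"
    and "\<And>x. x \<in> carrier G \<Longrightarrow> x \<in> L \<Longrightarrow> conjg (inv g) x \<in> L"
  shows "normalizes g L"
  unfolding normalizes_def
proof (intro ballI iffI)
  fix x assume "x \<in> carrier G" "conjg g x \<in> L"
  then show "x \<in> L" using assms(3)[of "conjg g x"] assms(1) by simp
qed (use assms in blast)

lemma normalizes_subgroup:
  assumes "subgroup L G" "g \<in> L"
  shows "normalizes g L"
proof (rule normalizesI)
  show "g \<in> carrier G" using assms subgroup.mem_carrier by metis
  have L: "x \<otimes> y \<in> L" if "x \<in> L" "y \<in> L" for x y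
    using that by (rule subgroup.m_closed[OF assms(1)])
  have L': "inv x \<in> L" if "x \<in> L" for x using that by (rule subgroup.m_inv_closed[OF assms(1)])
  show "conjg g x \<in> L" if "x \<in> L" for x
    unfolding conjg_def by (intro L L' that assms(2))
  show "conjg (inv g) x \<in> L" if "x \<in> L" for x
    unfolding conjg_def by (intro L L' that assms(2))
qed

lemma normalizes_generate:
  assumes "S \<subseteq> carrier G" "\<And>s. s \<in> S \<Longrightarrow> normalizes s L" "g \<in> generate G S"
  shows "normalizes g L"
  using assms(3)
proof induction
  case (inv h)
  then show ?case using assms(1,2) normalizes_inv by blast
next
  case (eng h1 h2)
  then show ?case using normalizes_mult generate_in_carrier[OF assms(1)] by blast
next
  case (incl h)
  then show ?case using assms(2) by blast
qed simp

lemma normalizes_Inter: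
  assumes "\<And>K. K \<in> F \<Longrightarrow> normalizes g K"
  shows "normalizes g (\<Inter>F)"
  using assms unfolding normalizes_def by blast

lemma subgroup_Int_subgroup:
  "subgroup H G \<Longrightarrow> subgroup K G \<Longrightarrow> subgroup (H \<inter> K) G"
  by (rule subgroups_Inter_pair)

section \<open>Balls in the word metric\<close>

definition word_ball :: "'a set \<Rightarrow> nat \<Rightarrow> 'a set" where
  "word_ball X n = {word_value G ws | ws. set ws \<subseteq> X \<union> m_inv G ` X \<and> length ws \<le> n}"

lemma word_value_Nil [simp]: "word_value G [] = \<one>"
  by (simp add: word_value_def)

lemma word_value_Cons [simp]: "word_value G (x # ws) = x \<otimes> word_value G ws"
  by (simp add: word_value_def)

lemma word_value_closed: "set ws \<subseteq> carrier G \<Longrightarrow> word_value G ws \<in> carrier G"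
  by (induction ws) auto

lemma word_value_append:
  "set us \<subseteq> carrier G \<Longrightarrow> set ws \<subseteq> carrier G \<Longrightarrow>
    word_value G (us @ ws) = word_value G us \<otimes> word_value G ws"
  by (induction us) (auto simp: word_value_closed m_assoc)

lemma symmetrized_subset: "X \<subseteq> carrier G \<Longrightarrow> X \<union> m_inv G ` X \<subseteq> carrier G"
  by auto

lemma inv_word_value:
  "set ws \<subseteq> carrier G \<Longrightarrow> inv (word_value G ws) = word_value G (rev (map (m_inv G) ws))"
proof (induction ws)
  case (Cons x ws)
  then have "set (rev (map (m_inv G) ws)) \<subseteq> carrier G" by auto
  with Cons show ?case by (simp add: inv_mult_group word_value_append word_value_closed)
qed simp

lemma finite_word_ball: assumes "finite X" shows "finite (word_ball X n)"
proof -
  have "word_ball X n = word_value G ` {ws. set ws \<subseteq> X \<union> m_inv G ` X \<and> length ws \<le> n}"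
    by (auto simp: word_ball_def)
  with assms show ?thesis by (simp add: finite_lists_length_le)
qed

lemma word_ball_mult:
  assumes "X \<subseteq> carrier G" "x \<in> word_ball X m" "y \<in> word_ball X n"
  shows "x \<otimes> y \<in> word_ball X (m + n)"
proof -
  obtain us ws where u: "x = word_value G us" "set us \<subseteq> X \<union> m_inv G ` X" "length us \<le> m"
    and w: "y = word_value G ws" "set ws \<subseteq> X \<union> m_inv G ` X" "length ws \<le> n"
    using assms by (auto simp: word_ball_def)
  have "x \<otimes> y = word_value G (us @ ws)"
    using u w symmetrized_subset[OF assms(1)] by (subst word_value_append) auto
  then show ?thesis using u w unfolding word_ball_def by (intro CollectI exI[of _ "us @ ws"]) auto
qed

lemma word_ball_inv:
  assumes "X \<subseteq> carrier G" "x \<in> word_ball X m"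
  shows "inv x \<in> word_ball X m"
proof -
  obtain us where u: "x = word_value G us" "set us \<subseteq> X \<union> m_inv G ` X" "length us \<le> m"
    using assms by (auto simp: word_ball_def)
  have "inv x = word_value G (rev (map (m_inv G) us))"
    using u symmetrized_subset[OF assms(1)] by (subst u(1), subst inv_word_value) auto
  moreover have "set (rev (map (m_inv G) us)) \<subseteq> X \<union> m_inv G ` X"
  proof
    fix z assume "z \<in> set (rev (map (m_inv G) us))"
    then obtain y where y: "y \<in> set us" "z = inv y" by auto
    then have "y \<in> X \<or> y \<in> m_inv G ` X" using u by auto
    then show "z \<in> X \<union> m_inv G ` X" using y assms(1) by auto
  qed
  ultimately show ?thesis using u unfolding word_ball_def
    by (intro CollectI exI[of _ "rev (map (m_inv G) us)"]) auto
qed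

lemma word_ball_mono: "m \<le> n \<Longrightarrow> word_ball X m \<subseteq> word_ball X n"
  by (force simp: word_ball_def)

lemma one_in_word_ball [simp]: "\<one> \<in> word_ball X n"
  unfolding word_ball_def by (intro CollectI exI[of _ "[]"]) auto

lemma gen_in_word_ball: "X \<subseteq> carrier G \<Longrightarrow> x \<in> X \<union> m_inv G ` X \<Longrightarrow> x \<in> word_ball X 1"
  unfolding word_ball_def by (intro CollectI exI[of _ "[x]"]) auto

lemma word_ball_subset:
  assumes "X \<subseteq> carrier G"
  shows "word_ball X n \<subseteq> carrier G"
proof
  fix g assume "g \<in> word_ball X n"
  then obtain ws where "g = word_value G ws" "set ws \<subseteq> X \<union> m_inv G ` X"
    unfolding word_ball_def by blast
  then show "g \<in> carrier G"
    using word_value_closed[OF subset_trans[OF _ symmetrized_subset[OF assms]]] by simp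
qed

lemma word_value_in_generate:
  assumes "set ws \<subseteq> X \<union> m_inv G ` X"
  shows "word_value G ws \<in> generate G X"
  using assms
proof (induction ws)
  case (Cons x ws)
  from Cons.prems consider "x \<in> X" | y where "y \<in> X" "x = inv y" by auto
  then have "x \<in> generate G X" by cases (simp_all add: generate.incl generate.inv)
  moreover have "word_value G ws \<in> generate G X" using Cons by simp
  ultimately show ?case unfolding word_value_Cons by (rule generate.eng)
qed (simp add: generate.one)

lemma generate_in_word_ball:
  assumes "X \<subseteq> carrier G" "g \<in> generate G X"
  shows "\<exists>n. g \<in> word_ball X n"
  using assms(2)
proof induction
  case one
  then show ?case by auto
next
  case (incl h)
  then show ?case using gen_in_word_ball[OF assms(1)] by blast
next
  case (inv h)
  then show ?case using gen_in_word_ball[OF assms(1)] by blast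
next
  case (eng h1 h2)
  then show ?case using word_ball_mult[OF assms(1)] by blast
qed

lemma generate_eq_word_balls:
  assumes "X \<subseteq> carrier G"
  shows "generate G X = (\<Union>n. word_ball X n)"
proof
  show "(\<Union>n. word_ball X n) \<subseteq> generate G X"
    by (auto simp: word_ball_def intro: word_value_in_generate)
qed (use generate_in_word_ball[OF assms] in auto)

lemma word_ball_subset_generate: "X \<subseteq> carrier G \<Longrightarrow> word_ball X n \<subseteq> generate G X"
  using generate_eq_word_balls by blast

lemma word_ball_word_ball:
  assumes "X \<subseteq> carrier G" "Y \<subseteq> word_ball X k"
  shows "word_ball Y n \<subseteq> word_ball X (k * n)"
proof -
  have *: "word_value G ws \<in> word_ball X (k * length ws)" if "set ws \<subseteq> Y \<union> m_inv G ` Y" for ws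
    using that
  proof (induction ws)
    case (Cons y ws)
    then have "y \<in> word_ball X k" using assms word_ball_inv by auto
    then show ?case using Cons word_ball_mult[OF assms(1)] by simp
  qed simp
  show ?thesis
  proof
    fix g assume "g \<in> word_ball Y n"
    then obtain ws where ws: "set ws \<subseteq> Y \<union> m_inv G ` Y" "length ws \<le> n" "g = word_value G ws"
      by (auto simp: word_ball_def)
    then have "k * length ws \<le> k * n" by simp
    then show "g \<in> word_ball X (k * n)" using * ws word_ball_mono by blast
  qed
qed

text \<open>Letters are added on the right, the side on which multiplication permutes right
  cosets.\<close>

lemma generate_right_induct [consumes 2, case_names one mult]:
  assumes "X \<subseteq> carrier G" "g \<in> generate G X"
    and "P \<one>" "\<And>g x. g \<in> generate G X \<Longrightarrow> P g \<Longrightarrow> x \<in> X \<union> m_inv G ` X \<Longrightarrow> P (g \<otimes> x)"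
  shows "P g"
proof -
  have "set ws \<subseteq> X \<union> m_inv G ` X \<Longrightarrow> P (word_value G ws)" for ws
  proof (induction ws rule: rev_induct)
    case (snoc x ws)
    have "word_value G (ws @ [x]) = word_value G ws \<otimes> x"
      using snoc symmetrized_subset[OF assms(1)] by (subst word_value_append) auto
    then show ?case using assms(4)[of "word_value G ws" x] snoc word_value_in_generate[of ws X] by simp
  qed (simp add: assms)
  then show ?thesis using generate_in_word_ball[OF assms(1,2)] by (auto simp: word_ball_def)
qed

section \<open>Subgroups of finite index and Schreier generators\<close>

lemma r_coset_eq_iff:
  assumes "subgroup H G" "x \<in> carrier G" "y \<in> carrier G"
  shows "H #> x = H #> y \<longleftrightarrow> x \<otimes> inv y \<in> H"
proof
  assume "H #> x = H #> y"
  then have "x \<in> H #> y" using assms rcos_self by blast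
  then show "x \<otimes> inv y \<in> H"
    using assms subgroup.rcos_module_imp[OF assms(1) is_group] by auto
next
  assume "x \<otimes> inv y \<in> H"
  then have "x \<in> H #> y"
    using assms subgroup.rcos_module_rev[OF assms(1) is_group] by auto
  then show "H #> x = H #> y" using assms repr_independence by metis
qed

text \<open>\<open>T\<close> represents the right cosets of \<open>K\<close> in \<open>P\<close>,
  possibly with repetitions. All subgroups stay inside one ambient group, so that long chains of
  them need no change of carrier.\<close>

definition finite_index :: "'a set \<Rightarrow> 'a set \<Rightarrow> bool" where
  "finite_index K P \<longleftrightarrow> subgroup K G \<and> subgroup P G \<and> K \<subseteq> P \<and>
     (\<exists>T. finite T \<and> T \<subseteq> P \<and> (\<forall>g\<in>P. \<exists>t\<in>T. g \<otimes> inv t \<in> K))"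

lemma finite_indexE:
  assumes "finite_index K P"
  obtains T where "finite T" "T \<subseteq> P" "\<forall>g\<in>P. \<exists>t\<in>T. g \<otimes> inv t \<in> K"
    and "subgroup K G" "subgroup P G" "K \<subseteq> P"
proof -
  from assms obtain T where "finite T" "T \<subseteq> P" "\<forall>g\<in>P. \<exists>t\<in>T. g \<otimes> inv t \<in> K"
    unfolding finite_index_def by (elim conjE exE)
  with assms show thesis by (intro that[of T]) (simp_all add: finite_index_def)
qed

lemma finite_indexD:
  assumes "finite_index K P"
  shows "subgroup K G" "subgroup P G" "K \<subseteq> P"
  using assms by (simp_all add: finite_index_def)

text \<open>There are at most \<open>card T\<close> right cosets, so the cosets met by growing balls
  become stationary within that many steps, and every coset has a representative of length at most
  \<open>card T\<close>. Schreier's products of a representative, a letter and an inverse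
  representative then have length at most \<open>2 * card T + 1\<close>, a bound that does not
  involve \<open>X\<close>.\<close>

lemma schreier_generators:
  assumes "X \<subseteq> carrier G" "generate G X = P" "subgroup K G" "K \<subseteq> P"
    and "finite T" "T \<subseteq> P" "\<forall>g\<in>P. \<exists>t\<in>T. g \<otimes> inv t \<in> K"
  shows "generate G (K \<inter> word_ball X (2 * card T + 1)) = K"
proof -
  let ?c = "\<lambda>g. K #> g"
  let ?d = "card T"
  define Y where "Y = K \<inter> word_ball X (2 * card T + 1)"
  interpret K: subgroup K G by fact
  have PG: "P \<subseteq> carrier G" using assms generate_incl by blast
  have BP: "word_ball X n \<subseteq> P" for n using assms word_ball_subset_generate by blast
  have ceq: "?c x = ?c y \<longleftrightarrow> x \<otimes> inv y \<in> K" if "x \<in> P" "y \<in> P" for x y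
    using r_coset_eq_iff[OF assms(3)] that PG by auto
  have PX: "x \<in> P" if "x \<in> X \<union> m_inv G ` X" for x
    using that by (auto simp flip: assms(2) intro: generate.incl generate.inv)
  have mulP: "x \<otimes> y \<in> P" if "x \<in> P" "y \<in> P" for x y
    using that by (auto simp flip: assms(2) intro: generate.eng)
  have cmul: "?c (x \<otimes> z) = ?c (y \<otimes> z)" if "?c x = ?c y" "x \<in> P" "y \<in> P" "z \<in> P" for x y z
    using that PG mulP coset_mult_assoc[OF K.subset] by (metis subset_iff)
  define U where "U n = ?c ` word_ball X n" for n
  have Usub: "U n \<subseteq> ?c ` T" for n
  proof
    fix y assume "y \<in> U n"
    then obtain b where b: "b \<in> P" "y = ?c b" using BP by (auto simp: U_def)
    obtain t where "t \<in> T" "b \<otimes> inv t \<in> K" using assms(7) b by blast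
    then have "y = ?c t" using ceq[of b t] b assms(6) by auto
    then show "y \<in> ?c ` T" using \<open>t \<in> T\<close> by blast
  qed
  have finU: "finite (U n)" for n using Usub assms(5) finite_subset by blast
  have cardU: "card (U n) \<le> ?d" for n
    using Usub[of n] assms(5) by (meson card_image_le card_mono finite_imageI le_trans)
  have Umono: "U n \<subseteq> U (Suc n)" for n unfolding U_def using word_ball_mono[of n "Suc n" X] by auto
  \<comment> \<open>If \<open>U 0\<close>, ..., \<open>U (Suc ?d)\<close> grew strictly, the last
    would have more than \<open>?d\<close> elements.\<close>
  have "\<exists>n\<le>?d. U n = U (Suc n)"
  proof (rule ccontr)
    assume neg: "\<not> (\<exists>n\<le>?d. U n = U (Suc n))"
    have "n \<le> ?d \<Longrightarrow> n < card (U (Suc n))" for n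
    proof (induction n)
      case 0
      have "?c \<one> \<in> U (Suc 0)" unfolding U_def by (rule imageI) simp
      then show ?case using finU[of "Suc 0"] by (metis card_gt_0_iff empty_iff)
    next
      case (Suc n)
      have "card (U (Suc n)) < card (U (Suc (Suc n)))"
        using neg Suc.prems Umono[of "Suc n"] finU[of "Suc (Suc n)"] by (intro psubset_card_mono) auto
      then show ?case using Suc by simp
    qed
    from this[of ?d] show False using cardU[of "Suc ?d"] by simp
  qed
  then obtain n where n: "n \<le> ?d" "U n = U (Suc n)" by blast
  \<comment> \<open>Once \<open>U n = U (Suc n)\<close>, the set \<open>U n\<close> is closed under
    right multiplication by letters and so contains every coset.\<close>
  have rep: "\<exists>b\<in>word_ball X ?d. ?c g = ?c b" if "g \<in> P" for g
  proof -
    have "g \<in> generate G X" using that assms by simp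
    with assms(1) have "?c g \<in> U n"
    proof (induction rule: generate_right_induct)
      case one
      then show ?case by (auto simp: U_def)
    next
      case (mult g x)
      then obtain b where b: "b \<in> word_ball X n" "?c g = ?c b" by (auto simp: U_def)
      have "b \<otimes> x \<in> word_ball X (Suc n)"
        using word_ball_mult[OF assms(1) b(1) gen_in_word_ball[OF assms(1)]] mult by simp
      moreover have "?c (g \<otimes> x) = ?c (b \<otimes> x)"
        using cmul[OF b(2) _ _ PX[OF mult(2)]] mult(1) BP b(1) assms(2) by auto
      ultimately show ?case using n by (auto simp: U_def)
    qed
    then obtain b where "b \<in> word_ball X n" "?c g = ?c b" unfolding U_def by blast
    then show ?thesis using n(1) word_ball_mono[of n ?d X] by blast
  qed
  have Ysub: "Y \<subseteq> carrier G" by (auto simp: Y_def)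
  \<comment> \<open>For each new letter \<open>x\<close>, the product \<open>b \<otimes> x\<close>
    is replaced by a Schreier generator times the chosen representative \<open>b'\<close>.\<close>
  have decomp: "\<exists>y\<in>generate G Y. \<exists>b\<in>word_ball X ?d. g = y \<otimes> b" if "g \<in> generate G X" for g
    using assms(1) that
  proof (induction rule: generate_right_induct)
    case one
    show ?case by (intro bexI[of _ "\<one>"]) (auto intro: generate.one)
  next
    case (mult g x)
    then obtain y b where yb: "y \<in> generate G Y" "b \<in> word_ball X ?d" "g = y \<otimes> b" by blast
    have bP: "b \<in> P" "x \<in> P" using yb BP mult PX by auto
    obtain b' where b': "b' \<in> word_ball X ?d" "?c (b \<otimes> x) = ?c b'" using rep mulP bP by blast
    have b'P: "b' \<in> P" using b' BP by auto
    have "b \<otimes> x \<otimes> inv b' \<in> word_ball X (?d + 1 + ?d)"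
      using word_ball_mult[OF assms(1) word_ball_mult[OF assms(1) yb(2) gen_in_word_ball[OF assms(1) mult(2)]]
          word_ball_inv[OF assms(1) b'(1)]] .
    then have "b \<otimes> x \<otimes> inv b' \<in> Y" unfolding Y_def
      using ceq b' b'P mulP bP by (simp add: mult_2)
    then have "y \<otimes> (b \<otimes> x \<otimes> inv b') \<in> generate G Y" using yb(1) by (blast intro: generate.eng generate.incl)
    moreover have "g \<otimes> x = y \<otimes> (b \<otimes> x \<otimes> inv b') \<otimes> b'"
    proof -
      have "b \<in> carrier G" "x \<in> carrier G" "b' \<in> carrier G" "y \<in> carrier G"
        using bP b'P PG yb Ysub generate_in_carrier by auto
      then show ?thesis using yb by (simp add: group_simps)
    qed
    ultimately show ?case using b' by blast
  qed
  have "K \<subseteq> generate G Y"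
  proof
    fix g assume g: "g \<in> K"
    then obtain y b where yb: "y \<in> generate G Y" "b \<in> word_ball X ?d" "g = y \<otimes> b"
      using decomp assms(2,4) by blast
    have "y \<in> K" using yb generate_subgroup_incl[OF _ assms(3), of Y] by (auto simp: Y_def)
    have "b = inv y \<otimes> g" using yb(3) \<open>y \<in> K\<close> yb(2) BP PG
      by (metis K.mem_carrier inv_mult_cancel(1) subset_iff)
    then have "b \<in> K" using \<open>y \<in> K\<close> g by simp
    then have "b \<in> Y" using yb word_ball_mono[of ?d "2 * ?d + 1" X] by (auto simp: Y_def)
    then show "g \<in> generate G Y" unfolding yb(3) using yb(1) by (blast intro: generate.eng generate.incl)
  qed
  moreover have "generate G Y \<subseteq> K" using generate_subgroup_incl[OF _ assms(3), of Y] by (auto simp: Y_def)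
  ultimately show ?thesis by (auto simp: Y_def)
qed

definition fg_subgroup :: "'a set \<Rightarrow> bool" where
  "fg_subgroup L \<longleftrightarrow> (\<exists>X. finite X \<and> X \<subseteq> carrier G \<and> generate G X = L)"

lemma fg_subgroupE:
  assumes "fg_subgroup L"
  obtains X where "finite X" "X \<subseteq> carrier G" "generate G X = L"
  using assms unfolding fg_subgroup_def by (elim exE conjE)

text \<open>The form in which zero entropy is used, relative to a subgroup \<open>P\<close> of the
  ambient group. The set \<open>X\<close> may depend on \<open>C\<close>; the base 2 is the factor
  by which one insertion multiplies a finite set in the counting argument.\<close>

definition slow :: "'a set \<Rightarrow> bool" where
  "slow P \<longleftrightarrow> (\<forall>C. \<exists>X. finite X \<and> X \<subseteq> carrier G \<and> generate G X = P \<and>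
     (\<exists>n0. \<forall>n\<ge>n0. card (word_ball X (C * n)) < 2 ^ n))"

lemma fg_subgroup_is_subgroup: "fg_subgroup P \<Longrightarrow> subgroup P G"
  unfolding fg_subgroup_def using generate_is_subgroup by blast

text \<open>The Schreier bound \<open>2 * card T + 1\<close> does not depend on the generating set,
  so it is absorbed into the constant before \<open>X\<close> is chosen.\<close>

lemma finite_index_slow:
  assumes "finite_index K P" "slow P"
  shows "slow K"
  unfolding slow_def
proof
  fix C
  obtain T where T: "finite T" "T \<subseteq> P" "\<forall>g\<in>P. \<exists>t\<in>T. g \<otimes> inv t \<in> K" and K: "subgroup K G" "subgroup P G" "K \<subseteq> P"
    using assms(1) by (rule finite_indexE)
  let ?d = "2 * card T + 1"
  obtain X n0 where X: "finite X" "X \<subseteq> carrier G" "generate G X = P"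
    and n0: "\<And>n. n \<ge> n0 \<Longrightarrow> card (word_ball X (?d * C * n)) < 2 ^ n"
    using assms(2) unfolding slow_def by blast
  let ?Y = "K \<inter> word_ball X ?d"
  have gen: "generate G ?Y = K" using schreier_generators[OF X(2,3) K(1,3) T] .
  have "card (word_ball ?Y (C * n)) < 2 ^ n" if "n \<ge> n0" for n
  proof -
    have "word_ball ?Y (C * n) \<subseteq> word_ball X (?d * (C * n))"
      by (rule word_ball_word_ball[OF X(2)]) auto
    then have "card (word_ball ?Y (C * n)) \<le> card (word_ball X (?d * C * n))"
      using card_mono[OF finite_word_ball[OF X(1)]] by (metis mult.assoc)
    then show ?thesis using n0[OF that] by simp
  qed
  moreover have "?Y \<subseteq> carrier G" using subgroup.subset[OF K(1)] by auto
  moreover have "finite ?Y" using finite_word_ball[OF X(1)] by simp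
  ultimately show "\<exists>X. finite X \<and> X \<subseteq> carrier G \<and> generate G X = K \<and>
     (\<exists>n0. \<forall>n\<ge>n0. card (word_ball X (C * n)) < 2 ^ n)"
    using gen by blast
qed

text \<open>The label \<open>f\<close> need not be constant on cosets; it only has to separate
  different ones, and one element for each label gives \<open>T\<close>.\<close>

lemma finite_indexI:
  assumes "subgroup K G" "subgroup P G" "K \<subseteq> P" "finite (f ` P)"
    and "\<And>g h. g \<in> P \<Longrightarrow> h \<in> P \<Longrightarrow> f g = f h \<Longrightarrow> g \<otimes> inv h \<in> K"
  shows "finite_index K P"
proof -
  define T where "T = (\<lambda>y. SOME h. h \<in> P \<and> f h = y) ` f ` P"
  have *: "(SOME h. h \<in> P \<and> f h = f g) \<in> P \<and> f (SOME h. h \<in> P \<and> f h = f g) = f g" if "g \<in> P" for g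
    using someI[of "\<lambda>h. h \<in> P \<and> f h = f g" g] that by simp
  have "finite T" unfolding T_def using assms(4) by simp
  moreover have "T \<subseteq> P" using * by (auto simp: T_def)
  moreover have "\<exists>t\<in>T. g \<otimes> inv t \<in> K" if "g \<in> P" for g
  proof
    let ?t = "SOME h. h \<in> P \<and> f h = f g"
    show "g \<otimes> inv ?t \<in> K" using *[OF that] assms(5)[OF that, of ?t] by simp
    show "?t \<in> T" unfolding T_def using that by blast
  qed
  ultimately show ?thesis unfolding finite_index_def using assms(1-3) by blast
qed

lemma finite_index_cosets:
  assumes "finite_index K P"
  shows "finite ((\<lambda>g. K #> g) ` P)"
proof -
  obtain T where T: "finite T" "T \<subseteq> P" "\<forall>g\<in>P. \<exists>t\<in>T. g \<otimes> inv t \<in> K" and K: "subgroup K G" "subgroup P G" "K \<subseteq> P"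
    using assms by (rule finite_indexE)
  have "(\<lambda>g. K #> g) ` P \<subseteq> (\<lambda>g. K #> g) ` T"
  proof clarify
    fix g assume "g \<in> P"
    with T(3) obtain t where "t \<in> T" "g \<otimes> inv t \<in> K" by blast
    moreover from this have "K #> g = K #> t"
      using r_coset_eq_iff[OF K(1)] \<open>g \<in> P\<close> T(2) subgroup.subset[OF K(2)] by blast
    ultimately show "K #> g \<in> (\<lambda>g. K #> g) ` T" by blast
  qed
  with T(1) show ?thesis using finite_subset by blast
qed

lemma finite_index_refl:
  assumes "subgroup P G"
  shows "finite_index P P"
proof -
  have "\<forall>g\<in>P. \<exists>t\<in>{\<one>}. g \<otimes> inv t \<in> P"
    using subgroup.mem_carrier[OF assms] by simp
  moreover have "{\<one>} \<subseteq> P" using subgroup.one_closed[OF assms] by simp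
  ultimately show ?thesis unfolding finite_index_def using assms by blast
qed

lemma finite_index_trans:
  assumes "finite_index L K" "finite_index K P"
  shows "finite_index L P"
proof -
  obtain S where S: "finite S" "S \<subseteq> K" "\<forall>g\<in>K. \<exists>t\<in>S. g \<otimes> inv t \<in> L"
    and L: "subgroup L G" "subgroup K G" "L \<subseteq> K" using assms(1) by (rule finite_indexE)
  obtain T where T: "finite T" "T \<subseteq> P" "\<forall>g\<in>P. \<exists>t\<in>T. g \<otimes> inv t \<in> K"
    and K: "subgroup K G" "subgroup P G" "K \<subseteq> P" using assms(2) by (rule finite_indexE)
  let ?R = "(\<lambda>(s, t). s \<otimes> t) ` (S \<times> T)"
  have "\<exists>r\<in>?R. g \<otimes> inv r \<in> L" if g: "g \<in> P" for g
  proof -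
    obtain t where t: "t \<in> T" "g \<otimes> inv t \<in> K" using T g by blast
    obtain s where s: "s \<in> S" "g \<otimes> inv t \<otimes> inv s \<in> L" using S t by blast
    have "g \<in> carrier G" "t \<in> carrier G" "s \<in> carrier G"
      using g t(1) s(1) T(2) S(2) K(3) subgroup.subset[OF K(2)] by auto
    then have "g \<otimes> inv (s \<otimes> t) \<in> L" using s(2) by (simp add: group_simps)
    moreover have "s \<otimes> t \<in> ?R" using s(1) t(1) by auto
    ultimately show ?thesis by blast
  qed
  moreover have "?R \<subseteq> P"
    using S(2) T(2) K(3) L(3) by (auto intro!: subgroup.m_closed[OF K(2)])
  moreover have "finite ?R" "L \<subseteq> P" using S(1) T(1) L(3) K(3) by auto
  ultimately show ?thesis using L(1) K(2) unfolding finite_index_def by blast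
qed

lemma finite_index_Int:
  assumes "finite_index K P" "subgroup Q G" "Q \<subseteq> P"
  shows "finite_index (K \<inter> Q) Q"
proof (rule finite_indexI[where f = "\<lambda>g. K #> g"])
  have K: "subgroup K G" "subgroup P G" using finite_indexD[OF assms(1)] by blast+
  show "subgroup (K \<inter> Q) G" using K(1) assms(2) by (rule subgroup_Int_subgroup)
  show "finite ((#>) K ` Q)"
    using finite_subset[OF image_mono[OF assms(3)] finite_index_cosets[OF assms(1)]] .
  show "g \<otimes> inv h \<in> K \<inter> Q" if "g \<in> Q" "h \<in> Q" "K #> g = K #> h" for g h
  proof -
    have "g \<in> carrier G" "h \<in> carrier G" using that(1,2) subgroup.subset[OF assms(2)] by auto
    moreover have "g \<otimes> inv h \<in> Q"
      by (intro subgroup.m_closed[OF assms(2)] subgroup.m_inv_closed[OF assms(2)] that(1,2))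
    ultimately show ?thesis using that(3) r_coset_eq_iff[OF K(1), of g h] by simp
  qed
  show "subgroup Q G" "K \<inter> Q \<subseteq> Q" using assms(2) by blast+
qed

lemma finite_index_Int2:
  assumes "finite_index K P" "finite_index L P"
  shows "finite_index (K \<inter> L) P"
proof -
  have "subgroup L G" "L \<subseteq> P" using finite_indexD[OF assms(2)] by blast+
  then show ?thesis using finite_index_trans[OF finite_index_Int[OF assms(1)] assms(2)] by simp
qed

lemma finite_index_Inter:
  assumes "finite F" "subgroup P G" "\<And>K. K \<in> F \<Longrightarrow> finite_index K P"
  shows "finite_index (P \<inter> \<Inter>F) P"
  using assms(1,3)
proof (induction F)
  case empty
  then show ?case using finite_index_refl[OF assms(2)] by simp
next
  case (insert K F)
  have "P \<inter> \<Inter>(insert K F) = K \<inter> (P \<inter> \<Inter>F)" by auto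
  then show ?case using insert finite_index_Int2[of K P "P \<inter> \<Inter>F"] by simp
qed

lemma fg_generate_insert:
  assumes "fg_subgroup L" "finite Y" "Y \<subseteq> carrier G"
  shows "fg_subgroup (generate G (L \<union> Y))"
proof -
  obtain X where X: "finite X" "X \<subseteq> carrier G" "generate G X = L" using assms(1) by (rule fg_subgroupE)
  have "generate G (L \<union> Y) = generate G (X \<union> Y)"
  proof
    have "L \<subseteq> generate G (X \<union> Y)" unfolding X(3)[symmetric] by (intro mono_generate) simp
    moreover have "Y \<subseteq> generate G (X \<union> Y)" by (auto intro: generate.incl)
    ultimately show "generate G (L \<union> Y) \<subseteq> generate G (X \<union> Y)"
      using X(2) assms(3) by (intro generate_subgroup_incl generate_is_subgroup) auto
    have "X \<subseteq> L" unfolding X(3)[symmetric] by (auto intro: generate.incl)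
    then show "generate G (X \<union> Y) \<subseteq> generate G (L \<union> Y)" by (intro mono_generate) auto
  qed
  then show ?thesis unfolding fg_subgroup_def using X(1,2) assms(2,3) by (intro exI[of _ "X \<union> Y"]) simp
qed

lemma finite_index_fg_up:
  assumes "finite_index K P" "fg_subgroup K"
  shows "fg_subgroup P"
proof -
  obtain T where T: "finite T" "T \<subseteq> P" "\<forall>g\<in>P. \<exists>t\<in>T. g \<otimes> inv t \<in> K"
    and K: "subgroup K G" "subgroup P G" "K \<subseteq> P" using assms(1) by (rule finite_indexE)
  have "P \<subseteq> generate G (K \<union> T)"
  proof
    fix g assume g: "g \<in> P"
    then obtain t where t: "t \<in> T" "g \<otimes> inv t \<in> K" using T by blast
    then have "g \<otimes> inv t \<otimes> t \<in> generate G (K \<union> T)" by (simp add: generate.eng generate.incl)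
    moreover have "g \<in> carrier G" "t \<in> carrier G" using g t T(2) subgroup.subset[OF K(2)] by auto
    then have "g \<otimes> inv t \<otimes> t = g" by (simp add: m_assoc)
    ultimately show "g \<in> generate G (K \<union> T)" by simp
  qed
  moreover have "generate G (K \<union> T) \<subseteq> P" using generate_subgroup_incl[OF _ K(2), of "K \<union> T"] K T by blast
  ultimately have "P = generate G (K \<union> T)" by blast
  then show ?thesis using fg_generate_insert[OF assms(2) T(1)] T(2) subgroup.subset[OF K(2)] by auto
qed

end

section \<open>Zero entropy\<close>

text \<open>Fekete's lemma. For \<open>m\<close> with \<open>a m / m\<close> close to the infimum,
  write \<open>n = q * m + s\<close> with \<open>s < m\<close>; the remainder \<open>a s\<close> is
  bounded and disappears after division by \<open>n\<close>.\<close>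

lemma fekete_convergent:
  fixes a :: "nat \<Rightarrow> real"
  assumes sub: "\<And>m n. a (m + n) \<le> a m + a n" and nonneg: "\<And>n. 0 \<le> a n"
  shows "convergent (\<lambda>n. a n / n)"
proof -
  define L where "L = (INF n\<in>{1..}. a n / real n)"
  have bdd: "bdd_below ((\<lambda>n. a n / real n) ` {1..})"
    by (rule bdd_belowI2[where m = 0]) (simp add: nonneg)
  have lower: "L \<le> a n / n" if "n \<ge> 1" for n
    unfolding L_def using that by (intro cINF_lower bdd) simp
  have mult: "a (q * m + s) \<le> real q * a m + a s" for q m s
  proof (induction q)
    case (Suc q)
    have "a (Suc q * m + s) \<le> a m + a (q * m + s)" using sub[of m "q * m + s"] by (simp add: add.assoc)
    with Suc show ?case by (simp add: algebra_simps)
  qed simp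
  have "(\<lambda>n. a n / n) \<longlonglongrightarrow> L"
  proof (rule LIMSEQ_I)
    fix e :: real assume e: "0 < e"
    have "\<exists>m\<in>{1..}. a m / real m < L + e / 2"
    proof (rule ccontr)
      assume "\<not> (\<exists>m\<in>{1..}. a m / real m < L + e / 2)"
      then have "L + e / 2 \<le> L" unfolding L_def[of ] by (intro cINF_greatest) (auto simp: not_less L_def)
      then show False using e by simp
    qed
    then obtain m where m: "m \<ge> 1" "a m / real m < L + e / 2" by auto
    define B where "B = Max (a ` {..<m})"
    have B: "a s \<le> B" if "s < m" for s unfolding B_def using that by (intro Max_ge) auto
    have B0: "0 \<le> B" using B[of 0] nonneg[of 0] m(1) by linarith
    obtain N where N: "real N > 2 * B / e" using reals_Archimedean2 by blast
    show "\<exists>n0. \<forall>n\<ge>n0. norm (a n / n - L) < e"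
    proof (intro exI allI impI)
      fix n assume n: "n \<ge> Suc N"
      then have n1: "real n > 0" "n \<ge> 1" by auto
      define q where "q = n div m"
      have "a n = a (q * m + n mod m)" by (simp add: q_def)
      also have "\<dots> \<le> real q * a m + a (n mod m)" by (rule mult)
      also have "\<dots> \<le> real q * a m + B" using B[of "n mod m"] m(1) by simp
      finally have an: "a n \<le> real q * a m + B" .
      have "q * m \<le> n" by (simp add: q_def)
      then have qm: "real q * real m \<le> real n" by (metis of_nat_mult of_nat_le_iff)
      have "real q * a m = (real q * real m) * (a m / real m)" using m(1) by simp
      also have "\<dots> \<le> real n * (a m / real m)" using qm nonneg[of m] by (intro mult_right_mono) simp_all
      also have "\<dots> \<le> real n * (L + e / 2)" using m(2) by (intro mult_left_mono) simp_all
      finally have 1: "a n \<le> real n * (L + e / 2) + B" using an by simp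
      have "real n > 2 * B / e" using N n by linarith
      then have "B < real n * (e / 2)" using e by (simp add: field_simps)
      then have "a n < real n * (L + e)" using 1 by (simp add: algebra_simps)
      then have "a n / n < L + e" using n1 by (simp add: field_simps)
      then show "norm (a n / n - L) < e" using lower[OF n1(2)] by simp
    qed
  qed
  then show ?thesis by (rule convergentI)
qed

context group
begin

text \<open>The \<open>LEAST\<close> in \<open>word_length\<close> is attained because
  \<open>X\<close> generates.\<close>

lemma growth_function_eq_card_word_ball:
  assumes X: "X \<subseteq> carrier G" "generate G X = carrier G"
  shows "growth_function G X n = card (word_ball X n)"
proof -
  have "{g \<in> carrier G. word_length G X g \<le> n} = word_ball X n"
  proof (intro equalityI subsetI)
    fix g assume "g \<in> {g \<in> carrier G. word_length G X g \<le> n}"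
    then have g: "g \<in> carrier G" "word_length G X g \<le> n" by auto
    obtain k where "g \<in> word_ball X k" using generate_in_word_ball[OF X(1)] X(2) g(1) by blast
    then have "\<exists>m ws. set ws \<subseteq> X \<union> m_inv G ` X \<and> length ws = m \<and> word_value G ws = g"
      by (auto simp: word_ball_def)
    from LeastI_ex[OF this] obtain ws where "set ws \<subseteq> X \<union> m_inv G ` X"
      "length ws = word_length G X g" "word_value G ws = g" unfolding word_length_def by blast
    then show "g \<in> word_ball X n" using g(2) unfolding word_ball_def by (intro CollectI exI[of _ ws]) simp
  next
    fix g assume g: "g \<in> word_ball X n"
    then obtain ws where ws: "set ws \<subseteq> X \<union> m_inv G ` X" "length ws \<le> n" "word_value G ws = g"
      unfolding word_ball_def by blast
    have "word_length G X g \<le> length ws" unfolding word_length_def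
      using ws by (intro Least_le exI[of _ ws]) simp
    then show "g \<in> {g \<in> carrier G. word_length G X g \<le> n}"
      using ws(2) g word_ball_subset[OF X(1)] by auto
  qed
  then show ?thesis by (simp add: growth_function_def)
qed

lemma card_word_ball_add:
  assumes "finite X" "X \<subseteq> carrier G"
  shows "card (word_ball X (m + n)) \<le> card (word_ball X m) * card (word_ball X n)"
proof -
  let ?P = "word_ball X m \<times> word_ball X n"
  have "word_ball X (m + n) \<subseteq> (\<lambda>(x, y). x \<otimes> y) ` ?P"
  proof
    fix g assume "g \<in> word_ball X (m + n)"
    then obtain ws where ws: "set ws \<subseteq> X \<union> m_inv G ` X" "length ws \<le> m + n" "g = word_value G ws"
      unfolding word_ball_def by blast
    have sub: "set (take m ws) \<subseteq> X \<union> m_inv G ` X" "set (drop m ws) \<subseteq> X \<union> m_inv G ` X"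
      using ws(1) set_take_subset set_drop_subset by fast+
    have "g = word_value G (take m ws @ drop m ws)" using ws(3) by simp
    also have "\<dots> = word_value G (take m ws) \<otimes> word_value G (drop m ws)"
      using sub symmetrized_subset[OF assms(2)] by (intro word_value_append) blast+
    finally have "g = word_value G (take m ws) \<otimes> word_value G (drop m ws)" .
    moreover have "length (take m ws) \<le> m" "length (drop m ws) \<le> n" using ws(2) by auto
    then have "word_value G (take m ws) \<in> word_ball X m" "word_value G (drop m ws) \<in> word_ball X n"
      unfolding word_ball_def using sub by blast+
    ultimately show "g \<in> (\<lambda>(x, y). x \<otimes> y) ` ?P" by force
  qed
  moreover have "finite ?P" using finite_word_ball[OF assms(1)] by simp
  ultimately have "card (word_ball X (m + n)) \<le> card ?P"
    by (meson card_image_le card_mono finite_imageI le_trans)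
  then show ?thesis by (simp add: card_cartesian_product)
qed

text \<open>\<open>growth_rate\<close> is defined by \<open>lim\<close>, which carries information
  only for convergent sequences. Convergence comes from Fekete's lemma, applied to the logarithms of
  the ball sizes.\<close>

lemma growth_rate_LIMSEQ:
  assumes "finite X" "generates G X"
  shows "(\<lambda>n. root n (real (growth_function G X n))) \<longlonglongrightarrow> growth_rate G X"
    and "growth_rate G X \<ge> 1"
proof -
  have X: "X \<subseteq> carrier G" "generate G X = carrier G" using assms(2) by (simp_all add: generates_def)
  let ?c = "\<lambda>n. real (card (word_ball X n))"
  have c1: "?c n \<ge> 1" for n
  proof -
    have "word_ball X n \<noteq> {}" using one_in_word_ball by blast
    then have "card (word_ball X n) > 0" using finite_word_ball[OF assms(1)] card_gt_0_iff by blast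
    then show ?thesis by simp
  qed
  have "ln (?c (m + n)) \<le> ln (?c m) + ln (?c n)" for m n
  proof -
    have "?c (m + n) \<le> ?c m * ?c n"
      using card_word_ball_add[OF assms(1) X(1), of m n] by (simp flip: of_nat_mult)
    then have "ln (?c (m + n)) \<le> ln (?c m * ?c n)" using c1[of "m + n"] by simp
    also have "\<dots> = ln (?c m) + ln (?c n)" using c1[of m] c1[of n] by (intro ln_mult_pos) linarith+
    finally show ?thesis .
  qed
  moreover have "0 \<le> ln (?c n)" for n using c1[of n] by simp
  ultimately have "convergent (\<lambda>n. ln (?c n) / n)"
    by (rule fekete_convergent)
  then obtain L where L: "(\<lambda>n. ln (?c n) / n) \<longlonglongrightarrow> L" unfolding convergent_def by blast
  have "(\<lambda>n. exp (ln (?c n) / n)) \<longlonglongrightarrow> exp L" by (intro tendsto_exp L)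
  moreover have "\<forall>\<^sub>F n in sequentially. exp (ln (?c n) / n) = root n (real (growth_function G X n))"
    using eventually_gt_at_top[of 0]
  proof eventually_elim
    case (elim n)
    have "root n (?c n) = ?c n powr (1 / n)" using elim c1[of n] by (intro root_powr_inverse) linarith+
    also have "\<dots> = exp (ln (?c n) / n)" using c1[of n] by (simp add: powr_def)
    finally show ?case by (simp add: growth_function_eq_card_word_ball[OF X])
  qed
  ultimately have lim: "(\<lambda>n. root n (real (growth_function G X n))) \<longlonglongrightarrow> exp L"
    by (rule Lim_transform_eventually)
  then have eq: "growth_rate G X = exp L" unfolding growth_rate_def by (rule limI)
  show lim': "(\<lambda>n. root n (real (growth_function G X n))) \<longlonglongrightarrow> growth_rate G X" using lim eq by simp
  have "root n (real (growth_function G X n)) \<ge> 1" if "n \<ge> 1" for n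
    using that c1[of n] by (simp add: growth_function_eq_card_word_ball[OF X])
  then show "growth_rate G X \<ge> 1" using lim' by (intro LIMSEQ_le_const[OF lim']) blast
qed

lemma slow_of_entropy_zero:
  assumes "finitely_generated G" "entropy G = 0"
  shows "slow (carrier G)"
proof -
  let ?S = "{X. finite X \<and> generates G X}"
  have ne: "?S \<noteq> {}" using assms(1) by (auto simp: finitely_generated_def)
  \<comment> \<open>The lower bound 1 excludes arguments that are not positive, where the total
    function \<open>ln\<close> has conventional values.\<close>
  have ge: "minimal_growth_rate G \<ge> 1"
    unfolding minimal_growth_rate_def using ne growth_rate_LIMSEQ(2) by (intro cINF_greatest) auto
  then have m1: "minimal_growth_rate G = 1" using assms(2) unfolding entropy_def by simp
  have ex: "\<exists>X\<in>?S. growth_rate G X < c" if "c > 1" for c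
  proof (rule ccontr)
    assume "\<not> (\<exists>X\<in>?S. growth_rate G X < c)"
    then have "c \<le> minimal_growth_rate G"
      unfolding minimal_growth_rate_def using ne by (intro cINF_greatest) (auto simp: not_less)
    then show False using m1 that by simp
  qed
  show ?thesis unfolding slow_def
  proof
    fix C :: nat
    \<comment> \<open>The successor avoids a root of order 0. A growth rate below \<open>c\<close>
      bounds the ball of radius \<open>?C * n\<close> by
      \<open>c ^ (?C * n) = 2 ^ n\<close>.\<close>
    let ?C = "Suc C"
    define c where "c = root ?C 2"
    have c: "c > 1" "c ^ ?C = 2" by (simp_all add: c_def del: power_Suc)
    obtain X where X: "finite X" "generates G X" "growth_rate G X < c" using ex[OF c(1)] by blast
    have XG: "X \<subseteq> carrier G" "generate G X = carrier G" using X(2) by (simp_all add: generates_def)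
    have "\<forall>\<^sub>F n in sequentially. root n (real (growth_function G X n)) < c"
      using order_tendstoD(2)[OF growth_rate_LIMSEQ(1)[OF X(1,2)] X(3)] .
    then obtain N where N: "\<And>n. n \<ge> N \<Longrightarrow> root n (real (growth_function G X n)) < c"
      unfolding eventually_sequentially by blast
    have "card (word_ball X (C * n)) < 2 ^ n" if n: "n \<ge> Suc N" for n
    proof -
      have pos: "?C * n > 0" "?C * n \<ge> N" using n by auto
      let ?b = "real (card (word_ball X (?C * n)))"
      have "root (?C * n) ?b < c"
        using N[OF pos(2)] by (simp only: growth_function_eq_card_word_ball[OF XG])
      then have "root (?C * n) ?b ^ (?C * n) < c ^ (?C * n)"
        using pos(1) by (intro power_strict_mono) simp_all
      moreover have "root (?C * n) ?b ^ (?C * n) = ?b" using pos(1) by (intro real_root_pow_pos2) simp_all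
      moreover have "c ^ (?C * n) = 2 ^ n" using c(2) by (simp only: power_mult)
      ultimately have "?b < 2 ^ n" by simp
      then have "real (card (word_ball X (?C * n))) < real (2 ^ n)" by simp
      then have "card (word_ball X (?C * n)) < 2 ^ n" by (simp only: of_nat_less_iff)
      moreover have "card (word_ball X (C * n)) \<le> card (word_ball X (?C * n))"
        by (intro card_mono finite_word_ball X(1) word_ball_mono) simp
      ultimately show ?thesis by simp
    qed
    then show "\<exists>X. finite X \<and> X \<subseteq> carrier G \<and> generate G X = carrier G \<and>
      (\<exists>n0. \<forall>n\<ge>n0. card (word_ball X (C * n)) < 2 ^ n)"
      using X(1) XG by blast
  qed
qed

end

section \<open>Walks that collect conjugates\<close>

context group
begin

lemma mem_conjg_image:
  assumes "t \<in> carrier G" "x \<in> carrier G" "L \<subseteq> carrier G"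
  shows "x \<in> conjg t ` L \<longleftrightarrow> conjg (inv t) x \<in> L"
proof
  assume "x \<in> conjg t ` L"
  then obtain y where "y \<in> L" "x = conjg t y" by blast
  then show "conjg (inv t) x \<in> L" using assms by auto
next
  assume "conjg (inv t) x \<in> L"
  moreover have "x = conjg t (conjg (inv t) x)" using assms by simp
  ultimately show "x \<in> conjg t ` L" by blast
qed

lemma conjg_image_subset: "t \<in> carrier G \<Longrightarrow> L \<subseteq> carrier G \<Longrightarrow> conjg t ` L \<subseteq> carrier G"
  by auto

lemma conjg_image_cancel:
  assumes "t \<in> carrier G" "L \<subseteq> carrier G"
  shows "conjg t ` conjg (inv t) ` L = L" "conjg (inv t) ` conjg t ` L = L"
  using assms by (force simp: image_image subset_iff)+

lemma conjg_image_normalized: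
  assumes "t \<in> carrier G" "L \<subseteq> carrier G" "normalizes t L"
  shows "conjg t ` L = L"
proof
  show "conjg t ` L \<subseteq> L" using assms unfolding normalizes_def by auto
  show "L \<subseteq> conjg t ` L"
  proof
    fix x assume x: "x \<in> L"
    have "x \<in> carrier G" using x assms(2) by auto
    have "conjg (inv t) x \<in> L"
      using normalizes_inv[OF assms(1,3)] x \<open>x \<in> carrier G\<close> unfolding normalizes_def by simp
    then show "x \<in> conjg t ` L" using mem_conjg_image assms(1,2) \<open>x \<in> carrier G\<close> by simp
  qed
qed

lemma conjg_hom: "t \<in> carrier G \<Longrightarrow> conjg t \<in> hom G G"
  by (auto simp: hom_def conjg_mult)

lemma conjg_group_hom:
  assumes "t \<in> carrier G" shows "group_hom G G (conjg t)"
  by (rule group_hom.intro) (use assms conjg_hom is_group in \<open>auto simp: group_hom_axioms_def\<close>)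

lemma conjg_image_subgroup:
  assumes "t \<in> carrier G" "subgroup L G"
  shows "subgroup (conjg t ` L) G"
  using group_hom.subgroup_img_is_subgroup[OF conjg_group_hom[OF assms(1)] assms(2)] .

lemma conjg_image_fg:
  assumes "t \<in> carrier G" "fg_subgroup L"
  shows "fg_subgroup (conjg t ` L)"
proof -
  obtain X where X: "finite X" "X \<subseteq> carrier G" "generate G X = L" using assms(2) by (rule fg_subgroupE)
  have "generate G (conjg t ` X) = conjg t ` L"
    using group_hom.generate_img[OF conjg_group_hom[OF assms(1)] X(2)] X(3) by simp
  then show ?thesis unfolding fg_subgroup_def
    using X(1) conjg_image_subset[OF assms(1) X(2)] by (metis finite_imageI)
qed

lemma normalizes_conjg_image:
  assumes "t \<in> carrier G" "s \<in> carrier G" "L \<subseteq> carrier G" "normalizes (inv t \<otimes> s \<otimes> t) L"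
  shows "normalizes s (conjg t ` L)"
  unfolding normalizes_def
proof
  fix x assume x: "x \<in> carrier G"
  have "conjg (inv t) (conjg s x) = conjg (inv t \<otimes> s \<otimes> t) (conjg (inv t) x)"
    using assms(1,2) x by (simp add: conjg_def group_simps)
  moreover have "conjg s x \<in> conjg t ` L \<longleftrightarrow> conjg (inv t) (conjg s x) \<in> L"
    using assms(1-3) x by (intro mem_conjg_image) auto
  moreover have "x \<in> conjg t ` L \<longleftrightarrow> conjg (inv t) x \<in> L"
    using assms(1-3) x by (intro mem_conjg_image) auto
  moreover have "conjg (inv t \<otimes> s \<otimes> t) (conjg (inv t) x) \<in> L \<longleftrightarrow> conjg (inv t) x \<in> L"
    using assms(4) assms(1) x unfolding normalizes_def by simp
  ultimately show "conjg s x \<in> conjg t ` L \<longleftrightarrow> x \<in> conjg t ` L" by simp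
qed

text \<open>For trivial \<open>L\<close> and \<open>T\<close> generating \<open>P\<close> this is
  the normal closure of \<open>A\<close> under \<open>P\<close>. A general \<open>L\<close> records
  what a walk has already collected.\<close>

definition closure_under :: "'a set \<Rightarrow> 'a set \<Rightarrow> 'a set \<Rightarrow> 'a set" where
  "closure_under A T L = \<Inter>{K. subgroup K G \<and> L \<subseteq> K \<and> A \<subseteq> K \<and> (\<forall>t\<in>T. normalizes t K)}"

lemma normalizes_carrier: "t \<in> carrier G \<Longrightarrow> normalizes t (carrier G)"
  by (simp add: normalizes_def)

lemma closure_under_subgroup:
  assumes "T \<subseteq> carrier G" "A \<subseteq> carrier G" "L \<subseteq> carrier G"
  shows "subgroup (closure_under A T L) G"
proof -
  have "carrier G \<in> {K. subgroup K G \<and> L \<subseteq> K \<and> A \<subseteq> K \<and> (\<forall>t\<in>T. normalizes t K)}"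
    using assms subgroup_self normalizes_carrier by blast
  then show ?thesis unfolding closure_under_def by (intro subgroups_Inter) blast+
qed

lemma closure_under_incl: "L \<subseteq> closure_under A T L" "A \<subseteq> closure_under A T L"
  by (auto simp: closure_under_def)

lemma closure_under_normalizes: "t \<in> T \<Longrightarrow> normalizes t (closure_under A T L)"
  unfolding closure_under_def by (rule normalizes_Inter) blast

lemma closure_under_least:
  assumes "subgroup K G" "L \<subseteq> K" "A \<subseteq> K" "\<And>t. t \<in> T \<Longrightarrow> normalizes t K"
  shows "closure_under A T L \<subseteq> K"
  unfolding closure_under_def using assms by blast

lemma closure_under_mono:
  "L \<subseteq> L' \<Longrightarrow> closure_under A T L \<subseteq> closure_under A T L'"
  unfolding closure_under_def by blast

lemma closure_under_id:
  assumes "subgroup L G" "A \<subseteq> L" "\<And>t. t \<in> T \<Longrightarrow> normalizes t L"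
  shows "closure_under A T L = L"
  using closure_under_least[OF assms(1) subset_refl assms(2,3)] closure_under_incl(1)[of L] by blast

lemma closure_under_empty:
  assumes "L \<subseteq> carrier G" "A \<subseteq> carrier G"
  shows "closure_under A {} L = generate G (L \<union> A)"
proof
  show "closure_under A {} L \<subseteq> generate G (L \<union> A)"
    using assms by (intro closure_under_least generate_is_subgroup) (auto intro: generate.incl)
  show "generate G (L \<union> A) \<subseteq> closure_under A {} L"
    using assms closure_under_incl[where A = A and T = "{}" and L = L] by (intro generate_subgroup_incl closure_under_subgroup) auto
qed

text \<open>\<open>reach X L n r L'\<close> is the counting device: a finite set \<open>S\<close> with all quotients \<open>u\<inverse>v\<close> in \<open>L\<close>
  can be turned into one \<open>2 ^ n\<close> times as large with quotients in \<open>L'\<close>, at the price of enlarging the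
  word length by \<open>r\<close>. Right multiplication by \<open>g\<close> conjugates \<open>L\<close>, and passing from \<open>S\<close> to \<open>S \<union> S a\<close>
  with \<open>a \<notin> L\<close> doubles \<open>S\<close>.\<close>

definition reach :: "'a set \<Rightarrow> 'a set \<Rightarrow> nat \<Rightarrow> nat \<Rightarrow> 'a set \<Rightarrow> bool" where
  "reach X L n r L' \<longleftrightarrow> (\<forall>S \<rho>. finite S \<longrightarrow> S \<subseteq> word_ball X \<rho> \<longrightarrow> (\<forall>u\<in>S. \<forall>v\<in>S. inv u \<otimes> v \<in> L) \<longrightarrow>
     (\<exists>S'. finite S' \<and> S' \<subseteq> word_ball X (\<rho> + r) \<and> (\<forall>u\<in>S'. \<forall>v\<in>S'. inv u \<otimes> v \<in> L') \<and>
       card S' = 2 ^ n * card S))"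

lemma reachI:
  assumes "\<And>S \<rho>. finite S \<Longrightarrow> S \<subseteq> word_ball X \<rho> \<Longrightarrow> \<forall>u\<in>S. \<forall>v\<in>S. inv u \<otimes> v \<in> L \<Longrightarrow>
     \<exists>S'. finite S' \<and> S' \<subseteq> word_ball X (\<rho> + r) \<and> (\<forall>u\<in>S'. \<forall>v\<in>S'. inv u \<otimes> v \<in> L') \<and>
       card S' = 2 ^ n * card S"
  shows "reach X L n r L'"
  using assms unfolding reach_def by simp

lemma reach_refl: "reach X L 0 0 L"
  unfolding reach_def by auto

lemma reach_trans:
  assumes "reach X L m r K" "reach X K n s M"
  shows "reach X L (m + n) (r + s) M"
proof (rule reachI)
  fix S \<rho> assume S: "finite S" "S \<subseteq> word_ball X \<rho>" "\<forall>u\<in>S. \<forall>v\<in>S. inv u \<otimes> v \<in> L"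
  obtain S' where S': "finite S'" "S' \<subseteq> word_ball X (\<rho> + r)" "\<forall>u\<in>S'. \<forall>v\<in>S'. inv u \<otimes> v \<in> K"
    "card S' = 2 ^ m * card S"
    using assms(1)[unfolded reach_def, rule_format, OF S(1,2)] S(3) by blast
  obtain S'' where S'': "finite S''" "S'' \<subseteq> word_ball X (\<rho> + r + s)" "\<forall>u\<in>S''. \<forall>v\<in>S''. inv u \<otimes> v \<in> M"
    "card S'' = 2 ^ n * card S'"
    using assms(2)[unfolded reach_def, rule_format, OF S'(1,2)] S'(3) by blast
  show "\<exists>S'. finite S' \<and> S' \<subseteq> word_ball X (\<rho> + (r + s)) \<and> (\<forall>u\<in>S'. \<forall>v\<in>S'. inv u \<otimes> v \<in> M) \<and>
       card S' = 2 ^ (m + n) * card S"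
    using S'' S'(4) by (intro exI[of _ S'']) (simp add: power_add add.assoc)
qed

lemma reach_conjg:
  assumes "X \<subseteq> carrier G" "g \<in> word_ball X l"
  shows "reach X L 0 l (conjg (inv g) ` L)"
proof (rule reachI)
  fix S \<rho> assume S: "finite S" "S \<subseteq> word_ball X \<rho>" "\<forall>u\<in>S. \<forall>v\<in>S. inv u \<otimes> v \<in> L"
  have g: "g \<in> carrier G" using assms word_ball_subset by blast
  have SG: "S \<subseteq> carrier G" using S(2) word_ball_subset[OF assms(1)] by blast
  let ?S = "(\<lambda>u. u \<otimes> g) ` S"
  have "inj_on (\<lambda>u. u \<otimes> g) S"
  proof (rule inj_onI)
    fix x y assume "x \<in> S" "y \<in> S" "x \<otimes> g = y \<otimes> g"
    then show "x = y" using SG g by (metis right_cancel subset_iff)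
  qed
  then have "card ?S = card S" by (rule card_image)
  moreover have "?S \<subseteq> word_ball X (\<rho> + l)" using word_ball_mult[OF assms(1)] assms(2) S(2) by auto
  moreover have "\<forall>u\<in>?S. \<forall>v\<in>?S. inv u \<otimes> v \<in> conjg (inv g) ` L"
  proof (intro ballI)
    fix u v assume "u \<in> ?S" "v \<in> ?S"
    then obtain u' v' where u: "u' \<in> S" "v' \<in> S" "u = u' \<otimes> g" "v = v' \<otimes> g" by blast
    have "u' \<in> carrier G" "v' \<in> carrier G" using u SG by auto
    then have "inv u \<otimes> v = conjg (inv g) (inv u' \<otimes> v')" using u g by (simp add: conjg_def group_simps)
    then show "inv u \<otimes> v \<in> conjg (inv g) ` L" using S(3) u by blast
  qed
  ultimately show "\<exists>S'. finite S' \<and> S' \<subseteq> word_ball X (\<rho> + l) \<and>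
      (\<forall>u\<in>S'. \<forall>v\<in>S'. inv u \<otimes> v \<in> conjg (inv g) ` L) \<and> card S' = 2 ^ 0 * card S"
    using S(1) by (intro exI[of _ ?S]) simp
qed

lemma reach_insert:
  assumes "X \<subseteq> carrier G" "a \<in> word_ball X l" "subgroup L G" "a \<notin> L"
  shows "reach X L 1 l (generate G (insert a L))"
proof (rule reachI)
  fix S \<rho> assume S: "finite S" "S \<subseteq> word_ball X \<rho>" "\<forall>u\<in>S. \<forall>v\<in>S. inv u \<otimes> v \<in> L"
  have a: "a \<in> carrier G" using assms word_ball_subset by blast
  have SG: "S \<subseteq> carrier G" using S(2) word_ball_subset[OF assms(1)] by blast
  let ?S = "(\<lambda>u. u \<otimes> a) ` S" and ?L = "generate G (insert a L)"
  have "inj_on (\<lambda>u. u \<otimes> a) S"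
  proof (rule inj_onI)
    fix x y assume "x \<in> S" "y \<in> S" "x \<otimes> a = y \<otimes> a"
    then show "x = y" using SG a by (metis right_cancel subset_iff)
  qed
  then have c: "card ?S = card S" by (rule card_image)
  have disj: "S \<inter> ?S = {}"
  proof (rule equals0I)
    fix x assume "x \<in> S \<inter> ?S"
    then obtain y where y: "x \<in> S" "y \<in> S" "x = y \<otimes> a" by blast
    have "y \<in> carrier G" using y SG by auto
    then have "inv y \<otimes> x = a" using y a by (simp add: group_simps)
    then show False using S(3) y assms(4) by metis
  qed
  have "card (S \<union> ?S) = 2 ^ 1 * card S"
    using c card_Un_disjoint[OF S(1) finite_imageI[OF S(1)] disj] by simp
  moreover have "S \<union> ?S \<subseteq> word_ball X (\<rho> + l)"
    using word_ball_mult[OF assms(1)] assms(2) S(2) word_ball_mono[of \<rho> "\<rho> + l" X] by auto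
  moreover have "\<forall>u\<in>S \<union> ?S. \<forall>v\<in>S \<union> ?S. inv u \<otimes> v \<in> ?L"
  proof (intro ballI)
    have sub: "subgroup ?L G" using a subgroup.subset[OF assms(3)] by (intro generate_is_subgroup) auto
    have aL: "a \<in> ?L" "inv a \<in> ?L" by (simp_all add: generate.incl generate.inv)
    have LL: "x \<in> ?L" if "x \<in> L" for x using that by (simp add: generate.incl)
    fix u v assume "u \<in> S \<union> ?S" "v \<in> S \<union> ?S"
    moreover have "inv u \<otimes> v \<in> ?L" if "u \<in> S" "v \<in> S" for u v using that S(3) LL by blast
    moreover have "inv (u \<otimes> a) \<otimes> v \<in> ?L" if "u \<in> S" "v \<in> S" for u v
    proof -
      have "u \<in> carrier G" "v \<in> carrier G" using that SG by auto
      then have "inv (u \<otimes> a) \<otimes> v = inv a \<otimes> (inv u \<otimes> v)" using a by (simp add: group_simps)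
      moreover have "inv u \<otimes> v \<in> ?L" using that S(3) LL by blast
      ultimately show ?thesis using subgroup.m_closed[OF sub aL(2)] by simp
    qed
    moreover have "inv u \<otimes> (v \<otimes> a) \<in> ?L" if "u \<in> S" "v \<in> S" for u v
    proof -
      have "u \<in> carrier G" "v \<in> carrier G" using that SG by auto
      then have "inv u \<otimes> (v \<otimes> a) = (inv u \<otimes> v) \<otimes> a" using a by (simp add: group_simps)
      moreover have "inv u \<otimes> v \<in> ?L" using that S(3) LL by blast
      ultimately show ?thesis using subgroup.m_closed[OF sub _ aL(1)] by simp
    qed
    moreover have "inv (u \<otimes> a) \<otimes> (v \<otimes> a) \<in> ?L" if "u \<in> S" "v \<in> S" for u v
    proof -
      have "u \<in> carrier G" "v \<in> carrier G" using that SG by auto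
      then have "inv (u \<otimes> a) \<otimes> (v \<otimes> a) = inv a \<otimes> (inv u \<otimes> v) \<otimes> a" using a by (simp add: group_simps)
      moreover have "inv u \<otimes> v \<in> ?L" using that S(3) LL by blast
      ultimately show ?thesis
        using subgroup.m_closed[OF sub subgroup.m_closed[OF sub aL(2)] aL(1)] by simp
    qed
    ultimately show "inv u \<otimes> v \<in> ?L" by blast
  qed
  ultimately show "\<exists>S'. finite S' \<and> S' \<subseteq> word_ball X (\<rho> + l) \<and>
      (\<forall>u\<in>S'. \<forall>v\<in>S'. inv u \<otimes> v \<in> ?L) \<and> card S' = 2 ^ 1 * card S"
    using S(1) by (intro exI[of _ "S \<union> ?S"]) simp
qed

text \<open>The device is started on the singleton of the identity: \<open>n\<close> insertions
  within length \<open>r\<close> fill a ball with \<open>2 ^ n\<close> elements, which slowness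
  forbids.\<close>

lemma reach_bound:
  assumes "finite X" "subgroup L G" "reach X L n r L'"
  shows "2 ^ n \<le> card (word_ball X r)"
proof -
  have 1: "\<forall>u\<in>{\<one>}. \<forall>v\<in>{\<one>}. inv u \<otimes> v \<in> L" using subgroup.one_closed[OF assms(2)] by simp
  have 2: "finite {\<one>}" "{\<one>} \<subseteq> word_ball X 0" by auto
  obtain S where "finite S" "S \<subseteq> word_ball X (0 + r)" "card S = 2 ^ n * card {\<one>}"
    using assms(3)[unfolded reach_def, THEN spec, THEN spec, THEN mp, THEN mp, THEN mp, OF 2 1] by blast
  then show ?thesis using card_mono[OF finite_word_ball[OF assms(1)], of S r] by simp
qed

lemma generate_subgroup_id:
  assumes "subgroup L G"
  shows "generate G L = L"
  by (intro equalityI generate_subgroup_incl[OF subset_refl assms] subsetI generate.incl)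

text \<open>Elements that are already collected are skipped at no cost, so the length is exactly
  \<open>l\<close> per doubling.\<close>

lemma reach_insert_set:
  assumes "X \<subseteq> carrier G" "finite A" "A \<subseteq> word_ball X l" "subgroup L G"
  shows "\<exists>n. reach X L n (l * n) (generate G (L \<union> A)) \<and> (\<not> A \<subseteq> L \<longrightarrow> n \<ge> 1)"
  using assms(2,3)
proof (induction A)
  case empty
  show ?case using reach_refl[of X L] generate_subgroup_id[OF assms(4)] by (intro exI[of _ 0]) simp
next
  case (insert a A)
  obtain n where n: "reach X L n (l * n) (generate G (L \<union> A))" "\<not> A \<subseteq> L \<longrightarrow> n \<ge> 1"
    using insert.IH insert.prems by blast
  let ?L = "generate G (L \<union> A)"
  have LG: "L \<subseteq> carrier G" using subgroup.subset[OF assms(4)] .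
  have AG: "insert a A \<subseteq> carrier G" using insert.prems word_ball_subset[OF assms(1)] by blast
  have sub: "subgroup ?L G" using LG AG by (intro generate_is_subgroup) auto
  have LL: "L \<union> A \<subseteq> ?L" by (auto intro: generate.incl)
  show ?case
  proof (cases "a \<in> ?L")
    case True
    have "generate G (L \<union> insert a A) = ?L"
    proof
      show "generate G (L \<union> insert a A) \<subseteq> ?L" using LL True sub by (intro generate_subgroup_incl) auto
      show "?L \<subseteq> generate G (L \<union> insert a A)" by (intro mono_generate) auto
    qed
    moreover have "n \<ge> 1" if "\<not> insert a A \<subseteq> L"
    proof (cases "A \<subseteq> L")
      case True': True
      have "?L = L" using True' generate_subgroup_incl[OF _ assms(4), of "L \<union> A"] LL by blast
      then show ?thesis using that True True' by blast
    qed (use n(2) in simp)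
    ultimately show ?thesis using n by auto
  next
    case False
    have "reach X L (n + 1) (l * n + l) (generate G (insert a ?L))"
      using insert.prems by (intro reach_trans[OF n(1)] reach_insert[OF assms(1) _ sub False]) simp
    moreover have "generate G (insert a ?L) = generate G (L \<union> insert a A)"
    proof
      have "?L \<subseteq> generate G (L \<union> insert a A)" by (intro mono_generate) auto
      moreover have "a \<in> generate G (L \<union> insert a A)" by (simp add: generate.incl)
      ultimately show "generate G (insert a ?L) \<subseteq> generate G (L \<union> insert a A)"
        using LG AG by (intro generate_subgroup_incl generate_is_subgroup) auto
      show "generate G (L \<union> insert a A) \<subseteq> generate G (insert a ?L)"
        using LL by (intro mono_generate) auto
    qed
    ultimately show ?thesis by (intro exI[of _ "n + 1"]) (simp add: algebra_simps)
  qed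
qed

end

text \<open>\<open>l\<close> bounds the relators in \<open>A\<close> and later also the steps of the
  walks. In the factor 3, one \<open>l\<close> pays for an insertion and two pay for a step to the
  next place and the step back.\<close>

locale slow_generators = group +
  fixes X A :: "'a set" and l :: nat
  assumes finite_X: "finite X" and X_carrier: "X \<subseteq> carrier G"
    and finite_A: "finite A" and A_ball: "A \<subseteq> word_ball X l"
    and slow_X: "\<exists>n0. \<forall>n\<ge>n0. card (word_ball X (3 * l * n)) < 2 ^ n"
begin

lemma A_carrier: "A \<subseteq> carrier G"
  using A_ball word_ball_subset[OF X_carrier] by blast

definition normalized_by :: "'a set \<Rightarrow> 'a set \<Rightarrow> bool" where
  "normalized_by T L \<longleftrightarrow> subgroup L G \<and> (\<forall>t\<in>T. normalizes t L)"

text \<open>The invariant for an induction along the list of group elements. The condition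
  \<open>n \<ge> 1\<close> guarantees progress as long as \<open>A\<close> is not contained in
  \<open>L\<close>; the second half keeps track of finite generation, which is the aim of the
  walks.\<close>

definition good :: "'a set \<Rightarrow> bool" where
  "good T \<longleftrightarrow> (\<forall>L. normalized_by T L \<longrightarrow>
     (\<not> A \<subseteq> L \<longrightarrow> (\<exists>n r. n \<ge> 1 \<and> reach X L n r (closure_under A T L) \<and> r + 2 * l \<le> 3 * l * n)) \<and>
     (fg_subgroup L \<longrightarrow> fg_subgroup (closure_under A T L)))"

lemma normalized_by_closure:
  assumes "T \<subseteq> carrier G" "L \<subseteq> carrier G"
  shows "normalized_by T (closure_under A T L)"
  unfolding normalized_by_def
  using closure_under_subgroup[OF assms(1) A_carrier assms(2)] closure_under_normalizes by blast

lemma normalized_by_carrier: "normalized_by T L \<Longrightarrow> L \<subseteq> carrier G"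
  unfolding normalized_by_def using subgroup.subset by blast

text \<open>As long as \<open>A\<close> is not contained in \<open>Z k\<close>, the next step
  inserts at least once, and its move by \<open>g\<close> is covered by the allowance
  \<open>2 * l\<close>. A walk that never stops would put \<open>2 ^ n\<close> elements into the
  ball of radius \<open>3 * l * n\<close> for arbitrarily large \<open>n\<close>.\<close>

lemma slow_sequence_stops:
  assumes "T \<subseteq> carrier G" "good T" "g \<in> word_ball X l" "\<And>k. normalized_by T (Z k)"
    and "\<And>k. Z (Suc k) = conjg (inv g) ` closure_under A T (Z k)"
  shows "\<exists>k. A \<subseteq> Z k"
proof (rule ccontr)
  assume neg: "\<not> (\<exists>k. A \<subseteq> Z k)"
  have *: "\<exists>n r. n \<ge> K \<and> reach X (Z 0) n r (Z K) \<and> r \<le> 3 * l * n" for K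
  proof (induction K)
    case 0
    show ?case using reach_refl by (intro exI[of _ 0]) simp
  next
    case (Suc K)
    then obtain n r where n: "n \<ge> K" "reach X (Z 0) n r (Z K)" "r \<le> 3 * l * n" by blast
    obtain n' r' where n': "n' \<ge> 1" "reach X (Z K) n' r' (closure_under A T (Z K))" "r' + 2 * l \<le> 3 * l * n'"
      using assms(2,4) neg unfolding good_def by blast
    have "reach X (Z 0) (n + n' + 0) (r + r' + l) (Z (Suc K))"
      unfolding assms(5) by (intro reach_trans[OF reach_trans[OF n(2) n'(2)]] reach_conjg X_carrier assms(3))
    moreover have "n + n' + 0 \<ge> Suc K" using n n' by simp
    moreover have "r + r' + l \<le> 3 * l * (n + n' + 0)" using n(3) n'(3) by (simp add: algebra_simps)
    ultimately show ?case by blast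
  qed
  obtain n0 where n0: "\<And>n. n \<ge> n0 \<Longrightarrow> card (word_ball X (3 * l * n)) < 2 ^ n" using slow_X by blast
  obtain n r where n: "n \<ge> n0" "reach X (Z 0) n r (Z n0)" "r \<le> 3 * l * n" using * by blast
  have "2 ^ n \<le> card (word_ball X r)"
    using reach_bound[OF finite_X _ n(2)] assms(4)[of 0] by (simp add: normalized_by_def)
  also have "\<dots> \<le> card (word_ball X (3 * l * n))"
    by (intro card_mono finite_word_ball finite_X word_ball_mono n(3))
  finally show False using n0[OF n(1)] by simp
qed

lemma good_empty: "good {}"
  unfolding good_def
proof (intro allI impI conjI)
  fix L assume "normalized_by {} L"
  then have L: "subgroup L G" by (simp add: normalized_by_def)
  have eq: "closure_under A {} L = generate G (L \<union> A)"
    by (intro closure_under_empty subgroup.subset L A_carrier)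
  {
    assume "\<not> A \<subseteq> L"
    with reach_insert_set[OF X_carrier finite_A A_ball L] obtain n
      where n: "reach X L n (l * n) (generate G (L \<union> A))" "n \<ge> 1" by blast
    have "l * n + 2 * l \<le> 3 * l * n" using n(2) by (cases n) auto
    with n show "\<exists>n r. n \<ge> 1 \<and> reach X L n r (closure_under A {} L) \<and> r + 2 * l \<le> 3 * l * n"
      unfolding eq by blast
  }
  show "fg_subgroup (closure_under A {} L)" if "fg_subgroup L"
    unfolding eq using fg_generate_insert[OF that finite_A A_carrier] .
qed

lemma normalizes_gen_union:
  assumes "T \<subseteq> carrier G" "normalized_by T L" "A \<subseteq> L" "g \<in> generate G (A \<union> T)"
  shows "normalizes g L"
proof (rule normalizes_generate[OF _ _ assms(4)])
  show "A \<union> T \<subseteq> carrier G" using assms(1) A_carrier by blast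
  fix s assume "s \<in> A \<union> T"
  then show "normalizes s L"
    using assms(2,3) normalizes_subgroup unfolding normalized_by_def by blast
qed

text \<open>\<open>s\<close> normalizes the conjugate of \<open>L\<close> by \<open>t\<close> as
  soon as \<open>inv t \<otimes> s \<otimes> t\<close> normalizes \<open>L\<close>. That element
  lies in the group generated by \<open>A\<close> and \<open>T\<close>, and the elements of
  \<open>A\<close> normalize \<open>L\<close> because they belong to it.\<close>

lemma normalized_by_conjg:
  assumes "T \<subseteq> carrier G" "normalized_by T L" "A \<subseteq> L" "t \<in> carrier G"
    and "\<And>s. s \<in> T \<Longrightarrow> inv t \<otimes> s \<otimes> t \<in> generate G (A \<union> T)"
  shows "normalized_by T (conjg t ` L)"
  unfolding normalized_by_def
proof (intro conjI ballI)
  show "subgroup (conjg t ` L) G"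
    using assms(2,4) conjg_image_subgroup unfolding normalized_by_def by blast
  fix s assume s: "s \<in> T"
  have "normalizes (inv t \<otimes> s \<otimes> t) L"
    using normalizes_gen_union[OF assms(1-3) assms(5)[OF s]] .
  then show "normalizes s (conjg t ` L)"
    using s assms(1,4) normalized_by_carrier[OF assms(2)] by (intro normalizes_conjg_image) auto
qed

text \<open>The groups \<open>Q k\<close> collect the conjugates at the first \<open>k\<close> places of a walk along the powers of \<open>t\<close>,
  seen from its current end point. The walk stops at some \<open>U = Q i\<close>. The second walk, in the opposite
  direction from \<open>U\<close>, would never end if \<open>U\<close> were not normalized by \<open>t\<close>. The summand \<open>2 * l\<close> in \<open>good\<close>
  pays for the way to the next place and back, so that the cost per insertion does not grow with \<open>T\<close>.\<close>

lemma good_insert: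
  assumes T: "T \<subseteq> carrier G" and good: "good T" and t: "t \<in> word_ball X l"
    and conj1: "\<And>s. s \<in> T \<Longrightarrow> t \<otimes> s \<otimes> inv t \<in> generate G (A \<union> T)"
    and conj2: "\<And>s. s \<in> T \<Longrightarrow> inv t \<otimes> s \<otimes> t \<in> generate G (A \<union> T)"
  shows "good (insert t T)"
proof -
  let ?C = "closure_under A T"
  have tG: "t \<in> carrier G" "inv t \<in> carrier G" using t word_ball_subset[OF X_carrier] by auto
  have t': "inv t \<in> word_ball X l" using word_ball_inv[OF X_carrier t] .
  have shift1: "normalized_by T (conjg t ` K)" if "normalized_by T K" "A \<subseteq> K" for K
    using normalized_by_conjg[OF T that tG(1) conj2] .
  have shift2: "normalized_by T (conjg (inv t) ` K)" if "normalized_by T K" "A \<subseteq> K" for K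
    using normalized_by_conjg[OF T that tG(2)] conj1 tG(1) by simp
  have C_norm: "normalized_by T (?C K)" "A \<subseteq> ?C K" "K \<subseteq> ?C K" if "normalized_by T K" for K
    using normalized_by_closure[OF T normalized_by_carrier[OF that]] closure_under_incl by blast+
  have C_id: "?C K = K" if "normalized_by T K" "A \<subseteq> K" for K
    using that unfolding normalized_by_def by (intro closure_under_id) blast+
  show ?thesis unfolding good_def
  proof (intro allI impI)
    fix L assume L: "normalized_by (insert t T) L"
    let ?D = "closure_under A (insert t T) L"
    have LT: "normalized_by T L" and Lt: "normalizes t L" and Lsub: "subgroup L G"
      using L unfolding normalized_by_def by blast+
    have LG: "L \<subseteq> carrier G" using subgroup.subset[OF Lsub] .
    define Q where "Q = rec_nat L (\<lambda>_ K. conjg (inv t) ` ?C K)"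
    have Q0: "Q 0 = L" and QS: "Q (Suc k) = conjg (inv t) ` ?C (Q k)" for k by (simp_all add: Q_def)
    have Qn: "normalized_by T (Q k)" for k
    proof (induction k)
      case (Suc k)
      then show ?case unfolding QS using shift2 C_norm by blast
    qed (simp add: Q0 LT)
    have QG: "Q k \<subseteq> carrier G" for k using normalized_by_carrier[OF Qn] .
    have CG: "?C K \<subseteq> carrier G" if "normalized_by T K" for K
      using normalized_by_carrier[OF C_norm(1)[OF that]] .
    have Qmono: "Q k \<subseteq> Q (Suc k)" for k
    proof (induction k)
      case 0
      have "L = conjg (inv t) ` L"
        using conjg_image_normalized[OF tG(2) LG normalizes_inv[OF tG(1) Lt]] by simp
      then show ?case unfolding QS Q0 using C_norm(3)[OF LT] by blast
    next
      case (Suc k)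
      have "?C (Q k) \<subseteq> ?C (Q (Suc k))" using closure_under_mono[OF Suc] .
      then show ?case unfolding QS[of k] QS[of "Suc k"] by (rule image_mono)
    qed
    obtain i0 where "A \<subseteq> Q i0"
      using slow_sequence_stops[where Z = Q, OF T good t Qn QS] by blast
    define i where "i = (LEAST i. A \<subseteq> Q i)"
    have Ai: "A \<subseteq> Q i" unfolding i_def by (rule LeastI) fact
    have less_i: "\<not> A \<subseteq> Q k" if "k < i" for k using that not_less_Least unfolding i_def by blast
    define U where "U = Q i"
    have Un: "normalized_by T U" "A \<subseteq> U" and UG: "U \<subseteq> carrier G" using Qn Ai QG by (simp_all add: U_def)
    have "U \<subseteq> conjg (inv t) ` U"
      using Qmono[of i] unfolding QS U_def[symmetric] C_id[OF Un] .
    then have "conjg t ` U \<subseteq> conjg t ` conjg (inv t) ` U" by (rule image_mono)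
    then have Udec: "conjg t ` U \<subseteq> U" using conjg_image_cancel(1)[OF tG(1) UG] by simp
    define V where "V = rec_nat U (\<lambda>_ K. conjg t ` ?C K)"
    have V0: "V 0 = U" and VS: "V (Suc k) = conjg t ` ?C (V k)" for k by (simp_all add: V_def)
    have Vn: "normalized_by T (V k)" for k
    proof (induction k)
      case (Suc k)
      then show ?case unfolding VS using shift1 C_norm by blast
    qed (simp add: V0 Un)
    have Vdec: "V (Suc k) \<subseteq> V k" for k
    proof (induction k)
      case 0
      show ?case unfolding VS V0 C_id[OF Un] using Udec .
    next
      case (Suc k)
      have "?C (V (Suc k)) \<subseteq> ?C (V k)" using closure_under_mono[OF Suc] .
      then show ?case unfolding VS[of k] VS[of "Suc k"] by (rule image_mono)
    qed
    have Vanti: "V (m + k) \<subseteq> V m" for m k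
      using Vdec by (induction k) (auto simp del: VS)
    \<comment> \<open>Every tail of the second walk stops somewhere, and the groups decrease, so
      \<open>A\<close> is never lost. From here on taking the closure changes nothing.\<close>
    have AV: "A \<subseteq> V k" for k
    proof -
      have "V (k + Suc j) = conjg (inv (inv t)) ` ?C (V (k + j))" for j using VS tG by simp
      then obtain j where "A \<subseteq> V (k + j)"
        using slow_sequence_stops[OF T good t', where Z = "\<lambda>j. V (k + j)"] Vn by metis
      then show ?thesis using Vanti by blast
    qed
    have VS': "V (Suc k) = conjg t ` V k" for k unfolding VS C_id[OF Vn AV] ..
    have VG: "V k \<subseteq> carrier G" for k using normalized_by_carrier[OF Vn] .
    \<comment> \<open>Conjugation by \<open>t\<close> only shifts the decreasing sequence, so the
      intersection is normalized by \<open>t\<close>. Hence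
      \<open>?D \<subseteq> W \<subseteq> U\<close>, while \<open>U = Q i\<close> lies in
      \<open>?D\<close>: the first walk has already collected the whole closure.\<close>
    define W where "W = (\<Inter>k. V k)"
    have Wsub: "subgroup W G"
      unfolding W_def using Vn unfolding normalized_by_def by (intro subgroups_Inter) blast+
    have WT: "normalizes s W" if "s \<in> T" for s
      unfolding W_def using Vn that unfolding normalized_by_def by (intro normalizes_Inter) blast
    have Wt: "normalizes t W" unfolding normalizes_def
    proof (intro ballI iffI)
      fix x assume x: "x \<in> carrier G" "x \<in> W"
      have "conjg t x \<in> V (Suc k)" for k unfolding VS' using x(2) by (auto simp: W_def)
      then show "conjg t x \<in> W" unfolding W_def using Vdec by blast
    next
      fix x assume x: "x \<in> carrier G" "conjg t x \<in> W"
      have "x \<in> V k" for k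
      proof -
        have "conjg t x \<in> conjg t ` V k" using x(2) unfolding VS'[symmetric] by (auto simp: W_def)
        then show ?thesis using mem_conjg_image[OF tG(1) _ VG, of "conjg t x" k] x(1) tG by simp
      qed
      then show "x \<in> W" by (simp add: W_def)
    qed
    have LW: "L \<subseteq> W"
    proof -
      have LQ: "L \<subseteq> Q k" for k using Q0 Qmono by (induction k) auto
      have "L \<subseteq> V k" for k
      proof (induction k)
        case 0
        show ?case using LQ by (simp add: V0 U_def)
      next
        case (Suc k)
        then have "conjg t ` L \<subseteq> conjg t ` V k" by (rule image_mono)
        then show ?case unfolding VS' using conjg_image_normalized[OF tG(1) LG Lt] by simp
      qed
      then show ?thesis by (auto simp: W_def)
    qed
    have DW: "?D \<subseteq> W"
      using Wsub LW AV WT Wt by (intro closure_under_least) (auto simp: W_def)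
    have insT: "insert t T \<subseteq> carrier G" using T tG by blast
    have Dn: "normalized_by (insert t T) ?D" using normalized_by_closure[OF insT LG] .
    then have DnT: "normalized_by T ?D" and Dt: "normalizes t ?D" and DG: "?D \<subseteq> carrier G"
      using normalized_by_carrier unfolding normalized_by_def by blast+
    have AD: "A \<subseteq> ?D" by (rule closure_under_incl)
    have QD: "Q k \<subseteq> ?D" for k
    proof (induction k)
      case 0
      show ?case unfolding Q0 by (rule closure_under_incl)
    next
      case (Suc k)
      have "?C (Q k) \<subseteq> ?D" using closure_under_mono[OF Suc] C_id[OF DnT AD] by blast
      then have "conjg (inv t) ` ?C (Q k) \<subseteq> conjg (inv t) ` ?D" by (rule image_mono)
      also have "\<dots> = ?D" using conjg_image_normalized[OF tG(2) DG normalizes_inv[OF tG(1) Dt]] .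
      finally show ?case unfolding QS .
    qed
    have "W \<subseteq> U" unfolding W_def V0[symmetric] by blast
    then have DU: "?D = U" using DW QD[of i] unfolding U_def[symmetric] by blast
    show "(\<not> A \<subseteq> L \<longrightarrow> (\<exists>n r. n \<ge> 1 \<and> reach X L n r ?D \<and> r + 2 * l \<le> 3 * l * n)) \<and>
      (fg_subgroup L \<longrightarrow> fg_subgroup ?D)"
    proof (intro conjI impI)
      assume "\<not> A \<subseteq> L"
      then have "i \<noteq> 0" using Ai Q0 by metis
      then obtain j where j: "i = Suc j" using not0_implies_Suc by blast
      \<comment> \<open>The summand \<open>l * k\<close> is set aside for the \<open>k\<close> steps
        home. Minimality of \<open>i\<close> makes every place before \<open>i\<close> contribute an
        insertion.\<close>
      have forth: "k < i \<Longrightarrow> \<exists>n r. n \<ge> 1 \<and> reach X L n r (?C (Q k)) \<and> r + l * k + 2 * l \<le> 3 * l * n" for k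
      proof (induction k)
        case 0
        then have "\<not> A \<subseteq> Q 0" using less_i by blast
        then show ?case using good Qn[of 0] unfolding good_def Q0 by simp
      next
        case (Suc k)
        then obtain n r where n: "n \<ge> 1" "reach X L n r (?C (Q k))" "r + l * k + 2 * l \<le> 3 * l * n"
          by auto
        obtain n' r' where n': "n' \<ge> 1" "reach X (Q (Suc k)) n' r' (?C (Q (Suc k)))" "r' + 2 * l \<le> 3 * l * n'"
          using good Qn[of "Suc k"] less_i[OF Suc.prems] unfolding good_def by blast
        have "reach X (?C (Q k)) 0 l (Q (Suc k))" unfolding QS by (rule reach_conjg[OF X_carrier t])
        then have "reach X L (n + 0 + n') (r + l + r') (?C (Q (Suc k)))"
          by (rule reach_trans[OF reach_trans[OF n(2)] n'(2)])
        moreover have "r + l + r' + l * Suc k + 2 * l \<le> 3 * l * (n + 0 + n')"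
          using n(3) n'(3) by (simp add: algebra_simps)
        moreover have "n + 0 + n' \<ge> 1" using n(1) by simp
        ultimately show ?case by blast
      qed
      have "?C (Q j) = conjg t ` Q (Suc j)"
        unfolding QS using conjg_image_cancel(1)[OF tG(1) CG[OF Qn]] by simp
      also have "\<dots> = ?D" using conjg_image_normalized[OF tG(1) DG Dt] DU by (simp add: j U_def)
      finally have CQj: "?C (Q j) = ?D" .
      \<comment> \<open>The collected group is normalized by \<open>t\<close>, so the way home
        leaves it unchanged and costs only length.\<close>
      have homeward: "reach X ?D 0 (l * k) ?D" for k
      proof (induction k)
        case 0
        show ?case using reach_refl by simp
      next
        case (Suc k)
        have "reach X ?D 0 l (conjg (inv (inv t)) ` ?D)" by (rule reach_conjg[OF X_carrier t'])
        then have "reach X ?D 0 l ?D" using conjg_image_normalized[OF tG(1) DG Dt] tG by simp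
        from reach_trans[OF Suc this] show ?case by (simp add: add.commute)
      qed
      obtain n r where n: "n \<ge> 1" "reach X L n r ?D" "r + l * j + 2 * l \<le> 3 * l * n"
        using forth[of j] unfolding CQj j by blast
      show "\<exists>n r. n \<ge> 1 \<and> reach X L n r ?D \<and> r + 2 * l \<le> 3 * l * n"
        using reach_trans[OF n(2) homeward[of j]] n(1,3)
        by (intro exI[of _ n] exI[of _ "r + l * j"]) simp
    next
      assume fg: "fg_subgroup L"
      have "fg_subgroup (Q k)" for k
      proof (induction k)
        case (Suc k)
        then have "fg_subgroup (?C (Q k))" using good Qn[of k] unfolding good_def by blast
        then show ?case unfolding QS by (rule conjg_image_fg[OF tG(2)])
      qed (simp add: Q0 fg)
      then show "fg_subgroup ?D" unfolding DU U_def .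
    qed
  qed
qed

text \<open>The list is absorbed from its end. Conjugates of later entries by \<open>t\<close> and
  \<open>inv t\<close> stay in the group generated by \<open>A\<close> and the entries behind
  \<open>t\<close>, which is how a central series behaves.\<close>

lemma good_list:
  assumes "set ts \<subseteq> word_ball X l"
    and "\<And>us t vs s. ts = us @ t # vs \<Longrightarrow> s \<in> set vs \<Longrightarrow>
      t \<otimes> s \<otimes> inv t \<in> generate G (A \<union> set vs) \<and> inv t \<otimes> s \<otimes> t \<in> generate G (A \<union> set vs)"
  shows "good (set ts)"
  using assms
proof (induction ts)
  case Nil
  show ?case using good_empty by simp
next
  case (Cons t vs)
  have "good (set vs)"
  proof (rule Cons.IH)
    show "set vs \<subseteq> word_ball X l" using Cons.prems(1) by simp
    fix us t' vs' s assume "vs = us @ t' # vs'" "s \<in> set vs'"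
    then show "t' \<otimes> s \<otimes> inv t' \<in> generate G (A \<union> set vs') \<and> inv t' \<otimes> s \<otimes> t' \<in> generate G (A \<union> set vs')"
      using Cons.prems(2)[of "t # us" t' vs' s] by simp
  qed
  moreover have "set vs \<subseteq> carrier G" using Cons.prems(1) word_ball_subset[OF X_carrier] by auto
  ultimately show ?case
    using good_insert[of "set vs" t] Cons.prems(1) Cons.prems(2)[of "[]" t vs] by simp
qed

lemma fg_closure_under:
  assumes "T \<subseteq> carrier G" "good T"
  shows "fg_subgroup (closure_under A T {\<one>})"
proof -
  have "normalizes t {\<one>}" if "t \<in> T" for t
    using that assms(1) by (intro normalizesI) auto
  then have "normalized_by T {\<one>}"
    unfolding normalized_by_def using triv_subgroup by blast
  moreover have "generate G {} = {\<one>}" using generate_empty .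
  then have "fg_subgroup {\<one>}" unfolding fg_subgroup_def by (intro exI[of _ "{}"]) simp
  ultimately show ?thesis using assms(2) unfolding good_def by blast
qed

end

section \<open>Virtually nilpotent quotients\<close>

context group
begin

text \<open>Arbitrary bracketings are allowed: then nilpotency passes through central extensions
  (\<open>nilpotent_mod_step\<close> below) without the three subgroups lemma.\<close>

inductive weighted_commutator :: "'a set \<Rightarrow> nat \<Rightarrow> 'a \<Rightarrow> bool" for P where
  base: "x \<in> P \<Longrightarrow> weighted_commutator P 1 x"
| commutator: "weighted_commutator P i u \<Longrightarrow> weighted_commutator P j v \<Longrightarrow>
    weighted_commutator P (i + j) (commutator u v)"

lemma weighted_commutator_pos: "weighted_commutator P n g \<Longrightarrow> n \<ge> 1"
  by (induction rule: weighted_commutator.induct) auto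

lemma weighted_commutator_mono:
  "weighted_commutator P n g \<Longrightarrow> P \<subseteq> Q \<Longrightarrow> weighted_commutator Q n g"
proof (induction rule: weighted_commutator.induct)
  case (base x)
  then show ?case by (intro weighted_commutator.base) blast
next
  case (commutator i u j v)
  then show ?case by (intro weighted_commutator.commutator)
qed

lemma commutator_in_subgroup:
  assumes "subgroup P G" "u \<in> P" "v \<in> P"
  shows "commutator u v \<in> P"
  unfolding commutator_def
  by (intro subgroup.m_closed[OF assms(1)] subgroup.m_inv_closed[OF assms(1)] assms(2,3))

lemma weighted_commutator_in_subgroup:
  "weighted_commutator P n g \<Longrightarrow> subgroup Q G \<Longrightarrow> P \<subseteq> Q \<Longrightarrow> g \<in> Q"
  by (induction rule: weighted_commutator.induct) (auto intro: commutator_in_subgroup)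

text \<open>Inverting a commutator exchanges its two entries and keeps the weight.\<close>

lemma weighted_commutator_inv:
  assumes "weighted_commutator P n g" "P \<subseteq> carrier G" "\<And>x. x \<in> P \<Longrightarrow> inv x \<in> P"
  shows "weighted_commutator P n (inv g)"
  using assms(1)
proof induction
  case (base x)
  then show ?case using assms(3) weighted_commutator.base by blast
next
  case (commutator i u j v)
  have "u \<in> carrier G" "v \<in> carrier G"
    using commutator.hyps weighted_commutator_in_subgroup[OF _ subgroup_self assms(2)] by blast+
  then have "inv (commutator u v) = commutator v u" by (rule inv_commutator)
  then show ?case using weighted_commutator.commutator[OF commutator.hyps(2,1)] by (simp add: add.commute)
qed

lemma finite_weighted_commutators:
  assumes "finite P"
  shows "finite {g. weighted_commutator P n g}"
proof (induction n rule: less_induct)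
  case (less n)
  let ?W = "\<lambda>i. {g. weighted_commutator P i g}"
  have "?W n \<subseteq> P \<union> (\<Union>(i, j)\<in>{..<n} \<times> {..<n}. (\<lambda>(u, v). commutator u v) ` (?W i \<times> ?W j))"
  proof
    fix g assume "g \<in> ?W n"
    then have "weighted_commutator P n g" by simp
    then show "g \<in> P \<union> (\<Union>(i, j)\<in>{..<n} \<times> {..<n}. (\<lambda>(u, v). commutator u v) ` (?W i \<times> ?W j))"
    proof cases
      case (commutator i u j v)
      then have "(i, j) \<in> {..<n} \<times> {..<n}" using weighted_commutator_pos by fastforce
      moreover have "g \<in> (\<lambda>(u, v). commutator u v) ` (?W i \<times> ?W j)" using commutator by force
      ultimately show ?thesis by blast
    qed simp
  qed
  moreover have "finite (P \<union> (\<Union>(i, j)\<in>{..<n} \<times> {..<n}. (\<lambda>(u, v). commutator u v) ` (?W i \<times> ?W j)))"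
  proof (intro finite_UnI assms finite_UN_I)
    show "finite ({..<n} \<times> {..<n})" by simp
    fix p assume p: "p \<in> {..<n} \<times> {..<n}"
    obtain i j where ij: "p = (i, j)" by (cases p)
    then have "finite (?W i \<times> ?W j)" using p less by simp
    then show "finite (case p of (i, j) \<Rightarrow> (\<lambda>(u, v). commutator u v) ` (?W i \<times> ?W j))"
      unfolding ij by simp
  qed
  ultimately show ?case by (rule finite_subset)
qed

text \<open>A commutator is at most twice as long as its two entries together, and
  \<open>2 * (4 ^ i + 4 ^ j) \<le> 4 ^ (i + j)\<close> for positive weights. Neither the size nor
  the choice of \<open>X\<close> enters.\<close>

lemma weighted_commutator_length:
  assumes "weighted_commutator (X \<union> m_inv G ` X) n g" "X \<subseteq> carrier G"
  shows "g \<in> word_ball X (4 ^ n)"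
  using assms(1)
proof induction
  case (base x)
  then show ?case using gen_in_word_ball[OF assms(2)] word_ball_mono[of 1 "4 ^ 1" X] by auto
next
  case (commutator i u j v)
  have "commutator u v \<in> word_ball X (4 ^ i + 4 ^ j + 4 ^ i + 4 ^ j)"
    unfolding commutator_def
    by (intro word_ball_mult[OF assms(2)] word_ball_inv[OF assms(2)] commutator.IH)
  moreover have "(4 ^ i + 4 ^ j + 4 ^ i + 4 ^ j :: nat) \<le> 4 ^ (i + j)"
  proof -
    have "i \<ge> 1" "j \<ge> 1" using commutator.hyps weighted_commutator_pos by blast+
    then obtain i' j' where ij: "i = Suc i'" "j = Suc j'" by (metis Suc_le_D One_nat_def)
    have "(4::nat) ^ i' \<le> 4 ^ i' * 4 ^ j'" "(4::nat) ^ j' \<le> 4 ^ i' * 4 ^ j'" by simp_all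
    moreover have "(4::nat) ^ (i + j) = 16 * (4 ^ i' * 4 ^ j')" "(4::nat) ^ i = 4 * 4 ^ i'" "(4::nat) ^ j = 4 * 4 ^ j'"
      by (simp_all add: ij power_add)
    ultimately show ?thesis by linarith
  qed
  ultimately show ?case using word_ball_mono by blast
qed

text \<open>A chain list, read from its end, consists of successive generators of a central series modulo the
  normal closure of \<open>A\<close>.\<close>

definition chain_list :: "'a set \<Rightarrow> 'a list \<Rightarrow> bool" where
  "chain_list A ts \<longleftrightarrow> set ts \<subseteq> carrier G \<and> (\<forall>t\<in>set ts. inv t \<in> set ts) \<and>
     (\<forall>us t vs x. ts = us @ t # vs \<longrightarrow> x \<in> set ts \<longrightarrow> commutator x t \<in> A \<union> set vs)"

text \<open>Translates position in the list into weight: whatever has larger weight than the block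
  of \<open>t\<close> comes after \<open>t\<close>.\<close>

lemma concat_map_suffix:
  assumes "sorted_wrt (<) ws" "concat (map L ws) = us @ t # vs"
  shows "\<exists>w\<in>set ws. t \<in> set (L w) \<and> (\<forall>w'\<in>set ws. w < (w' :: nat) \<longrightarrow> set (L w') \<subseteq> set vs)"
  using assms
proof (induction ws arbitrary: us)
  case (Cons w ws)
  from Cons.prems(2) have "L w @ concat (map L ws) = us @ t # vs" by simp
  then consider us' where "us = L w @ us'" "concat (map L ws) = us' @ t # vs"
    | vs' where "L w = us @ t # vs'" "vs = vs' @ concat (map L ws)"
    by (auto simp: append_eq_append_conv2 append_eq_Cons_conv Cons_eq_append_conv)
  then show ?case
  proof cases
    case 1
    then obtain w0 where w0: "w0 \<in> set ws" "t \<in> set (L w0)" "\<forall>w'\<in>set ws. w0 < w' \<longrightarrow> set (L w') \<subseteq> set vs"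
      using Cons.IH Cons.prems(1) by auto
    moreover have "w < w0" using Cons.prems(1) w0(1) by simp
    ultimately show ?thesis by auto
  next
    case 2
    then show ?thesis by auto
  qed
qed simp

text \<open>All commutators of weight at most \<open>c\<close>, ordered by increasing weight; those of weight
  between \<open>c + 1\<close> and \<open>2 c\<close> form \<open>A\<close>.\<close>

lemma short_chain_list:
  assumes X: "finite X" "X \<subseteq> carrier G" and c: "c \<ge> 1"
  obtains ts A where "finite A" "A \<subseteq> word_ball X (4 ^ (2 * c))" "set ts \<subseteq> word_ball X (4 ^ (2 * c))"
    "X \<subseteq> set ts" "chain_list A ts" "\<forall>a\<in>A. \<exists>n>c. weighted_commutator (X \<union> m_inv G ` X) n a"
proof -
  let ?X = "X \<union> m_inv G ` X"
  let ?W = "\<lambda>n. {g. weighted_commutator ?X n g}"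
  have finW: "finite (?W n)" for n using X(1) by (intro finite_weighted_commutators) simp
  have "\<forall>n. \<exists>l. set l = ?W n" using finite_list[OF finW] by blast
  then obtain L where L: "\<And>n. set (L n) = ?W n" by metis
  define ts where "ts = concat (map L [1..<Suc c])"
  define A where "A = (\<Union>n\<in>{Suc c..2 * c}. ?W n)"
  have set_ts: "set ts = (\<Union>n\<in>{1..c}. ?W n)"
  proof -
    have "set [1..<Suc c] = {1..c}" by auto
    then show ?thesis by (simp add: ts_def L del: upt_Suc)
  qed
  have Xinv: "inv x \<in> ?X" if "x \<in> ?X" for x using that X(2) by auto
  have XG: "?X \<subseteq> carrier G" using symmetrized_subset[OF X(2)] .
  have short: "g \<in> word_ball X (4 ^ (2 * c))" if "g \<in> ?W n" "n \<le> 2 * c" for g n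
  proof -
    have "g \<in> word_ball X (4 ^ n)" using that(1) weighted_commutator_length[OF _ X(2)] by simp
    moreover have "(4::nat) ^ n \<le> 4 ^ (2 * c)" using that(2) by (intro power_increasing) auto
    ultimately show ?thesis using word_ball_mono by blast
  qed
  show thesis
  proof (rule that[of A ts])
    show "finite A" unfolding A_def using finW by blast
    show "A \<subseteq> word_ball X (4 ^ (2 * c))" unfolding A_def using short by fastforce
    show ts_short: "set ts \<subseteq> word_ball X (4 ^ (2 * c))" unfolding set_ts using short by fastforce
    show "X \<subseteq> set ts"
    proof
      fix x assume "x \<in> X"
      then have "x \<in> ?W 1" by (intro CollectI weighted_commutator.base) blast
      moreover have "1 \<in> {1..c}" using c by simp
      ultimately show "x \<in> set ts" unfolding set_ts by blast
    qed
    show "\<forall>a\<in>A. \<exists>n>c. weighted_commutator ?X n a"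
      unfolding A_def by (auto simp: Suc_le_eq)
    show "chain_list A ts" unfolding chain_list_def
    proof (intro conjI allI impI ballI)
      show "set ts \<subseteq> carrier G" using ts_short word_ball_subset[OF X(2)] by blast
      show "inv t \<in> set ts" if t: "t \<in> set ts" for t
      proof -
        obtain n where n: "n \<in> {1..c}" "t \<in> ?W n" using t unfolding set_ts by blast
        then have "inv t \<in> ?W n" using weighted_commutator_inv[OF _ XG Xinv] by simp
        then show ?thesis unfolding set_ts using n(1) by blast
      qed
      fix us t vs x assume d: "ts = us @ t # vs" and x: "x \<in> set ts"
      have "sorted_wrt (<) [1..<Suc c]" by (rule sorted_wrt_upt)
      from concat_map_suffix[OF this d[unfolded ts_def]] obtain w
        where w: "w \<in> set [1..<Suc c]" "t \<in> set (L w)"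
          "\<forall>w'\<in>set [1..<Suc c]. w < w' \<longrightarrow> set (L w') \<subseteq> set vs" by blast
      obtain i where i: "i \<in> {1..c}" "x \<in> ?W i" using x unfolding set_ts by blast
      have com: "commutator x t \<in> ?W (i + w)"
        using i(2) w(2) L weighted_commutator.commutator by simp
      \<comment> \<open>Both weights \<open>i\<close> and \<open>w\<close> lie between 1 and
        \<open>c\<close>, so the weight of the commutator exceeds \<open>w\<close> and is at most
        \<open>2 * c\<close>: it occurs later in the list or belongs to \<open>A\<close>.\<close>
      show "commutator x t \<in> A \<union> set vs"
      proof (cases "i + w \<le> c")
        case True
        then have "i + w \<in> set [1..<Suc c]" "w < i + w" using i(1) by auto
        then have "set (L (i + w)) \<subseteq> set vs" using w(3) by blast
        then show ?thesis using com L by blast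
      next
        case False
        then have "i + w \<in> {Suc c..2 * c}" using i(1) w(1) by auto
        then show ?thesis using com unfolding A_def by blast
      qed
    qed
  qed
qed

section \<open>Polycyclic series obtained from chain lists\<close>

lemma normalizes_generated:
  assumes "S \<subseteq> carrier G" "x \<in> carrier G"
    and "\<And>s. s \<in> S \<Longrightarrow> conjg x s \<in> generate G S" "\<And>s. s \<in> S \<Longrightarrow> conjg (inv x) s \<in> generate G S"
  shows "normalizes x (generate G S)"
proof -
  have sub: "subgroup (generate G S) G" using generate_is_subgroup[OF assms(1)] .
  have *: "conjg y g \<in> generate G S"
    if y: "y \<in> carrier G" "\<And>s. s \<in> S \<Longrightarrow> conjg y s \<in> generate G S" and g: "g \<in> generate G S" for y g
    using g
  proof induction
    case one
    then show ?case using y(1) by (simp add: generate.one)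
  next
    case (incl h)
    then show ?case using y(2) by blast
  next
    case (inv h)
    then have "conjg y (inv h) = inv (conjg y h)" using y(1) assms(1) conjg_inv by blast
    then show ?case using subgroup.m_inv_closed[OF sub y(2)[OF inv]] by simp
  next
    case (eng h1 h2)
    have "h1 \<in> carrier G" "h2 \<in> carrier G" using eng.hyps generate_in_carrier[OF assms(1)] by blast+
    then show ?case using y(1) subgroup.m_closed[OF sub eng.IH] by (simp add: conjg_mult)
  qed
  show ?thesis
    by (rule normalizesI[OF assms(2)]) (use *[of x] *[of "inv x"] assms in simp_all)
qed

text \<open>Since \<open>conjg x s = commutator x s \<otimes> s\<close>, conjugation changes an
  entry only by an element of \<open>A\<close> or by an entry further down the list. Closure of the
  list under inverses takes care of conjugation by \<open>inv x\<close>.\<close>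

lemma chain_list_normalizes:
  assumes ch: "chain_list A ts" and N: "subgroup N G" "A \<subseteq> N" "\<And>t. t \<in> set ts \<Longrightarrow> normalizes t N"
    and d: "ts = us @ vs" and x: "x \<in> generate G (set ts)"
  shows "normalizes x (generate G (N \<union> set vs))"
proof -
  have tsG: "set ts \<subseteq> carrier G" using ch by (simp add: chain_list_def)
  have NG: "N \<subseteq> carrier G" using subgroup.subset[OF N(1)] .
  have vsG: "N \<union> set vs \<subseteq> carrier G" using tsG NG d by auto
  have conj: "conjg x s \<in> generate G (N \<union> set vs)" if x: "x \<in> set ts" and s: "s \<in> N \<union> set vs" for x s
  proof (cases "s \<in> N")
    case True
    then have "conjg x s \<in> N" using N(3)[OF x] NG unfolding normalizes_def by blast
    then show ?thesis by (simp add: generate.incl)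
  next
    case False
    then have "s \<in> set vs" using s by simp
    then obtain as bs where "vs = as @ s # bs" by (meson split_list)
    then have bs: "ts = (us @ as) @ s # bs" "set bs \<subseteq> set vs" using d by auto
    have "commutator x s \<in> A \<union> set bs"
      using ch[unfolded chain_list_def] bs(1) x by blast
    then have "commutator x s \<in> N \<union> set vs" using N(2) bs(2) by blast
    then have "commutator x s \<otimes> s \<in> generate G (N \<union> set vs)"
      using s by (intro generate.eng generate.incl)
    moreover have "x \<in> carrier G" "s \<in> carrier G" using x tsG s vsG by auto
    ultimately show ?thesis by (simp add: conjg_eq_commutator)
  qed
  show ?thesis
  proof (rule normalizes_generate[OF tsG _ x])
    fix t assume t: "t \<in> set ts"
    have "inv t \<in> set ts" using ch t unfolding chain_list_def by blast
    then show "normalizes t (generate G (N \<union> set vs))"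
      using conj t tsG by (intro normalizes_generated[OF vsG]) auto
  qed
qed

lemma generate_insert_suffix:
  assumes "N \<subseteq> carrier G" "set (t # vs) \<subseteq> carrier G"
  shows "generate G (N \<union> set (t # vs)) = generate G (insert t (generate G (N \<union> set vs)))"
proof
  let ?K = "generate G (N \<union> set vs)"
  have KG: "?K \<subseteq> carrier G" using assms by (intro generate_incl) auto
  have "N \<union> set vs \<subseteq> ?K" by (auto intro: generate.incl)
  then show "generate G (N \<union> set (t # vs)) \<subseteq> generate G (insert t ?K)"
    by (intro mono_generate) auto
  have "?K \<subseteq> generate G (N \<union> set (t # vs))" by (intro mono_generate) auto
  moreover have "t \<in> generate G (N \<union> set (t # vs))" by (simp add: generate.incl)
  ultimately show "generate G (insert t ?K) \<subseteq> generate G (N \<union> set (t # vs))"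
    using assms by (intro generate_subgroup_incl generate_is_subgroup) auto
qed

lemma normalizes_int_pow:
  assumes "t \<in> carrier G" "subgroup K G" "normalizes t K"
  shows "normalizes (t [^] (i::int)) K"
proof (rule normalizes_generate[of "{t}"])
  show "t [^] i \<in> generate G {t}" using generate_pow[OF assms(1)] by blast
qed (use assms in auto)

lemma generate_insert_normalized:
  assumes "t \<in> carrier G" "subgroup K G" "normalizes t K" "x \<in> generate G (insert t K)"
  shows "\<exists>k\<in>K. \<exists>i::int. x = k \<otimes> t [^] i"
  using assms(4)
proof induction
  case one
  show ?case using subgroup.one_closed[OF assms(2)] by (intro bexI[of _ "\<one>"] exI[of _ 0]) auto
next
  case (incl h)
  then consider "h = t" | "h \<in> K" by blast
  then show ?case
  proof cases
    case 1
    have "t [^] (1::int) = t" using assms(1) by simp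
    then show ?thesis using subgroup.one_closed[OF assms(2)] 1 assms(1)
      by (intro bexI[of _ "\<one>"] exI[of _ 1]) simp_all
  next
    case 2
    then show ?thesis using subgroup.mem_carrier[OF assms(2)] by (intro bexI[of _ h] exI[of _ 0]) auto
  qed
next
  case (inv h)
  then consider "h = t" | "h \<in> K" by blast
  then show ?case
  proof cases
    case 1
    have "t [^] (-1::int) = inv t" using assms(1) by (simp add: int_pow_neg)
    then show ?thesis using subgroup.one_closed[OF assms(2)] 1 assms(1)
      by (intro bexI[of _ "\<one>"] exI[of _ "-1"]) simp_all
  next
    case 2
    then show ?thesis using subgroup.mem_carrier[OF assms(2)] subgroup.m_inv_closed[OF assms(2)]
      by (intro bexI[of _ "inv h"] exI[of _ 0]) auto
  qed
next
  case (eng h1 h2)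
  then obtain k1 k2 and i j :: int
    where k: "k1 \<in> K" "k2 \<in> K" "h1 = k1 \<otimes> t [^] i" "h2 = k2 \<otimes> t [^] j" by blast
  have G: "k1 \<in> carrier G" "k2 \<in> carrier G" using k subgroup.mem_carrier[OF assms(2)] by auto
  have "h1 \<otimes> h2 = (k1 \<otimes> conjg (t [^] i) k2) \<otimes> t [^] (i + j)"
    using G assms(1) unfolding k conjg_def by (simp add: group_simps int_pow_mult)
  moreover have "conjg (t [^] i) k2 \<in> K"
    using normalizes_int_pow[OF assms(1-3)] k(2) G unfolding normalizes_def by blast
  then have "k1 \<otimes> conjg (t [^] i) k2 \<in> K" using subgroup.m_closed[OF assms(2) k(1)] by blast
  ultimately show ?case by blast
qed

text \<open>A computation in the cyclic quotient by \<open>K\<close> of the group generated by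
  \<open>K\<close> and \<open>t\<close>.\<close>

lemma normalized_coset_pow:
  assumes "t \<in> carrier G" "subgroup K G" "normalizes t K" "k \<in> K"
  shows "\<exists>k'\<in>K. (k \<otimes> t [^] (d::int)) [^] (q::int) = k' \<otimes> t [^] (d * q)"
proof -
  let ?g = "k \<otimes> t [^] d"
  have kG: "k \<in> carrier G" using subgroup.mem_carrier[OF assms(2,4)] .
  have gG: "?g \<in> carrier G" using kG assms(1) by simp
  have nat: "\<exists>k'\<in>K. ?g [^] int n = k' \<otimes> t [^] (d * int n)" for n
  proof (induction n)
    case 0
    show ?case using subgroup.one_closed[OF assms(2)] by (intro bexI[of _ "\<one>"]) simp_all
  next
    case (Suc n)
    then obtain k' where k': "k' \<in> K" "?g [^] int n = k' \<otimes> t [^] (d * int n)" by blast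
    have k'G: "k' \<in> carrier G" using subgroup.mem_carrier[OF assms(2) k'(1)] .
    have "?g [^] int (Suc n) = ?g [^] int n \<otimes> ?g"
      using int_pow_mult[OF gG, of "int n" 1] gG by (simp add: add.commute)
    also have "\<dots> = (k' \<otimes> conjg (t [^] (d * int n)) k) \<otimes> (t [^] (d * int n) \<otimes> t [^] d)"
      using kG k'G assms(1) unfolding k' conjg_def by (simp add: group_simps)
    also have "t [^] (d * int n) \<otimes> t [^] d = t [^] (d * int (Suc n))"
      using assms(1) by (simp add: int_pow_mult[symmetric] algebra_simps)
    finally have "?g [^] int (Suc n) = (k' \<otimes> conjg (t [^] (d * int n)) k) \<otimes> t [^] (d * int (Suc n))" .
    moreover have "conjg (t [^] (d * int n)) k \<in> K"
      using normalizes_int_pow[OF assms(1-3)] assms(4) kG unfolding normalizes_def by blast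
    then have "k' \<otimes> conjg (t [^] (d * int n)) k \<in> K" using subgroup.m_closed[OF assms(2) k'(1)] by blast
    ultimately show ?case by blast
  qed
  show ?thesis
  proof (cases "q \<ge> 0")
    case True
    then show ?thesis using nat[of "nat q"] by simp
  next
    case False
    then obtain n where q: "q = - int n" by (metis nat_0_le neg_0_le_iff_le linear minus_minus)
    obtain k' where k': "k' \<in> K" "?g [^] int n = k' \<otimes> t [^] (d * int n)" using nat by blast
    have k'G: "k' \<in> carrier G" using subgroup.mem_carrier[OF assms(2) k'(1)] .
    have "?g [^] q = inv (?g [^] int n)" unfolding q using gG by (simp add: int_pow_neg)
    also have "\<dots> = conjg (t [^] (d * q)) (inv k') \<otimes> t [^] (d * q)"
      using k'G assms(1) unfolding k' conjg_def q by (simp add: group_simps int_pow_neg)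
    finally have "?g [^] q = conjg (t [^] (d * q)) (inv k') \<otimes> t [^] (d * q)" .
    moreover have "conjg (t [^] (d * q)) (inv k') \<in> K"
      using normalizes_int_pow[OF assms(1-3)] subgroup.m_inv_closed[OF assms(2) k'(1)] k'G
      unfolding normalizes_def by blast
    ultimately show ?thesis by blast
  qed
qed

text \<open>Modulo \<open>L \<inter> K\<close> the intersection embeds in the cyclic quotient
  generated by \<open>t\<close>, so one further generator suffices.\<close>

lemma fg_Int_generate_insert:
  assumes t: "t \<in> carrier G" and K: "subgroup K G" "normalizes t K" and L: "subgroup L G"
    and fg: "fg_subgroup (L \<inter> K)"
  shows "fg_subgroup (L \<inter> generate G (insert t K))"
proof -
  let ?K = "generate G (insert t K)"
  \<comment> \<open>The exponents of \<open>t\<close> that occur in \<open>L\<close> modulo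
    \<open>K\<close>. Division with remainder by the least positive one, if there is one, yields the
    extra generator.\<close>
  define J where "J = {i::int. \<exists>k\<in>K. k \<otimes> t [^] i \<in> L}"
  have KG: "K \<subseteq> carrier G" using subgroup.subset[OF K(1)] .
  have subK: "subgroup ?K G" using t KG by (intro generate_is_subgroup) auto
  have KK: "K \<subseteq> ?K" and tK: "t \<in> ?K" by (auto intro: generate.incl)
  have powK: "t [^] i \<in> ?K" for i :: int using subgroup_int_pow_closed[OF subK tK] .
  show ?thesis
  proof (cases "\<exists>d\<in>J. d > 0")
    case False
    have J0: "i = 0" if i: "i \<in> J" for i
    proof -
      obtain k where k: "k \<in> K" "k \<otimes> t [^] i \<in> L" using i by (auto simp: J_def)
      have kG: "k \<in> carrier G" using k KG by blast
      have "inv (k \<otimes> t [^] i) = conjg (t [^] (- i)) (inv k) \<otimes> t [^] (- i)"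
        using kG t by (simp add: conjg_def group_simps int_pow_neg)
      moreover have "conjg (t [^] (- i)) (inv k) \<in> K"
        using normalizes_int_pow[OF t K] subgroup.m_inv_closed[OF K(1) k(1)] kG
        unfolding normalizes_def by blast
      moreover have "inv (k \<otimes> t [^] i) \<in> L" using subgroup.m_inv_closed[OF L k(2)] .
      ultimately have "- i \<in> J" unfolding J_def by auto
      then have "\<not> i > 0" "\<not> - i > 0" using False i by blast+
      then show ?thesis by simp
    qed
    have "L \<inter> ?K = L \<inter> K"
    proof
      show "L \<inter> ?K \<subseteq> L \<inter> K"
      proof
        fix x assume x: "x \<in> L \<inter> ?K"
        then obtain k and i :: int where k: "k \<in> K" "x = k \<otimes> t [^] i"
          using generate_insert_normalized[OF t K] by blast
        then have "i \<in> J" using x by (auto simp: J_def)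
        then have "x = k" using J0[of i] k subgroup.mem_carrier[OF K(1)] by simp
        then show "x \<in> L \<inter> K" using x k by simp
      qed
    qed (use KK in blast)
    then show ?thesis using fg by simp
  next
    case True
    then obtain d0 where d0: "d0 \<in> J" "d0 > 0" by blast
    define n where "n = (LEAST n. n > 0 \<and> int n \<in> J)"
    have ex: "nat d0 > 0 \<and> int (nat d0) \<in> J" using d0 by simp
    have n: "n > 0 \<and> int n \<in> J" unfolding n_def by (rule LeastI[where P = "\<lambda>n. n > 0 \<and> int n \<in> J", OF ex])
    have nmin: "n \<le> m" if "m > 0" "int m \<in> J" for m unfolding n_def using that by (intro Least_le) simp
    obtain k0 where k0: "k0 \<in> K" "k0 \<otimes> t [^] int n \<in> L" using n by (auto simp: J_def)
    define g where "g = k0 \<otimes> t [^] int n"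
    have gL: "g \<in> L" using k0 by (simp add: g_def)
    have gG: "g \<in> carrier G" using subgroup.mem_carrier[OF L gL] .
    have gK: "g \<in> ?K" unfolding g_def using subgroup.m_closed[OF subK _ powK] KK k0(1) by blast
    have "L \<inter> ?K = generate G ((L \<inter> K) \<union> {g})"
    proof
      show "generate G ((L \<inter> K) \<union> {g}) \<subseteq> L \<inter> ?K"
        using KK gL gK subgroup_Int_subgroup[OF L subK] by (intro generate_subgroup_incl) auto
      show "L \<inter> ?K \<subseteq> generate G ((L \<inter> K) \<union> {g})"
      proof
        fix x assume x: "x \<in> L \<inter> ?K"
        then obtain k and i :: int where k: "k \<in> K" "x = k \<otimes> t [^] i"
          using generate_insert_normalized[OF t K] by blast
        define q where "q = i div int n"
        obtain k' where k': "k' \<in> K" "g [^] (- q) = k' \<otimes> t [^] (int n * (- q))"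
          unfolding g_def using normalized_coset_pow[OF t K k0(1)] by blast
        have G: "k \<in> carrier G" "k' \<in> carrier G" "x \<in> carrier G" using k k' KG t by auto
        define y where "y = x \<otimes> g [^] (- q)"
        have yL: "y \<in> L" unfolding y_def
          using x subgroup.m_closed[OF L _ subgroup_int_pow_closed[OF L gL]] by blast
        have "y = (k \<otimes> conjg (t [^] i) k') \<otimes> (t [^] i \<otimes> t [^] (int n * (- q)))"
          unfolding y_def k'(2) k(2) conjg_def using G t by (simp add: group_simps)
        also have "t [^] i \<otimes> t [^] (int n * (- q)) = t [^] (i mod int n)"
          using t by (simp add: int_pow_mult[symmetric] q_def minus_mult_div_eq_mod)
        finally have y: "y = (k \<otimes> conjg (t [^] i) k') \<otimes> t [^] (i mod int n)" .
        have "conjg (t [^] i) k' \<in> K"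
          using normalizes_int_pow[OF t K] k'(1) G unfolding normalizes_def by blast
        then have kk: "k \<otimes> conjg (t [^] i) k' \<in> K" using subgroup.m_closed[OF K(1) k(1)] by blast
        then have iJ: "i mod int n \<in> J" unfolding J_def using kk yL[unfolded y] by blast
        have "i mod int n = 0"
        proof (rule ccontr)
          assume "i mod int n \<noteq> 0"
          moreover have "i mod int n \<ge> 0" "i mod int n < int n"
            using n by (auto intro: pos_mod_sign pos_mod_bound)
          ultimately have pos: "i mod int n > 0" "i mod int n < int n" by linarith+
          have "int (nat (i mod int n)) = i mod int n" using pos(1) by simp
          then have "n \<le> nat (i mod int n)" using nmin[of "nat (i mod int n)"] pos(1) iJ by simp
          then show False using pos by linarith
        qed
        then have "y \<in> L \<inter> K" using y yL kk G t subgroup.mem_carrier[OF K(1) kk] by simp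
        moreover have "x = y \<otimes> g [^] q"
          unfolding y_def using G gG by (simp add: m_assoc int_pow_neg)
        moreover have "g [^] q \<in> generate G ((L \<inter> K) \<union> {g})"
          using gG KG by (intro subgroup_int_pow_closed[OF generate_is_subgroup]) (auto intro: generate.incl)
        ultimately show "x \<in> generate G ((L \<inter> K) \<union> {g})" by (simp add: generate.eng generate.incl)
      qed
    qed
    then show ?thesis using fg_generate_insert[OF fg, of "{g}"] gG by simp
  qed
qed

section \<open>Nilpotency modulo a normal subgroup\<close>

definition nilpotent_mod :: "'a set \<Rightarrow> nat \<Rightarrow> 'a set \<Rightarrow> bool" where
  "nilpotent_mod P c M \<longleftrightarrow> (\<forall>n g. c < n \<longrightarrow> weighted_commutator P n g \<longrightarrow> g \<in> M)"

definition normal_in :: "'a set \<Rightarrow> 'a set \<Rightarrow> bool" where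
  "normal_in M P \<longleftrightarrow> subgroup M G \<and> subgroup P G \<and> M \<subseteq> P \<and> (\<forall>g\<in>P. normalizes g M)"

lemma normal_inD:
  assumes "normal_in M P"
  shows "subgroup M G" "subgroup P G" "M \<subseteq> P" "\<And>g. g \<in> P \<Longrightarrow> normalizes g M"
  using assms unfolding normal_in_def by blast+

lemma normal_in_conjg:
  assumes "normal_in M P" "g \<in> P" "x \<in> M"
  shows "conjg g x \<in> M"
  using normal_inD(4)[OF assms(1,2)] assms(3) subgroup.mem_carrier[OF normal_inD(1)[OF assms(1)]]
  unfolding normalizes_def by blast

lemma normal_inI:
  assumes "subgroup M G" "subgroup P G" "M \<subseteq> P" "\<And>g x. g \<in> P \<Longrightarrow> x \<in> M \<Longrightarrow> conjg g x \<in> M"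
  shows "normal_in M P"
  unfolding normal_in_def
proof (intro conjI ballI assms(1-3))
  fix g assume g: "g \<in> P"
  then have "inv g \<in> P" using subgroup.m_inv_closed[OF assms(2)] by blast
  with g show "normalizes g M"
    using subgroup.mem_carrier[OF assms(2)] assms(4) by (intro normalizesI) blast+
qed

lemma normal_in_commutator:
  assumes "normal_in M P" "g \<in> P" "x \<in> M"
  shows "commutator g x \<in> M" "commutator x g \<in> M"
proof -
  have G: "g \<in> carrier G" "x \<in> carrier G"
    using assms(2,3) subgroup.mem_carrier[OF normal_inD(1)[OF assms(1)]]
      subgroup.mem_carrier[OF normal_inD(2)[OF assms(1)]] by blast+
  have "commutator g x = conjg g x \<otimes> inv x" by (simp add: commutator_def conjg_def)
  then show 1: "commutator g x \<in> M"
    using subgroup.m_closed[OF normal_inD(1)[OF assms(1)] normal_in_conjg[OF assms]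
        subgroup.m_inv_closed[OF normal_inD(1)[OF assms(1)] assms(3)]] by simp
  have "commutator x g = inv (commutator g x)" using G by (simp add: inv_commutator)
  then show "commutator x g \<in> M" using subgroup.m_inv_closed[OF normal_inD(1)[OF assms(1)] 1] by simp
qed

text \<open>Nilpotency of \<open>K / M\<close> is expressed by commutators inside \<open>K\<close>,
  without forming the quotient, so that different \<open>M\<close> are easily compared.\<close>

definition virtually_nilpotent :: "'a set \<Rightarrow> 'a set \<Rightarrow> bool" where
  "virtually_nilpotent P M \<longleftrightarrow>
     normal_in M P \<and> (\<exists>K c. finite_index K P \<and> M \<subseteq> K \<and> nilpotent_mod K c M)"

lemma nilpotent_mod_mono:
  "nilpotent_mod P c M \<Longrightarrow> c \<le> d \<Longrightarrow> M \<subseteq> N \<Longrightarrow> Q \<subseteq> P \<Longrightarrow> nilpotent_mod Q d N"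
  unfolding nilpotent_mod_def using weighted_commutator_mono
  by (meson le_less_trans subset_iff)

text \<open>A commutator of weight above \<open>2 * c + 1\<close> has an entry of weight above
  \<open>c\<close>, which lies in \<open>K\<close> and is therefore central modulo
  \<open>K'\<close>. Doubling the bound is harmless, since only finiteness of the class
  matters.\<close>

lemma nilpotent_mod_step:
  assumes P: "subgroup P G" and nil: "nilpotent_mod P c K" and K': "subgroup K' G"
    and com: "\<And>x k. x \<in> P \<Longrightarrow> k \<in> K \<Longrightarrow> k \<in> P \<Longrightarrow> commutator x k \<in> K'"
  shows "nilpotent_mod P (2 * c + 1) K'"
  unfolding nilpotent_mod_def
proof (intro allI impI)
  fix n g assume n: "2 * c + 1 < n" and "weighted_commutator P n g"
  from this(2) show "g \<in> K'"
  proof cases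
    case base
    then show ?thesis using n by simp
  next
    case (commutator i u j v)
    have uv: "u \<in> P" "v \<in> P"
      using commutator weighted_commutator_in_subgroup[OF _ P] by blast+
    have uvG: "u \<in> carrier G" "v \<in> carrier G" using uv subgroup.mem_carrier[OF P] by blast+
    from n commutator(1) consider "c < i" | "c < j" by linarith
    then show ?thesis
    proof cases
      case 1
      then have "u \<in> K" using nil commutator(3) unfolding nilpotent_mod_def by blast
      then have "commutator v u \<in> K'" using com uv by blast
      then have "inv (commutator v u) \<in> K'" by (rule subgroup.m_inv_closed[OF K'])
      then show ?thesis using commutator(2) uvG by (simp add: inv_commutator)
    next
      case 2
      then have "v \<in> K" using nil commutator(4) unfolding nilpotent_mod_def by blast
      then show ?thesis using com uv commutator(2) by blast
    qed
  qed
qed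

lemma commutator_mult_left:
  "x \<in> carrier G \<Longrightarrow> y \<in> carrier G \<Longrightarrow> t \<in> carrier G \<Longrightarrow>
    commutator (x \<otimes> y) t = conjg x (commutator y t) \<otimes> commutator x t"
  by (simp add: commutator_def conjg_def group_simps)

lemma commutator_mult_right:
  "x \<in> carrier G \<Longrightarrow> y \<in> carrier G \<Longrightarrow> t \<in> carrier G \<Longrightarrow>
    commutator t (x \<otimes> y) = commutator t x \<otimes> conjg x (commutator t y)"
  by (simp add: commutator_def conjg_def group_simps)

lemma commutator_inv_left:
  "x \<in> carrier G \<Longrightarrow> t \<in> carrier G \<Longrightarrow>
    commutator (inv x) t = conjg (inv x) (inv (commutator x t))"
  by (simp add: commutator_def conjg_def group_simps)

text \<open>Modulo \<open>K\<close>, which is normalized by all elements in question, those that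
  commute with \<open>t\<close> are closed under products and inverses.\<close>

lemma commutator_generate_left:
  assumes K: "subgroup K G" and S: "S \<subseteq> carrier G" "\<And>x. x \<in> generate G S \<Longrightarrow> normalizes x K"
    and t: "t \<in> carrier G" "\<And>s. s \<in> S \<Longrightarrow> commutator s t \<in> K" and x: "x \<in> generate G S"
  shows "commutator x t \<in> K"
  using x
proof induction
  case one
  then show ?case using t(1) subgroup.one_closed[OF K] by (simp add: commutator_def)
next
  case (incl h)
  then show ?case by (rule t(2))
next
  case (inv h)
  have hG: "h \<in> carrier G" using inv S(1) by blast
  have "inv (commutator h t) \<in> K" using subgroup.m_inv_closed[OF K t(2)[OF inv]] .
  moreover have "normalizes (inv h) K" using S(2)[OF generate.inv[OF inv]] .
  ultimately show ?case
    using hG t(1) subgroup.mem_carrier[OF K] unfolding commutator_inv_left[OF hG t(1)] normalizes_def by blast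
next
  case (eng h1 h2)
  have G: "h1 \<in> carrier G" "h2 \<in> carrier G" using eng.hyps generate_in_carrier[OF S(1)] by blast+
  have "conjg h1 (commutator h2 t) \<in> K"
    using S(2)[OF eng.hyps(1)] eng.IH(2) subgroup.mem_carrier[OF K] unfolding normalizes_def by blast
  then show ?case unfolding commutator_mult_left[OF G t(1)] by (rule subgroup.m_closed[OF K _ eng.IH(1)])
qed

lemma commutator_generate_right:
  assumes K: "subgroup K G" and S: "S \<subseteq> carrier G" "\<And>x. x \<in> generate G S \<Longrightarrow> normalizes x K"
    and t: "t \<in> carrier G" "\<And>s. s \<in> S \<Longrightarrow> commutator t s \<in> K" and x: "x \<in> generate G S"
  shows "commutator t x \<in> K"
proof -
  have "commutator x t \<in> K"
  proof (rule commutator_generate_left[OF K S t(1) _ x])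
    fix s assume s: "s \<in> S"
    have "inv (commutator t s) \<in> K" using subgroup.m_inv_closed[OF K t(2)[OF s]] .
    then show "commutator s t \<in> K" using s S(1) t(1) by (metis inv_commutator subset_iff)
  qed
  then have "inv (commutator x t) \<in> K" using subgroup.m_inv_closed[OF K] by blast
  then show ?thesis using generate_in_carrier[OF S(1) x] t(1) by (simp add: inv_commutator)
qed

text \<open>\<open>chain_list\<close> controls commutators of list entries only. Normality of the
  smaller suffix group extends this to products, first in \<open>x\<close> with \<open>t\<close>
  fixed and then in \<open>k\<close>.\<close>

lemma chain_list_central:
  assumes ch: "chain_list A ts" and N: "normal_in N (generate G (set ts))" "A \<subseteq> N"
    and d: "ts = us @ t # vs" and x: "x \<in> generate G (set ts)"
    and k: "k \<in> generate G (N \<union> set (t # vs))"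
  shows "commutator x k \<in> generate G (N \<union> set vs)"
proof -
  let ?P = "generate G (set ts)" and ?K = "generate G (N \<union> set vs)"
  have tsG: "set ts \<subseteq> carrier G" using ch by (simp add: chain_list_def)
  have NG: "N \<subseteq> carrier G" using subgroup.subset[OF normal_inD(1)[OF N(1)]] .
  have ts_P: "t \<in> ?P" if "t \<in> set ts" for t using that by (rule generate.incl)
  have Kn: "normalizes y ?K" if "y \<in> ?P" for y
    using chain_list_normalizes[OF ch normal_inD(1)[OF N(1)] N(2) normal_inD(4)[OF N(1) ts_P] _ that, of "us @ [t]" vs] d
    by simp
  have subK: "subgroup ?K G" using tsG NG d by (intro generate_is_subgroup) auto
  have KP: "?K \<subseteq> ?P"
    using normal_inD(3)[OF N(1)] d ts_P normal_inD(2)[OF N(1)] by (intro generate_subgroup_incl) auto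
  have K_normal: "normal_in ?K ?P"
    unfolding normal_in_def using subK normal_inD(2)[OF N(1)] KP Kn by blast
  have xG: "x \<in> carrier G" using generate_in_carrier[OF tsG x] .
  have SG: "N \<union> set (t # vs) \<subseteq> carrier G" using NG tsG d by auto
  show ?thesis
  proof (rule commutator_generate_right[OF subK SG _ xG _ k])
    fix y assume "y \<in> generate G (N \<union> set (t # vs))"
    moreover have "generate G (N \<union> set (t # vs)) \<subseteq> ?P"
      using normal_inD(3)[OF N(1)] d ts_P normal_inD(2)[OF N(1)] by (intro generate_subgroup_incl) auto
    ultimately show "normalizes y ?K" using Kn by blast
  next
    fix s assume s: "s \<in> N \<union> set (t # vs)"
    show "commutator x s \<in> ?K"
    proof (cases "s = t")
      case True
      have tG: "t \<in> carrier G" using tsG d by simp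
      show ?thesis unfolding True
      proof (rule commutator_generate_left[OF subK tsG Kn tG _ x])
        fix y assume "y \<in> set ts"
        then have "commutator y t \<in> A \<union> set vs" using ch[unfolded chain_list_def] d by blast
        then have "commutator y t \<in> N \<union> set vs" using N(2) by blast
        then show "commutator y t \<in> ?K" by (rule generate.incl)
      qed
    next
      case False
      then have "s \<in> N \<union> set vs" using s by auto
      then have "s \<in> ?K" by (rule generate.incl)
      then show ?thesis using normal_in_commutator(1)[OF K_normal x] by blast
    qed
  qed
qed

text \<open>Every entry of the list contributes one central step on the way down to
  \<open>N\<close>.\<close>

lemma chain_list_nilpotent:
  assumes ch: "chain_list A ts" and N: "normal_in N (generate G (set ts))" "A \<subseteq> N"
  shows "\<exists>c. nilpotent_mod (generate G (set ts)) c N"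
proof -
  let ?P = "generate G (set ts)"
  have tsG: "set ts \<subseteq> carrier G" using ch by (simp add: chain_list_def)
  have NG: "N \<subseteq> carrier G" using subgroup.subset[OF normal_inD(1)[OF N(1)]] .
  have "ts = us @ vs \<Longrightarrow> \<exists>c. nilpotent_mod ?P c (generate G (N \<union> set vs))" for us vs
  proof (induction us arbitrary: vs rule: rev_induct)
    case Nil
    have "?P \<subseteq> generate G (N \<union> set vs)" using Nil by (intro mono_generate) auto
    then show ?case unfolding nilpotent_mod_def
      using weighted_commutator_in_subgroup[OF _ normal_inD(2)[OF N(1)] subset_refl] by blast
  next
    case (snoc t us)
    then have d: "ts = us @ t # vs" by simp
    obtain c where c: "nilpotent_mod ?P c (generate G (N \<union> set (t # vs)))" using snoc.IH[OF d] by blast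
    have "subgroup (generate G (N \<union> set vs)) G" using tsG NG d by (intro generate_is_subgroup) auto
    from nilpotent_mod_step[OF normal_inD(2)[OF N(1)] c this chain_list_central[OF ch N d]]
    show ?case by blast
  qed
  from this[of ts "[]"] show ?thesis using generate_subgroup_id[OF normal_inD(1)[OF N(1)]] by simp
qed

text \<open>The group generated by the list is polycyclic modulo \<open>N\<close>, so generators of
  \<open>L\<close> are found one cyclic step at a time.\<close>

lemma chain_list_fg:
  assumes ch: "chain_list A ts" and N: "normal_in N (generate G (set ts))" "A \<subseteq> N" "fg_subgroup N"
    and L: "subgroup L G" "N \<subseteq> L" "L \<subseteq> generate G (set ts)"
  shows "fg_subgroup L"
proof -
  let ?P = "generate G (set ts)"
  have tsG: "set ts \<subseteq> carrier G" using ch by (simp add: chain_list_def)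
  have NG: "N \<subseteq> carrier G" using subgroup.subset[OF normal_inD(1)[OF N(1)]] .
  have "ts = us @ vs \<Longrightarrow> fg_subgroup (L \<inter> generate G (N \<union> set vs))" for us vs
  proof (induction vs arbitrary: us)
    case Nil
    have "L \<inter> N = N" using L(2) by blast
    then show ?case using N(3) generate_subgroup_id[OF normal_inD(1)[OF N(1)]] by simp
  next
    case (Cons t vs)
    have tvG: "set (t # vs) \<subseteq> carrier G" using tsG Cons.prems by auto
    have "t \<in> ?P" using Cons.prems by (intro generate.incl) simp
    have nt: "normalizes t (generate G (N \<union> set vs))"
      using chain_list_normalizes[OF ch normal_inD(1)[OF N(1)] N(2) normal_inD(4)[OF N(1) generate.incl] _ \<open>t \<in> ?P\<close>, of "us @ [t]" vs]
        Cons.prems by simp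
    have "fg_subgroup (L \<inter> generate G (N \<union> set vs))" using Cons.IH[of "us @ [t]"] Cons.prems by simp
    moreover have "subgroup (generate G (N \<union> set vs)) G" using NG tvG by (intro generate_is_subgroup) auto
    ultimately show ?case unfolding generate_insert_suffix[OF NG tvG]
      using tvG nt L(1) by (intro fg_Int_generate_insert) auto
  qed
  from this[of "[]" ts] have "fg_subgroup (L \<inter> generate G (N \<union> set ts))" by simp
  moreover have "?P \<subseteq> generate G (N \<union> set ts)" by (intro mono_generate) auto
  then have "L \<inter> generate G (N \<union> set ts) = L" using L(3) by blast
  ultimately show ?thesis by simp
qed

text \<open>The point is that the bound \<open>4 ^ (2 * c)\<close> on the lengths does not depend on \<open>D\<close>.\<close>

lemma slow_chain_list:
  assumes P: "slow P" and c: "c \<ge> 1" and M: "normal_in M P" and nil: "nilpotent_mod P c M"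
  obtains X ts A where "finite X" "X \<subseteq> carrier G"
    "A \<subseteq> word_ball X (4 ^ (2 * c))" "set ts \<subseteq> word_ball X (4 ^ (2 * c))"
    "\<exists>n0. \<forall>n\<ge>n0. card (word_ball X (D * n)) < 2 ^ n"
    "generate G (set ts) = P" "chain_list A ts" "A \<subseteq> M" "fg_subgroup (closure_under A (set ts) {\<one>})"
proof -
  let ?l = "4 ^ (2 * c) :: nat"
  \<comment> \<open>One set \<open>X\<close> has to serve both the caller, with the constant
    \<open>D\<close>, and the walk, with \<open>3 * ?l\<close>.\<close>
  obtain X n0 where X: "finite X" "X \<subseteq> carrier G" "generate G X = P"
    and n0: "\<And>n. n \<ge> n0 \<Longrightarrow> card (word_ball X (max D (3 * ?l) * n)) < 2 ^ n"
    using P unfolding slow_def by blast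
  have slowX: "\<exists>n0. \<forall>n\<ge>n0. card (word_ball X (E * n)) < 2 ^ n" if E: "E \<le> max D (3 * ?l)" for E
  proof (intro exI[of _ n0] allI impI)
    fix n assume "n \<ge> n0"
    have "word_ball X (E * n) \<subseteq> word_ball X (max D (3 * ?l) * n)"
      by (intro word_ball_mono mult_le_mono1 E)
    then have "card (word_ball X (E * n)) \<le> card (word_ball X (max D (3 * ?l) * n))"
      by (intro card_mono finite_word_ball X(1))
    then show "card (word_ball X (E * n)) < 2 ^ n" using n0[OF \<open>n \<ge> n0\<close>] by linarith
  qed
  obtain ts A where ts: "finite A" "A \<subseteq> word_ball X ?l" "set ts \<subseteq> word_ball X ?l"
    "X \<subseteq> set ts" "chain_list A ts" "\<forall>a\<in>A. \<exists>n>c. weighted_commutator (X \<union> m_inv G ` X) n a"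
    by (rule short_chain_list[OF X(1,2) c])
  have subP: "subgroup P G" using normal_inD(2)[OF M] .
  have XP: "X \<union> m_inv G ` X \<subseteq> P" unfolding X(3)[symmetric] by (auto intro: generate.incl generate.inv)
  have AM: "A \<subseteq> M"
  proof
    fix a assume "a \<in> A"
    then obtain n where n: "n > c" "weighted_commutator (X \<union> m_inv G ` X) n a" using ts(6) by blast
    have "weighted_commutator P n a" by (rule weighted_commutator_mono[OF n(2) XP])
    then show "a \<in> M" using nil n(1) unfolding nilpotent_mod_def by blast
  qed
  have tsG: "set ts \<subseteq> carrier G" using ts(3) word_ball_subset[OF X(2)] by blast
  have gen: "generate G (set ts) = P"
  proof
    have "set ts \<subseteq> P" using ts(3) word_ball_subset_generate[OF X(2)] X(3) by blast
    then show "generate G (set ts) \<subseteq> P" by (rule generate_subgroup_incl[OF _ subP])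
    show "P \<subseteq> generate G (set ts)" unfolding X(3)[symmetric] by (rule mono_generate[OF ts(4)])
  qed
  interpret S: slow_generators G X A ?l
    by unfold_locales (use X ts slowX[of "3 * ?l"] in auto)
  have "S.good (set ts)"
  proof (rule S.good_list[OF ts(3)])
    fix us t vs s assume d: "ts = us @ t # vs" and s: "s \<in> set vs"
    then obtain as bs where vs: "vs = as @ s # bs" by (meson split_list)
    \<comment> \<open>The commutator falls into \<open>A\<close> or behind \<open>s\<close> in the
      list. The fact is needed for \<open>y = t\<close> and for \<open>y = inv t\<close>.\<close>
    have *: "conjg y s \<in> generate G (A \<union> set vs)" if y: "y \<in> set ts" for y
    proof -
      have "ts = (us @ t # as) @ s # bs" using d vs by simp
      then have "commutator y s \<in> A \<union> set bs" using ts(5) y unfolding chain_list_def by blast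
      then have "commutator y s \<in> A \<union> set vs" using vs by auto
      then have "commutator y s \<otimes> s \<in> generate G (A \<union> set vs)"
        using s by (intro generate.eng generate.incl) auto
      moreover have "y \<in> carrier G" "s \<in> carrier G" using tsG y s d by auto
      ultimately show ?thesis by (simp add: conjg_eq_commutator)
    qed
    have "t \<in> set ts" "t \<in> carrier G" using d tsG by auto
    moreover have "inv t \<in> set ts" using ts(5) \<open>t \<in> set ts\<close> unfolding chain_list_def by blast
    ultimately show "t \<otimes> s \<otimes> inv t \<in> generate G (A \<union> set vs) \<and> inv t \<otimes> s \<otimes> t \<in> generate G (A \<union> set vs)"
      using *[of t] *[of "inv t"] by (simp add: conjg_def)
  qed
  then have "fg_subgroup (closure_under A (set ts) {\<one>})" by (rule S.fg_closure_under[OF tsG])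
  then show thesis using that[OF X(1,2) ts(2,3) _ gen ts(5) AM] slowX[of D] by simp
qed

text \<open>The walk shows that the normal closure \<open>?R\<close> of the relators in
  \<open>P\<close> is finitely generated. It lies in \<open>M\<close>, and \<open>P\<close> is
  polycyclic modulo \<open>?R\<close>, so every subgroup above \<open>?R\<close> is finitely
  generated. The case \<open>L = M\<close> is included.\<close>

lemma fg_above_nilpotent_mod:
  assumes "slow P" "normal_in M P" "nilpotent_mod P c M" "subgroup L G" "M \<subseteq> L" "L \<subseteq> P"
  shows "fg_subgroup L"
proof -
  \<comment> \<open>The successor makes the weight bound positive, as \<open>slow_chain_list\<close>
    requires.\<close>
  have nil: "nilpotent_mod P (Suc c) M" using nilpotent_mod_mono[OF assms(3)] by simp
  obtain X ts A where ts: "finite X" "X \<subseteq> carrier G"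
    "A \<subseteq> word_ball X (4 ^ (2 * Suc c))" "set ts \<subseteq> word_ball X (4 ^ (2 * Suc c))"
    "\<exists>n0. \<forall>n\<ge>n0. card (word_ball X (0 * n)) < 2 ^ n"
    "generate G (set ts) = P" "chain_list A ts" "A \<subseteq> M" "fg_subgroup (closure_under A (set ts) {\<one>})"
    by (rule slow_chain_list[OF assms(1) _ assms(2) nil, where D = 0]) auto
  let ?R = "closure_under A (set ts) {\<one>}"
  have tsG: "set ts \<subseteq> carrier G" using ts(7) by (simp add: chain_list_def)
  have tsP: "t \<in> P" if "t \<in> set ts" for t unfolding ts(6)[symmetric] using that by (rule generate.incl)
  have R: "subgroup ?R G" using fg_subgroup_is_subgroup[OF ts(9)] .
  have RM: "?R \<subseteq> M"
    using normal_inD[OF assms(2)] ts(8) tsP subgroup.one_closed by (intro closure_under_least) auto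
  have "normalizes g ?R" if "g \<in> generate G (set ts)" for g
    using normalizes_generate[OF tsG closure_under_normalizes that] .
  then have Rn: "normal_in ?R (generate G (set ts))"
    unfolding normal_in_def ts(6) using R normal_inD(2,3)[OF assms(2)] RM by blast
  show ?thesis
    using chain_list_fg[OF ts(7) Rn closure_under_incl(2) ts(9) assms(4)] RM assms(5,6) ts(6) by blast
qed

lemma fg_above_virtually_nilpotent:
  assumes "slow P" "virtually_nilpotent P M" "subgroup L G" "M \<subseteq> L" "L \<subseteq> P"
  shows "fg_subgroup L"
proof -
  obtain K c where K: "finite_index K P" "M \<subseteq> K" "nilpotent_mod K c M" and M: "normal_in M P"
    using assms(2) unfolding virtually_nilpotent_def by blast
  have "normal_in M K"
    unfolding normal_in_def using normal_inD[OF M] finite_indexD[OF K(1)] K(2) by blast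
  moreover have "subgroup (K \<inter> L) G" using subgroup_Int_subgroup[OF finite_indexD(1)[OF K(1)] assms(3)] .
  ultimately have "fg_subgroup (K \<inter> L)"
    using fg_above_nilpotent_mod[OF finite_index_slow[OF K(1) assms(1)] _ K(3)] K(2) assms(4) by blast
  then show ?thesis using finite_index_fg_up[OF finite_index_Int[OF K(1) assms(3,5)]] by blast
qed

end

section \<open>Virtual nilpotency under changes of finite index\<close>

context group
begin

text \<open>The powers of \<open>t\<close> with exponents from 0 to \<open>n - 1\<close> represent
  all cosets.\<close>

lemma finite_index_generate_insert:
  assumes t: "t \<in> carrier G" and K: "subgroup K G" "normalizes t K" and n: "t [^] (n::nat) \<in> K" "n > 0"
  shows "finite_index K (generate G (insert t K))"
proof -
  let ?P = "generate G (insert t K)"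
  let ?T = "(\<lambda>i. t [^] int i) ` {..<n}"
  have KG: "K \<subseteq> carrier G" using subgroup.subset[OF K(1)] .
  have subP: "subgroup ?P G" using t KG by (intro generate_is_subgroup) auto
  have tP: "t \<in> ?P" and KP: "K \<subseteq> ?P" by (auto intro: generate.incl)
  have "\<exists>s\<in>?T. g \<otimes> inv s \<in> K" if "g \<in> ?P" for g
  proof -
    obtain k and i :: int where k: "k \<in> K" "g = k \<otimes> t [^] i"
      using generate_insert_normalized[OF t K \<open>g \<in> ?P\<close>] by blast
    have kG: "k \<in> carrier G" using k(1) KG by blast
    define \<rho> where "\<rho> = nat (i mod int n)"
    have \<rho>: "int \<rho> = i mod int n" "\<rho> < n" using n(2) by (simp_all add: \<rho>_def nat_less_iff)
    have "t [^] (int n * (i div int n)) = (t [^] int n) [^] (i div int n)"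
      using int_pow_pow[OF t] by simp
    also have "\<dots> \<in> K" using subgroup_int_pow_closed[OF K(1)] n(1) by (simp add: int_pow_int)
    finally have tK: "t [^] (int n * (i div int n)) \<in> K" .
    have "g \<otimes> inv (t [^] int \<rho>) = k \<otimes> (t [^] i \<otimes> t [^] (- int \<rho>))"
      unfolding k(2) using kG t by (simp add: m_assoc int_pow_neg)
    also have "t [^] i \<otimes> t [^] (- int \<rho>) = t [^] (i + - int \<rho>)" by (rule int_pow_mult[OF t, symmetric])
    also have "i + - int \<rho> = int n * (i div int n)" unfolding \<rho>(1) by (simp add: minus_mod_eq_mult_div)
    finally have "g \<otimes> inv (t [^] int \<rho>) \<in> K" using subgroup.m_closed[OF K(1) k(1) tK] by simp
    moreover have "t [^] int \<rho> \<in> ?T" using \<rho>(2) by blast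
    ultimately show ?thesis by blast
  qed
  moreover have "finite ?T" by simp
  moreover have "?T \<subseteq> ?P" using subgroup_int_pow_closed[OF subP tP] by blast
  ultimately show ?thesis unfolding finite_index_def using K(1) subP KP by blast
qed

text \<open>The set is the preimage in \<open>P\<close> of the centralizer of \<open>t\<close>
  modulo \<open>C\<close>.\<close>

lemma commutator_kernel_normal:
  assumes C: "normal_in C P" and t: "t \<in> P"
  shows "subgroup {g \<in> P. commutator g t \<in> C} G"
proof (rule subgroupI)
  have P: "subgroup P G" and Csub: "subgroup C G" using normal_inD[OF C] by blast+
  have PG: "x \<in> carrier G" if "x \<in> P" for x using subgroup.mem_carrier[OF P that] .
  show "{g \<in> P. commutator g t \<in> C} \<subseteq> carrier G" using PG by blast
  have "\<one> \<in> {g \<in> P. commutator g t \<in> C}"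
    using subgroup.one_closed[OF P] subgroup.one_closed[OF Csub] PG[OF t] by (simp add: commutator_def)
  then show "{g \<in> P. commutator g t \<in> C} \<noteq> {}" by blast
  fix g assume g: "g \<in> {g \<in> P. commutator g t \<in> C}"
  then have gP: "g \<in> P" "commutator g t \<in> C" "inv g \<in> P" using subgroup.m_inv_closed[OF P] by blast+
  show "inv g \<in> {g \<in> P. commutator g t \<in> C}"
    using gP commutator_inv_left[OF PG[OF gP(1)] PG[OF t]]
      normal_in_conjg[OF C gP(3) subgroup.m_inv_closed[OF Csub gP(2)]] by simp
  fix h assume h: "h \<in> {g \<in> P. commutator g t \<in> C}"
  then have hP: "h \<in> P" "commutator h t \<in> C" by blast+
  show "g \<otimes> h \<in> {g \<in> P. commutator g t \<in> C}"
    using subgroup.m_closed[OF P gP(1) hP(1)] commutator_mult_left[OF PG[OF gP(1)] PG[OF hP(1)] PG[OF t]]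
      subgroup.m_closed[OF Csub normal_in_conjg[OF C gP(1) hP(2)] gP(2)] by simp
qed

text \<open>Modulo \<open>C\<close>, the element \<open>t\<close> has at most as many conjugates
  under \<open>P\<close> as there are cosets of \<open>C\<close> in \<open>K\<close>.\<close>

lemma commutator_kernel_finite_index:
  assumes C: "normal_in C P" and t: "t \<in> P" and K: "finite_index C K"
    and com: "\<And>g. g \<in> P \<Longrightarrow> commutator g t \<in> K"
  shows "finite_index {g \<in> P. commutator g t \<in> C} P"
\<comment> \<open>Conjugates of \<open>t\<close> label left cosets of its centralizer; passing to
  \<open>inv g\<close> turns them into right cosets.\<close>
proof (rule finite_indexI[where f = "\<lambda>g. C #> commutator (inv g) t"])
  have P: "subgroup P G" and Csub: "subgroup C G" using normal_inD[OF C] by blast+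
  have PG: "x \<in> carrier G" if "x \<in> P" for x using subgroup.mem_carrier[OF P that] .
  have Pinv: "inv x \<in> P" if "x \<in> P" for x using subgroup.m_inv_closed[OF P that] .
  let ?Z = "{g \<in> P. commutator g t \<in> C}"
  show Z: "subgroup ?Z G" by (rule commutator_kernel_normal[OF C t])
  show "subgroup P G" by fact
  show "?Z \<subseteq> P" by blast
  have "(\<lambda>g. C #> commutator (inv g) t) ` P \<subseteq> (\<lambda>k. C #> k) ` K" using com Pinv by blast
  then show "finite ((\<lambda>g. C #> commutator (inv g) t) ` P)"
    using finite_index_cosets[OF K] finite_subset by blast
  fix g h assume gh: "g \<in> P" "h \<in> P" "C #> commutator (inv g) t = C #> commutator (inv h) t"
  have G: "g \<in> carrier G" "h \<in> carrier G" "t \<in> carrier G" using gh t PG by blast+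
  have "commutator (inv g) t \<otimes> inv (commutator (inv h) t) \<in> C"
    using gh(3) r_coset_eq_iff[OF Csub] G by simp
  then have "conjg h (commutator (inv g) t \<otimes> inv (commutator (inv h) t)) \<in> C"
    by (rule normal_in_conjg[OF C gh(2)])
  moreover have "conjg h (commutator (inv g) t \<otimes> inv (commutator (inv h) t)) = commutator (h \<otimes> inv g) t"
    using G by (simp add: conjg_def commutator_def group_simps)
  ultimately have "h \<otimes> inv g \<in> ?Z"
    using subgroup.m_closed[OF P gh(2) Pinv[OF gh(1)]] by simp
  then have "inv (h \<otimes> inv g) \<in> ?Z" by (rule subgroup.m_inv_closed[OF Z])
  then show "g \<otimes> inv h \<in> ?Z" using G by (simp add: inv_mult_group)
qed

text \<open>Only finitely many representatives of \<open>M / H\<close> have to be centralized, so a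
  subgroup \<open>C\<close> of finite index centralizes all of \<open>M / H\<close>. On
  \<open>K \<inter> C\<close> this section is one more central step.\<close>

lemma virtually_nilpotent_finite_section:
  assumes M: "virtually_nilpotent P M" and H: "normal_in H P" and fin: "finite_index H M"
  shows "virtually_nilpotent P H"
proof -
  obtain K c where K: "finite_index K P" "M \<subseteq> K" "nilpotent_mod K c M" and MP: "normal_in M P"
    using M unfolding virtually_nilpotent_def by blast
  obtain T where T: "finite T" "T \<subseteq> M" "\<forall>g\<in>M. \<exists>t\<in>T. g \<otimes> inv t \<in> H"
    and sub: "subgroup H G" "subgroup M G" "H \<subseteq> M" using fin by (rule finite_indexE)
  have P: "subgroup P G" and PG: "P \<subseteq> carrier G" and MG: "M \<subseteq> carrier G" and MP': "M \<subseteq> P"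
    using normal_inD[OF MP] subgroup.subset by blast+
  define Z where "Z t = {g \<in> P. commutator g t \<in> H}" for t
  have Zfin: "finite_index (Z t) P" if "t \<in> T" for t
    unfolding Z_def
  proof (rule commutator_kernel_finite_index[OF H _ fin])
    show tP: "t \<in> P" using that T(2) MP' by blast
    show "commutator g t \<in> M" if "g \<in> P" for g
      using normal_in_commutator(1)[OF MP that] \<open>t \<in> T\<close> T(2) by blast
  qed
  define C where "C = P \<inter> \<Inter>(Z ` T)"
  have Cfin: "finite_index C P" unfolding C_def
    using T(1) Zfin by (intro finite_index_Inter P) auto
  have com: "commutator g m \<in> H" if g: "g \<in> C" and m: "m \<in> M" for g m
  proof -
    obtain t where t: "t \<in> T" "m \<otimes> inv t \<in> H" using T(3) m by blast
    have gP: "g \<in> P" and gt: "commutator g t \<in> H" using g t(1) unfolding C_def Z_def by blast+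
    have G: "g \<in> carrier G" "m \<in> carrier G" "t \<in> carrier G" using gP PG m t(1) T(2) MG by blast+
    have hG: "m \<otimes> inv t \<in> carrier G" using G by simp
    have "m \<otimes> inv t \<in> P" using t(2) sub(3) MP' by blast
    then have "commutator g (m \<otimes> inv t) \<otimes> conjg (m \<otimes> inv t) (commutator g t) \<in> H"
      using subgroup.m_closed[OF sub(1) normal_in_commutator(1)[OF H gP t(2)] normal_in_conjg[OF H _ gt]] by blast
    moreover have "m = (m \<otimes> inv t) \<otimes> t" using G by (simp add: m_assoc)
    ultimately show ?thesis using commutator_mult_right[OF hG G(3) G(1)] by simp
  qed
  have HC: "H \<subseteq> C"
  proof
    fix h assume h: "h \<in> H"
    have "h \<in> P" using h normal_inD(3)[OF H] by blast
    moreover have "commutator h t \<in> H" if "t \<in> T" for t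
    proof -
      have "t \<in> P" using that T(2) MP' by blast
      from normal_in_commutator(2)[OF H this h] show ?thesis .
    qed
    ultimately show "h \<in> C" unfolding C_def Z_def by blast
  qed
  have KC: "finite_index (K \<inter> C) P" by (rule finite_index_Int2[OF K(1) Cfin])
  have "nilpotent_mod (K \<inter> C) c M" by (rule nilpotent_mod_mono[OF K(3)]) auto
  then have "nilpotent_mod (K \<inter> C) (2 * c + 1) H"
    using com by (intro nilpotent_mod_step[OF finite_indexD(1)[OF KC] _ sub(1)]) auto
  moreover have "H \<subseteq> K \<inter> C" using HC sub(3) K(2) by blast
  ultimately show ?thesis unfolding virtually_nilpotent_def using H KC by blast
qed

lemma virtually_nilpotent_up:
  assumes "virtually_nilpotent K H" "finite_index K P" "normal_in H P"
  shows "virtually_nilpotent P H"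
  using assms finite_index_trans unfolding virtually_nilpotent_def by blast

lemma normal_in_subgroup:
  assumes "normal_in H P" "subgroup K G" "K \<subseteq> P" "H \<subseteq> K"
  shows "normal_in H K"
  using assms unfolding normal_in_def by blast

lemma virtually_nilpotent_down:
  assumes "virtually_nilpotent P M" "finite_index K P" "M \<subseteq> K"
  shows "virtually_nilpotent K M"
proof -
  obtain L c where L: "finite_index L P" "M \<subseteq> L" "nilpotent_mod L c M" and M: "normal_in M P"
    using assms(1) unfolding virtually_nilpotent_def by blast
  have K: "subgroup K G" "K \<subseteq> P" using finite_indexD[OF assms(2)] by blast+
  have "finite_index (L \<inter> K) K" by (rule finite_index_Int[OF L(1) K])
  moreover have "nilpotent_mod (L \<inter> K) c M" by (rule nilpotent_mod_mono[OF L(3)]) auto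
  moreover have "M \<subseteq> L \<inter> K" using L(2) assms(3) by blast
  ultimately show ?thesis
    unfolding virtually_nilpotent_def using normal_in_subgroup[OF M K assms(3)] by blast
qed

text \<open>Adding the generators of \<open>M\<close> to \<open>H\<close> one at a time, each step
  has finite index because a positive power of the new generator already lies in
  \<open>H\<close>.\<close>

lemma finite_index_torsion_abelian:
  assumes fg: "fg_subgroup M" and H: "normal_in H M"
    and ab: "\<And>x y. x \<in> M \<Longrightarrow> y \<in> M \<Longrightarrow> commutator x y \<in> H"
    and tor: "\<And>m. m \<in> M \<Longrightarrow> \<exists>n::nat. n > 0 \<and> m [^] n \<in> H"
  shows "finite_index H M"
proof -
  obtain Y where Y: "finite Y" "Y \<subseteq> carrier G" "generate G Y = M" using fg by (rule fg_subgroupE)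
  obtain ys where ys: "set ys = Y" using finite_list[OF Y(1)] by blast
  have sub: "subgroup H G" "subgroup M G" "H \<subseteq> M" using normal_inD[OF H] by blast+
  have HG: "H \<subseteq> carrier G" using subgroup.subset[OF sub(1)] .
  have YM: "Y \<subseteq> M" unfolding Y(3)[symmetric] by (auto intro: generate.incl)
  have "set vs \<subseteq> Y \<Longrightarrow> finite_index H (generate G (H \<union> set vs))" for vs
  proof (induction vs)
    case Nil
    show ?case using finite_index_refl[OF sub(1)] generate_subgroup_id[OF sub(1)] by simp
  next
    case (Cons t vs)
    let ?K = "generate G (H \<union> set vs)"
    have tvG: "set (t # vs) \<subseteq> carrier G" using Cons.prems Y(2) by blast
    have tG: "t \<in> carrier G" and tM: "t \<in> M" "inv t \<in> M"
      using tvG Cons.prems YM subgroup.m_inv_closed[OF sub(2)] by auto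
    have SG: "H \<union> set vs \<subseteq> carrier G" and SM: "H \<union> set vs \<subseteq> M" using HG tvG sub(3) Cons.prems YM by auto
    have K: "subgroup ?K G" by (rule generate_is_subgroup[OF SG])
    have conj: "conjg x s \<in> ?K" if "x \<in> M" "s \<in> H \<union> set vs" for x s
    proof -
      have "commutator x s \<in> H" using ab that SM by blast
      then have "commutator x s \<otimes> s \<in> ?K" using that(2) by (intro generate.eng generate.incl) auto
      moreover have "x \<in> carrier G" "s \<in> carrier G"
        using that SG subgroup.mem_carrier[OF sub(2)] by blast+
      ultimately show ?thesis by (simp add: conjg_eq_commutator)
    qed
    have nt: "normalizes t ?K" using conj tM by (intro normalizes_generated[OF SG tG])
    obtain n :: nat where n: "n > 0" "t [^] n \<in> H" using tor[OF tM(1)] by blast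
    have "t [^] n \<in> ?K" using n(2) by (intro generate.incl) blast
    then have "finite_index ?K (generate G (insert t ?K))"
      using finite_index_generate_insert[OF tG K nt _ n(1)] by blast
    moreover have "finite_index H ?K" using Cons by simp
    ultimately show ?case unfolding generate_insert_suffix[OF HG tvG] by (rule finite_index_trans[rotated])
  qed
  from this[of ys] have "finite_index H (generate G (H \<union> Y))" using ys by simp
  moreover have "generate G (H \<union> Y) = M"
  proof
    show "generate G (H \<union> Y) \<subseteq> M" using YM sub by (intro generate_subgroup_incl) auto
    show "M \<subseteq> generate G (H \<union> Y)" unfolding Y(3)[symmetric] by (intro mono_generate) auto
  qed
  ultimately show ?thesis by simp
qed

end

section \<open>Integer polynomials with bounded roots\<close>

definition int_poly_eval :: "int poly \<Rightarrow> complex \<Rightarrow> complex" where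
  "int_poly_eval p z = poly (map_poly of_int p) z"

lemma int_poly_eval_pCons [simp]: "int_poly_eval (pCons a p) z = of_int a + z * int_poly_eval p z"
  by (simp add: int_poly_eval_def map_poly_pCons)

lemma int_poly_eval_0 [simp]: "int_poly_eval 0 z = 0"
  by (simp add: int_poly_eval_def)

lemma int_poly_eval_add [simp]: "int_poly_eval (p + q) z = int_poly_eval p z + int_poly_eval q z"
  by (induction p q rule: poly_induct2) (simp_all add: algebra_simps)

lemma int_poly_eval_smult [simp]: "int_poly_eval (smult c p) z = of_int c * int_poly_eval p z"
  by (induction p) (simp_all add: algebra_simps)

lemma int_poly_eval_mult [simp]: "int_poly_eval (p * q) z = int_poly_eval p z * int_poly_eval q z"
  by (induction p) (simp_all add: algebra_simps)

lemma int_poly_eval_diff [simp]: "int_poly_eval (p - q) z = int_poly_eval p z - int_poly_eval q z"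
  using int_poly_eval_add[of "p - q" q z] by simp

lemma int_poly_eval_pcompose: "int_poly_eval (pcompose p q) z = int_poly_eval p (int_poly_eval q z)"
  by (induction p) (simp_all add: pcompose_pCons algebra_simps)

lemma int_poly_eval_monom: "int_poly_eval (monom 1 n) z = z ^ n"
  by (induction n) (simp_all add: monom_0 monom_Suc)

lemma int_poly_eval_1 [simp]: "int_poly_eval 1 z = 1"
  using int_poly_eval_monom[of 0 z] by simp

text \<open>These are the differences of two distinct polynomials with coefficients 0 and 1, as they
  arise from two coinciding words.\<close>

definition digit_poly :: "int poly \<Rightarrow> bool" where
  "digit_poly p \<longleftrightarrow> p \<noteq> 0 \<and> (\<forall>i. coeff p i \<in> {-1, 0, 1})"

lemma geometric_sum_le:
  fixes x :: real
  assumes "x \<ge> 2"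
  shows "(\<Sum>i<n. x ^ i) \<le> x ^ n - 1"
proof (induction n)
  case (Suc n)
  have "2 * x ^ n \<le> x * x ^ n" using assms by (intro mult_right_mono) auto
  with Suc show ?case by simp
qed simp

text \<open>The leading coefficient is 1 or -1, and for \<open>norm z \<ge> 2\<close> the lower
  terms add up to at most \<open>norm z ^ n - 1\<close>, where \<open>n\<close> is the
  degree.\<close>

lemma digit_poly_root_bound:
  assumes "digit_poly p" "int_poly_eval p z = 0"
  shows "norm z < 2"
proof (rule ccontr)
  assume "\<not> norm z < 2"
  then have z: "norm z \<ge> 2" by simp
  let ?n = "degree p"
  have c: "norm (of_int (coeff p i) :: complex) \<le> 1" for i
  proof -
    have "coeff p i \<in> {-1, 0, 1}" using assms(1) unfolding digit_poly_def by blast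
    then show ?thesis by auto
  qed
  have "lead_coeff p \<noteq> 0" using assms(1) by (simp add: digit_poly_def)
  then have lc: "lead_coeff p = 1 \<or> lead_coeff p = -1" using assms(1) by (auto simp: digit_poly_def)
  have deg: "degree (map_poly of_int p :: complex poly) = ?n" by (rule degree_map_poly) simp
  have "0 = (\<Sum>i\<le>?n. of_int (coeff p i) * z ^ i)"
    using assms(2) unfolding int_poly_eval_def poly_altdef deg by (simp add: coeff_map_poly)
  also have "\<dots> = (\<Sum>i<?n. of_int (coeff p i) * z ^ i) + of_int (lead_coeff p) * z ^ ?n"
    by (simp add: lessThan_Suc_atMost[symmetric])
  finally have "of_int (lead_coeff p) * z ^ ?n = - (\<Sum>i<?n. of_int (coeff p i) * z ^ i)"
    by (simp add: eq_neg_iff_add_eq_0 add.commute)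
  then have "norm (of_int (lead_coeff p) * z ^ ?n) = norm (\<Sum>i<?n. of_int (coeff p i) * z ^ i)"
    by simp
  also have "\<dots> \<le> (\<Sum>i<?n. norm (of_int (coeff p i) * z ^ i))" by (rule norm_sum)
  also have "\<dots> \<le> (\<Sum>i<?n. norm z ^ i)"
  proof (rule sum_mono)
    fix i
    have "norm (of_int (coeff p i) :: complex) * norm z ^ i \<le> 1 * norm z ^ i"
      by (intro mult_right_mono c) simp
    then show "norm (of_int (coeff p i) * z ^ i) \<le> norm z ^ i" by (simp add: norm_mult norm_power)
  qed
  also have "\<dots> \<le> norm z ^ ?n - 1" by (rule geometric_sum_le[OF z])
  finally show False using lc by (auto simp: norm_mult norm_power)
qed

text \<open>Multiplication by \<open>[:- z, 1:]\<close> with \<open>norm z \<le> 2\<close> enlarges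
  the coefficients by a factor of at most 1 + 2.\<close>

lemma coeff_bound_of_roots:
  fixes f :: "complex poly"
  assumes "lead_coeff f = 1" "\<And>z. poly f z = 0 \<Longrightarrow> norm z \<le> 2"
  shows "norm (coeff f i) \<le> 3 ^ degree f"
  using assms
proof (induction "degree f" arbitrary: f i)
  case 0
  then have "f = 1" by (metis degree_eq_zeroE lead_coeff_pCons(2) one_pCons)
  then show ?case by (simp add: coeff_1)
next
  case (Suc n)
  have "\<exists>z. poly f z = 0"
    using Suc.hyps(2) by (intro fundamental_theorem_of_algebra_alt) auto
  then obtain z where z: "poly f z = 0" by blast
  then obtain g where g: "f = [:- z, 1:] * g" by (auto simp: poly_eq_0_iff_dvd elim: dvdE)
  have g0: "g \<noteq> 0" using g Suc.hyps(2) by auto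
  have dg: "degree g = n"
    using Suc.hyps(2) degree_mult_eq[of "[:- z, 1:]" g] g0 unfolding g by simp
  have lg: "lead_coeff g = 1" using Suc.prems(1) unfolding g lead_coeff_mult by simp
  have "norm (coeff g j) \<le> 3 ^ n" for j
  proof -
    have "norm w \<le> 2" if "poly g w = 0" for w using Suc.prems(2)[of w] that g by simp
    then show ?thesis using Suc.hyps(1)[of g j] dg lg by simp
  qed
  moreover have "norm (if i = 0 then 0 else coeff g (i - 1)) \<le> 3 ^ n" using calculation by simp
  moreover have "coeff f i = (if i = 0 then 0 else coeff g (i - 1)) - z * coeff g i"
    unfolding g by (cases i) simp_all
  moreover have "norm z \<le> 2" using Suc.prems(2) z by blast
  ultimately have "norm (coeff f i) \<le> 3 ^ n + 2 * 3 ^ n"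
    by (metis norm_triangle_le_diff norm_mult add_mono mult_mono norm_ge_zero zero_le_numeral)
  then show ?case unfolding Suc.hyps(2)[symmetric] by simp
qed

text \<open>Prime ideals of integer polynomials that contain no nonzero constant. A nonzero one is
  principal and is recovered from any complex root of its generator, so eigenvalues can be treated
  without algebraic number fields.\<close>

definition prime_over_zero :: "int poly set \<Rightarrow> bool" where
  "prime_over_zero J \<longleftrightarrow> (\<forall>p\<in>J. \<forall>q\<in>J. p + q \<in> J) \<and> (\<forall>p\<in>J. \<forall>q. q * p \<in> J) \<and>
     (\<forall>p q. p * q \<in> J \<longrightarrow> p \<in> J \<or> q \<in> J) \<and> (\<forall>c. [:c:] \<in> J \<longrightarrow> c = 0)"

lemma prime_over_zeroD:
  assumes "prime_over_zero J"
  shows "p \<in> J \<Longrightarrow> q \<in> J \<Longrightarrow> p + q \<in> J" "p \<in> J \<Longrightarrow> q * p \<in> J"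
    "p * q \<in> J \<Longrightarrow> p \<in> J \<or> q \<in> J" "[:c:] \<in> J \<Longrightarrow> c = 0"
  using assms unfolding prime_over_zero_def by blast+

text \<open>By pseudo-division, a primitive element of least degree divides a constant multiple of
  every element; Gauss's lemma removes the constant.\<close>

lemma prime_over_zero_generator:
  assumes J: "prime_over_zero J" and "g \<in> J" "g \<noteq> 0"
  obtains f where "f \<in> J" "f \<noteq> 0" "\<And>h. h \<in> J \<Longrightarrow> f dvd h"
proof -
  define P where "P = (\<lambda>f. f \<in> J \<and> f \<noteq> 0)"
  have "P g" using assms by (simp add: P_def)
  then obtain f0 where f0: "P f0" "\<And>h. P h \<Longrightarrow> degree f0 \<le> degree h"
    using ex_has_least_nat[of P g degree] by blast
  define f where "f = primitive_part f0"
  have eq: "f0 = [:content f0:] * f" by (simp add: f_def)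
  have f00: "f0 \<noteq> 0" and f0J: "f0 \<in> J" using f0(1) by (auto simp: P_def)
  have cf: "content f = 1" using f00 by (simp add: f_def)
  \<comment> \<open>No nonzero constant lies in \<open>J\<close>, so primality moves membership from
    \<open>f0\<close> to its primitive part.\<close>
  have "[:content f0:] \<notin> J" using prime_over_zeroD(4)[OF J, of "content f0"] f00 by auto
  then have fJ: "f \<in> J" using f0J eq prime_over_zeroD(3)[OF J] by metis
  have fne: "f \<noteq> 0" using f00 eq by auto
  have df: "degree f = degree f0" by (simp add: f_def)
  have "f dvd h" if h: "h \<in> J" for h
  proof -
    obtain q r where qr: "pseudo_divmod h f = (q, r)" by fastforce
    define c where "c = coeff f (degree f) ^ (Suc (degree h) - degree f)"
    have c0: "c \<noteq> 0" using fne by (simp add: c_def)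
    have div: "smult c h = f * q + r" "r = 0 \<or> degree r < degree f"
      using pseudo_divmod[OF fne qr] by (simp_all add: c_def)
    have "r = [:c:] * h + [:-1:] * (q * f)" using div(1) by simp
    then have "r \<in> J" using h fJ prime_over_zeroD(1,2)[OF J] by metis
    then have "r = 0" using f0(2)[of r] div(2) df unfolding P_def by linarith
    then have fq: "smult c h = f * q" using div(1) by simp
    \<comment> \<open>Gauss's lemma: since \<open>f\<close> is primitive, \<open>c\<close> divides
      the content of \<open>q\<close>.\<close>
    have "content (smult c h) = normalize c * content h" by simp
    moreover have "content (f * q) = content q" using cf by (simp add: content_mult)
    ultimately have "c dvd content q" unfolding fq by (metis dvd_triv_left normalize_dvd_iff)
    then have "[:c:] dvd q" by (simp add: const_poly_dvd_iff_dvd_content)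
    then obtain q' where q': "q = [:c:] * q'" by (elim dvdE)
    have "smult c h = smult c (f * q')" using fq q' by simp
    then have "h = f * q'" using c0 by (metis smult_cancel)
    then show ?thesis by simp
  qed
  then show thesis using that fJ fne by blast
qed

text \<open>A finite set that depends on \<open>r\<close> only and catches the minimal polynomials
  of all eigenvalues that can occur. The bound \<open>3 ^ r\<close> belongs to roots of norm at most
  2.\<close>

definition small_monic :: "nat \<Rightarrow> int poly set" where
  "small_monic r = {f. degree f \<le> r \<and> lead_coeff f = 1 \<and> (\<forall>i. \<bar>coeff f i\<bar> \<le> 3 ^ r)}"

lemma finite_small_monic: "finite (small_monic r)"
proof -
  have "small_monic r \<subseteq> Poly ` {cs. set cs \<subseteq> {- (3 ^ r)..3 ^ r} \<and> length cs \<le> Suc r}"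
  proof
    fix f assume f: "f \<in> small_monic r"
    have "set (coeffs f) \<subseteq> {- (3 ^ r)..3 ^ r}"
    proof
      fix c assume "c \<in> set (coeffs f)"
      then obtain i where "c = coeff f i" by (auto simp: coeffs_def split: if_splits)
      then show "c \<in> {- (3 ^ r)..3 ^ r}" using f by (auto simp: small_monic_def abs_le_iff minus_le_iff)
    qed
    moreover have "length (coeffs f) \<le> Suc r" using f by (auto simp: small_monic_def coeffs_def)
    ultimately show "f \<in> Poly ` {cs. set cs \<subseteq> {- (3 ^ r)..3 ^ r} \<and> length cs \<le> Suc r}"
      by (intro image_eqI[of _ _ "coeffs f"]) auto
  qed
  moreover have "finite {cs. set cs \<subseteq> {- (3 ^ r)..3 ^ r :: int} \<and> length cs \<le> Suc r}"
    by (rule finite_lists_length_le) simp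
  ultimately show ?thesis using finite_surj by blast
qed

text \<open>The generator of \<open>J\<close> divides a digit polynomial, so its leading coefficient
  is 1 or -1 and its roots have norm below 2. It also divides \<open>g\<close>, which bounds its
  degree by \<open>r\<close>.\<close>

lemma prime_over_zero_small_monic:
  assumes J: "prime_over_zero J" and g: "g \<in> J" "g \<noteq> 0" "degree g \<le> r" and p: "p \<in> J" "digit_poly p"
  shows "\<exists>f\<in>small_monic r. f \<in> J"
proof -
  obtain f where f: "f \<in> J" "f \<noteq> 0" "\<And>h. h \<in> J \<Longrightarrow> f dvd h"
    using prime_over_zero_generator[OF J g(1,2)] by blast
  have deg: "degree f \<le> r" using f(3)[OF g(1)] g(2,3) dvd_imp_degree_le le_trans by blast
  obtain q where q: "p = f * q" using f(3)[OF p(1)] by (elim dvdE)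
  have p0: "p \<noteq> 0" using p(2) by (simp add: digit_poly_def)
  have "lead_coeff p \<in> {-1, 0, 1}" "lead_coeff p \<noteq> 0" using p(2) by (auto simp: digit_poly_def)
  then have "\<bar>lead_coeff p\<bar> = 1" by auto
  then have lf: "\<bar>lead_coeff f\<bar> = 1" unfolding q lead_coeff_mult by (rule abs_zmult_eq_1)
  define h where "h = smult (lead_coeff f) f"
  have "lead_coeff f * lead_coeff f = 1" using lf by (metis abs_mult_self_eq mult_1)
  then have lh: "lead_coeff h = 1" by (simp add: h_def f(2))
  have hJ: "h \<in> J" using prime_over_zeroD(2)[OF J f(1), of "[:lead_coeff f:]"] by (simp add: h_def)
  have dh: "degree h = degree f" using lf by (simp add: h_def)
  let ?h = "map_poly of_int h :: complex poly"
  have dh': "degree ?h = degree h" by (rule degree_map_poly) simp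
  have "norm (coeff ?h i) \<le> 3 ^ degree ?h" for i
  proof (rule coeff_bound_of_roots)
    show "lead_coeff ?h = 1" using lh by (simp add: dh' coeff_map_poly)
    fix z assume "poly ?h z = 0"
    then have "int_poly_eval h z = 0" by (simp add: int_poly_eval_def)
    then have "int_poly_eval f z = 0" using lf by (auto simp: h_def)
    then have "int_poly_eval p z = 0" by (simp add: q)
    then show "norm z \<le> 2" using digit_poly_root_bound[OF p(2)] by fastforce
  qed
  then have b: "\<bar>real_of_int (coeff h i)\<bar> \<le> 3 ^ degree f" for i
    using dh dh' by (simp add: coeff_map_poly)
  have "\<bar>coeff h i\<bar> \<le> 3 ^ r" for i
  proof -
    have "\<bar>real_of_int (coeff h i)\<bar> \<le> 3 ^ r"
      using b[of i] power_increasing[OF deg, of "3::real"] by linarith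
    then have "real_of_int \<bar>coeff h i\<bar> \<le> real_of_int (3 ^ r)" by simp
    then show ?thesis by (simp only: of_int_le_iff)
  qed
  then have "h \<in> small_monic r" using lh dh deg by (simp add: small_monic_def)
  then show ?thesis using hJ by blast
qed

lemma prime_over_zero_eval: "prime_over_zero {p. int_poly_eval p z = 0}"
  unfolding prime_over_zero_def by auto

text \<open>One more than the number of possible eigenvalues, so that among this many powers two
  must coincide.\<close>

definition power_bound :: "nat \<Rightarrow> nat" where
  "power_bound r = Suc (card (\<Union>f\<in>small_monic r. {z. int_poly_eval f z = 0}))"

text \<open>A quantitative form of Kronecker's theorem. If \<open>\<lambda>\<close> is a root of a generator of \<open>J\<close>, then all
  powers \<open>\<lambda> ^ q\<close> are roots of the finitely many polynomials in \<open>small_monic r\<close>, so that two of them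
  coincide.\<close>

lemma kronecker_prime_ideal:
  assumes J: "prime_over_zero J" and x: "[:0, 1:] \<notin> J"
    and g: "\<And>q. 1 \<le> q \<Longrightarrow> q \<le> power_bound r \<Longrightarrow>
      \<exists>g. g \<noteq> 0 \<and> degree g \<le> r \<and> pcompose g (monom 1 q) \<in> J"
    and p: "\<And>q. 1 \<le> q \<Longrightarrow> q \<le> power_bound r \<Longrightarrow>
      \<exists>p. digit_poly p \<and> pcompose p (monom 1 q) \<in> J"
  shows "monom 1 (fact (power_bound r)) - 1 \<in> J"
proof -
  let ?n = "power_bound r" and ?N = "fact (power_bound r) :: nat"
  define Z where "Z = (\<Union>f\<in>small_monic r. {z. int_poly_eval f z = 0})"
  have finZ: "finite Z" unfolding Z_def
  proof (intro finite_UN_I finite_small_monic)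
    fix f assume "f \<in> small_monic r"
    then have "coeff (map_poly of_int f :: complex poly) (degree f) = 1"
      by (simp add: small_monic_def coeff_map_poly)
    then have "map_poly of_int f \<noteq> (0 :: complex poly)" by auto
    then show "finite {z. int_poly_eval f z = 0}" unfolding int_poly_eval_def by (rule poly_roots_finite)
  qed
  have n1: "1 \<le> ?n" by (simp add: power_bound_def)
  obtain g1 where g1: "g1 \<noteq> 0" "pcompose g1 (monom 1 1) \<in> J" using g[OF order_refl n1] by blast
  have m1: "monom 1 1 = [:0, 1 :: int:]" by (simp add: monom_Suc monom_0)
  have g1J: "g1 \<in> J" using g1(2) unfolding m1 pcompose_idR .
  obtain f where f: "f \<in> J" "f \<noteq> 0" "\<And>h. h \<in> J \<Longrightarrow> f dvd h"
    using prime_over_zero_generator[OF J g1J g1(1)] by blast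
  have degf: "degree f \<noteq> 0"
  proof
    assume "degree f = 0"
    then obtain c where "f = [:c:]" by (rule degree_eq_zeroE)
    then show False using prime_over_zeroD(4)[OF J] f(1,2) by auto
  qed
  have degf': "degree (map_poly of_int f :: complex poly) = degree f" by (rule degree_map_poly) simp
  have "\<exists>z::complex. poly (map_poly of_int f) z = 0"
    using degf degf' by (intro fundamental_theorem_of_algebra_alt) auto
  then obtain z where z: "int_poly_eval f z = 0" by (auto simp: int_poly_eval_def)
  have zJ: "int_poly_eval h z = 0" if "h \<in> J" for h using f(3)[OF that] z by (auto elim!: dvdE)
  \<comment> \<open>\<open>e\<close> generates the ideal of all polynomials that vanish at
    \<open>z\<close>; \<open>J\<close> will turn out to be this ideal.\<close>
  obtain e where e: "int_poly_eval e z = 0" "e \<noteq> 0" "\<And>h. int_poly_eval h z = 0 \<Longrightarrow> e dvd h"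
    using prime_over_zero_generator[OF prime_over_zero_eval, of f z] z f(2) by auto
  have dege: "degree e \<noteq> 0"
  proof
    assume "degree e = 0"
    then obtain c where "e = [:c:]" by (rule degree_eq_zeroE)
    then show False using e(1,2) by auto
  qed
  \<comment> \<open>The cofactor \<open>k\<close> has smaller degree than the generator
    \<open>f\<close> of \<open>J\<close>, so primality puts \<open>e\<close> into \<open>J\<close>.
    Thus vanishing at the single root \<open>z\<close> decides membership in
    \<open>J\<close>.\<close>
  have eJ: "e \<in> J"
  proof -
    obtain k where k: "f = e * k" using e(3)[OF z] by (elim dvdE)
    have "k \<notin> J"
    proof
      assume "k \<in> J"
      have k0: "k \<noteq> 0" using k f(2) by auto
      have "degree f \<le> degree k" using dvd_imp_degree_le[OF f(3)[OF \<open>k \<in> J\<close>] k0] .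
      moreover have "degree f = degree e + degree k" unfolding k by (rule degree_mult_eq[OF e(2) k0])
      ultimately show False using dege by simp
    qed
    then show ?thesis using f(1) k prime_over_zeroD(3)[OF J] by metis
  qed
  have eval_J: "h \<in> J" if "int_poly_eval h z = 0" for h
    using e(3)[OF that] prime_over_zeroD(2)[OF J eJ] by (metis dvdE mult.commute)
  have z0: "z \<noteq> 0" using eval_J[of "[:0, 1:]"] x by auto
  have zq: "z ^ q \<in> Z" if q: "1 \<le> q" "q \<le> ?n" for q
  proof -
    \<comment> \<open>Composition with the q-th power of the variable replaces the root
      \<open>z\<close> by \<open>z ^ q\<close>.\<close>
    define K where "K = {p. pcompose p (monom 1 q) \<in> J}"
    have K: "prime_over_zero K" unfolding prime_over_zero_def
    proof (intro conjI ballI allI impI)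
      fix p p' assume "p \<in> K" "p' \<in> K"
      then show "p + p' \<in> K" using prime_over_zeroD(1)[OF J] by (simp add: K_def pcompose_add)
    next
      fix p p' assume "p \<in> K"
      then show "p' * p \<in> K" using prime_over_zeroD(2)[OF J] by (simp add: K_def pcompose_mult)
    next
      fix p p' assume "p * p' \<in> K"
      then show "p \<in> K \<or> p' \<in> K" using prime_over_zeroD(3)[OF J] by (simp add: K_def pcompose_mult)
    next
      fix c :: int assume "[:c:] \<in> K"
      then show "c = 0" using prime_over_zeroD(4)[OF J] by (simp add: K_def)
    qed
    obtain f' where f': "f' \<in> small_monic r" "f' \<in> K"
      using prime_over_zero_small_monic[OF K] g[OF q] p[OF q] unfolding K_def by blast
    then have "int_poly_eval f' (z ^ q) = 0"
      using zJ[of "pcompose f' (monom 1 q)"] by (simp add: K_def int_poly_eval_pcompose int_poly_eval_monom)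
    then show ?thesis using f'(1) by (auto simp: Z_def)
  qed
  have "\<not> inj_on (\<lambda>q. z ^ q) {1..?n}"
  proof
    assume inj: "inj_on (\<lambda>q. z ^ q) {1..?n}"
    have "(\<lambda>q. z ^ q) ` {1..?n} \<subseteq> Z" using zq by auto
    then have "card {1..?n} \<le> card Z" using card_inj_on_le[OF inj _ finZ] by blast
    then show False by (simp add: power_bound_def Z_def)
  qed
  then obtain a b where ab: "a \<in> {1..?n}" "b \<in> {1..?n}" "a \<noteq> b" "z ^ a = z ^ b"
    unfolding inj_on_def by blast
  \<comment> \<open>The exponent \<open>d\<close> is at most \<open>?n\<close> and hence divides its
    factorial, which is a common exponent for all cases.\<close>
  have "\<exists>d. 1 \<le> d \<and> d \<le> ?n \<and> z ^ d = 1"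
  proof -
    have *: "z ^ (b - a) = 1" if "a < b" "z ^ a = z ^ b" for a b
    proof -
      have "z ^ a * z ^ (b - a) = z ^ b" using that(1) by (subst power_add[symmetric]) simp
      also have "\<dots> = z ^ a * 1" using that(2) by simp
      finally have "z ^ a * z ^ (b - a) = z ^ a * 1" .
      then show ?thesis using z0 by simp
    qed
    from ab(3) consider "a < b" | "b < a" by linarith
    then show ?thesis
    proof cases
      case 1
      then show ?thesis using *[of a b] ab by (intro exI[of _ "b - a"]) auto
    next
      case 2
      then show ?thesis using *[of b a] ab by (intro exI[of _ "a - b"]) auto
    qed
  qed
  then obtain d where d: "1 \<le> d" "d \<le> ?n" "z ^ d = 1" by blast
  then have "d dvd ?N" by (intro dvd_fact)
  then obtain k where "?N = d * k" by (elim dvdE)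
  then have "z ^ ?N = 1" using d(3) by (simp add: power_mult)
  then have "int_poly_eval (monom 1 ?N - 1) z = 0" by (simp add: int_poly_eval_monom)
  then show ?thesis by (rule eval_J)
qed

section \<open>Polynomials acting on abelian sections\<close>

text \<open>Horner's scheme, in an abelian group written multiplicatively, for the polynomial
  \<open>p\<close> in the endomorphism \<open>\<phi>\<close>, applied to \<open>b\<close>. It makes
  the group a module over the integer polynomials.\<close>

definition poly_act :: "('a, 'b) monoid_scheme \<Rightarrow> ('a \<Rightarrow> 'a) \<Rightarrow> int poly \<Rightarrow> 'a \<Rightarrow> 'a" where
  "poly_act B \<phi> p b = foldr (\<lambda>c x. b [^]\<^bsub>B\<^esub> c \<otimes>\<^bsub>B\<^esub> \<phi> x) (coeffs p) \<one>\<^bsub>B\<^esub>"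

definition prod_pow :: "('a, 'b) monoid_scheme \<Rightarrow> 'a list \<Rightarrow> int list \<Rightarrow> 'a" where
  "prod_pow B ms zs = foldr (\<lambda>(m, z) x. m [^]\<^bsub>B\<^esub> z \<otimes>\<^bsub>B\<^esub> x) (zip ms zs) \<one>\<^bsub>B\<^esub>"

lemma prod_pow_Nil [simp]: "prod_pow B [] zs = \<one>\<^bsub>B\<^esub>" "prod_pow B ms [] = \<one>\<^bsub>B\<^esub>"
  by (simp_all add: prod_pow_def)

lemma prod_pow_Cons [simp]:
  "prod_pow B (m # ms) (z # zs) = m [^]\<^bsub>B\<^esub> z \<otimes>\<^bsub>B\<^esub> prod_pow B ms zs"
  by (simp add: prod_pow_def)

lemma (in group) prod_pow_in_subgroup:
  assumes "subgroup K G" "set ms \<subseteq> K"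
  shows "prod_pow G ms zs \<in> K"
  using assms(2)
proof (induction ms arbitrary: zs)
  case (Cons m ms)
  show ?case
  proof (cases zs)
    case (Cons z zs')
    have "m [^] z \<in> K" using Cons.prems by (intro subgroup_int_pow_closed[OF assms(1)]) simp
    moreover have "prod_pow G ms zs' \<in> K" using Cons.IH Cons.prems by simp
    ultimately show ?thesis unfolding Cons prod_pow_Cons by (rule subgroup.m_closed[OF assms(1)])
  qed (simp add: subgroup.one_closed[OF assms(1)])
qed (simp add: subgroup.one_closed[OF assms(1)])

lemma (in group) prod_pow_zero:
  assumes "\<forall>z\<in>set zs. z = 0"
  shows "prod_pow G ms zs = \<one>"
  using assms
proof (induction ms arbitrary: zs)
  case (Cons m ms)
  then show ?case by (cases zs) auto
qed simp

lemma (in group) prod_pow_snoc: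
  assumes "length ms = length zs" "set ms \<subseteq> carrier G" "m \<in> carrier G"
  shows "prod_pow G (ms @ [m]) (zs @ [z]) = prod_pow G ms zs \<otimes> m [^] z"
  using assms
proof (induction ms zs rule: list_induct2)
  case (Cons x xs y ys)
  have "prod_pow G xs ys \<in> carrier G"
    using Cons.prems by (intro prod_pow_in_subgroup subgroup_self) simp
  with Cons show ?case by (simp add: m_assoc)
qed simp

text \<open>Gaussian elimination without division: a pivot row clears the last column, and a
  solution for the other rows is completed by a multiple of the pivot row.\<close>

lemma integer_dependence:
  assumes "finite I" "card I > d"
  shows "\<exists>z::'i \<Rightarrow> int. (\<exists>i\<in>I. z i \<noteq> 0) \<and> (\<forall>j<d. (\<Sum>i\<in>I. z i * A i j) = 0)"
  using assms
proof (induction d arbitrary: I A)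
  case 0
  then obtain i where "i \<in> I" by (metis card.empty equals0I less_irrefl)
  then show ?case by (intro exI[of _ "\<lambda>_. 1"]) auto
next
  case (Suc d)
  show ?case
  proof (cases "\<forall>i\<in>I. A i d = 0")
    case True
    obtain z :: "'i \<Rightarrow> int" where z: "\<exists>i\<in>I. z i \<noteq> 0" "\<forall>j<d. (\<Sum>i\<in>I. z i * A i j) = 0"
      using Suc.IH[of I A] Suc.prems by auto
    have "(\<Sum>i\<in>I. z i * A i d) = 0" using True by simp
    then show ?thesis using z by (intro exI[of _ z]) (auto simp: less_Suc_eq)
  next
    case False
    then obtain i0 where i0: "i0 \<in> I" "A i0 d \<noteq> 0" by blast
    let ?I = "I - {i0}"
    define B where "B i j = A i0 d * A i j - A i d * A i0 j" for i j
    have "finite ?I" "card ?I > d" using Suc.prems i0(1) by auto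
    then obtain z :: "'i \<Rightarrow> int" where z: "\<exists>i\<in>?I. z i \<noteq> 0" "\<forall>j<d. (\<Sum>i\<in>?I. z i * B i j) = 0"
      using Suc.IH[of ?I B] by blast
    \<comment> \<open>Scaling by the pivot undoes the cross multiplication in \<open>B\<close>; the
      coefficient at \<open>i0\<close> collects the multiples of the pivot row that were subtracted
      there.\<close>
    define w where "w i = (if i = i0 then - (\<Sum>i\<in>?I. z i * A i d) else z i * A i0 d)" for i
    have sum_w: "(\<Sum>i\<in>I. w i * A i j) = (\<Sum>i\<in>?I. z i * B i j)" for j
    proof -
      have "(\<Sum>i\<in>I. w i * A i j) = w i0 * A i0 j + (\<Sum>i\<in>?I. w i * A i j)"
        using Suc.prems(1) i0(1) by (rule sum.remove)
      also have "(\<Sum>i\<in>?I. w i * A i j) = (\<Sum>i\<in>?I. z i * A i0 d * A i j)"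
        by (intro sum.cong) (auto simp: w_def)
      also have "w i0 * A i0 j = (\<Sum>i\<in>?I. - (z i * A i d * A i0 j))"
        by (simp add: w_def sum_distrib_right sum_negf)
      finally show ?thesis by (simp add: B_def sum.distrib[symmetric] algebra_simps)
    qed
    have "(\<Sum>i\<in>?I. z i * B i d) = 0" by (simp add: B_def)
    then have "\<forall>j<Suc d. (\<Sum>i\<in>I. w i * A i j) = 0" using z(2) sum_w by (auto simp: less_Suc_eq)
    moreover have "\<exists>i\<in>I. w i \<noteq> 0" using z(1) i0(2) by (auto simp: w_def)
    ultimately show ?thesis by blast
  qed
qed

section \<open>Integer relations in finitely generated abelian groups\<close>

context comm_group
begin

text \<open>Exponent vectors are functions on all natural numbers, of which only the first
  \<open>length ys\<close> values count. They supply the rows of the matrix in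
  \<open>integer_dependence\<close>.\<close>

primrec monomial :: "'a list \<Rightarrow> (nat \<Rightarrow> int) \<Rightarrow> 'a" where
  "monomial [] e = \<one>"
| "monomial (y # ys) e = y [^] e 0 \<otimes> monomial ys (\<lambda>i. e (Suc i))"

lemma monomial_closed: "set ys \<subseteq> carrier G \<Longrightarrow> monomial ys e \<in> carrier G"
  by (induction ys arbitrary: e) auto

lemma monomial_add:
  "set ys \<subseteq> carrier G \<Longrightarrow> monomial ys (\<lambda>i. e i + f i) = monomial ys e \<otimes> monomial ys f"
proof (induction ys arbitrary: e f)
  case (Cons y ys)
  have c: "monomial ys g \<in> carrier G" for g using Cons.prems by (intro monomial_closed) simp
  have "y \<in> carrier G" using Cons.prems by simp
  then show ?case using Cons c by (simp add: int_pow_mult m_ac)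
qed simp

lemma monomial_scale:
  "set ys \<subseteq> carrier G \<Longrightarrow> monomial ys (\<lambda>i. z * e i) = monomial ys e [^] (z::int)"
proof (induction ys arbitrary: e)
  case (Cons y ys)
  have c: "monomial ys g \<in> carrier G" for g using Cons.prems by (intro monomial_closed) simp
  have "y \<in> carrier G" using Cons.prems by simp
  then show ?case using Cons c by (simp add: int_pow_distrib int_pow_pow mult.commute)
qed simp

lemma monomial_zero: "\<forall>i<length ys. e i = 0 \<Longrightarrow> set ys \<subseteq> carrier G \<Longrightarrow> monomial ys e = \<one>"
proof (induction ys arbitrary: e)
  case (Cons y ys)
  have "e 0 = 0" "\<forall>i<length ys. e (Suc i) = 0" using Cons.prems(1) by auto
  then show ?case using Cons by simp
qed simp

lemma generator_monomial:
  "set ys \<subseteq> carrier G \<Longrightarrow> y \<in> set ys \<Longrightarrow> \<exists>e. y = monomial ys e"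
proof (induction ys)
  case (Cons x ys)
  show ?case
  proof (cases "y = x")
    case True
    have "monomial (x # ys) (\<lambda>i. if i = 0 then 1 else 0) = x"
      using Cons.prems(1) monomial_zero[of ys "\<lambda>i. 0"] by simp
    then show ?thesis using True by metis
  next
    case False
    then obtain e where e: "y = monomial ys e" using Cons by auto
    have "monomial (x # ys) (\<lambda>i. case i of 0 \<Rightarrow> 0 | Suc j \<Rightarrow> e j) = y"
      using Cons.prems(1) monomial_closed[of ys e] e by simp
    then show ?thesis by metis
  qed
qed simp

lemma generate_monomial:
  assumes "set ys \<subseteq> carrier G" "x \<in> generate G (set ys)"
  shows "\<exists>e. x = monomial ys e"
  using assms(2)
proof induction
  case one
  show ?case using monomial_zero[of ys "\<lambda>i. 0"] assms(1) by (intro exI[of _ "\<lambda>i. 0"]) simp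
next
  case (incl h)
  then show ?case by (rule generator_monomial[OF assms(1)])
next
  case (inv h)
  then obtain e where e: "h = monomial ys e" using generator_monomial[OF assms(1)] by blast
  have "inv h = monomial ys (\<lambda>i. (-1) * e i)"
    using e monomial_scale[OF assms(1), of "-1" e] monomial_closed[OF assms(1)] by (simp add: int_pow_neg)
  then show ?case by blast
next
  case (eng h1 h2)
  then show ?case using monomial_add[OF assms(1)] by metis
qed

text \<open>There is one exponent vector too many, so the exponent vectors of \<open>ms\<close> are
  linearly dependent over the integers, and a linear relation among them is a relation in the
  group.\<close>

lemma prod_pow_dependence:
  assumes "set ys \<subseteq> carrier G" "generate G (set ys) = carrier G"
    and "set ms \<subseteq> carrier G" "length ms = Suc (length ys)"
  shows "\<exists>zs. length zs = length ms \<and> (\<exists>z\<in>set zs. z \<noteq> 0) \<and> prod_pow G ms zs = \<one>"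
proof -
  let ?n = "length ms"
  have "\<exists>e. ms ! i = monomial ys e" if "i < ?n" for i
    using that assms(3) generate_monomial[OF assms(1)] unfolding assms(2) by (metis nth_mem subset_iff)
  then have "\<forall>i. \<exists>e. i < ?n \<longrightarrow> ms ! i = monomial ys e" by blast
  then obtain A where A: "\<And>i. i < ?n \<Longrightarrow> ms ! i = monomial ys (A i)" by metis
  have "finite {..<?n}" "card {..<?n} > length ys" using assms(4) by auto
  from integer_dependence[OF this, of A] obtain z :: "nat \<Rightarrow> int"
    where z: "\<exists>i\<in>{..<?n}. z i \<noteq> 0" "\<forall>j<length ys. (\<Sum>i<?n. z i * A i j) = 0" by blast
  have partial: "m \<le> ?n \<Longrightarrow> prod_pow G (map (\<lambda>i. ms ! i) [0..<m]) (map z [0..<m]) = monomial ys (\<lambda>j. \<Sum>i<m. z i * A i j)" for m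
  proof (induction m)
    case 0
    then show ?case using monomial_zero[of ys "\<lambda>i. 0"] assms(1) by simp
  next
    case (Suc m)
    have c: "set (map (\<lambda>i. ms ! i) [0..<m]) \<subseteq> carrier G" "ms ! m \<in> carrier G"
      using Suc.prems assms(3) nth_mem by fastforce+
    have "prod_pow G (map (\<lambda>i. ms ! i) [0..<Suc m]) (map z [0..<Suc m])
      = prod_pow G (map (\<lambda>i. ms ! i) [0..<m]) (map z [0..<m]) \<otimes> ms ! m [^] z m"
      using prod_pow_snoc[OF _ c, where zs = "map z [0..<m]" and z = "z m"] by simp
    also have "\<dots> = monomial ys (\<lambda>j. \<Sum>i<m. z i * A i j) \<otimes> monomial ys (\<lambda>j. z m * A m j)"
      using Suc A[of m] monomial_scale[OF assms(1)] by simp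
    also have "\<dots> = monomial ys (\<lambda>j. \<Sum>i<Suc m. z i * A i j)"
      using monomial_add[OF assms(1), symmetric] by simp
    finally show ?case .
  qed
  have "prod_pow G ms (map z [0..<?n]) = \<one>"
    using partial[of ?n] monomial_zero[OF z(2) assms(1)] by (simp add: map_nth)
  moreover have "\<exists>x\<in>set (map z [0..<?n]). x \<noteq> 0" using z(1) by auto
  ultimately show ?thesis by (intro exI[of _ "map z [0..<?n]"]) simp
qed

section \<open>Abelian groups as modules over integer polynomials\<close>

lemma poly_act_pCons:
  assumes "\<phi> \<in> hom G G" "b \<in> carrier G"
  shows "poly_act G \<phi> (pCons c p) b = b [^] c \<otimes> \<phi> (poly_act G \<phi> p b)"
\<comment> \<open>The coefficient list of the zero polynomial is empty and not a single 0, hence the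
  separate case.\<close>
proof (cases "c = 0 \<and> p = 0")
  case True
  have "\<phi> \<one> = \<one>" using hom_one[OF assms(1)] is_group by blast
  then show ?thesis using True by (simp add: poly_act_def)
next
  case False
  then have "coeffs (pCons c p) = c # coeffs p" by (auto simp: cCons_def)
  then show ?thesis by (simp add: poly_act_def)
qed

lemma poly_act_0 [simp]: "poly_act G \<phi> 0 b = \<one>"
  by (simp add: poly_act_def)

lemma poly_act_closed:
  assumes "\<phi> \<in> hom G G" "b \<in> carrier G"
  shows "poly_act G \<phi> p b \<in> carrier G"
  using assms by (induction p) (auto simp: poly_act_pCons hom_in_carrier)

lemma poly_act_add:
  assumes "\<phi> \<in> hom G G" "b \<in> carrier G"
  shows "poly_act G \<phi> (p + q) b = poly_act G \<phi> p b \<otimes> poly_act G \<phi> q b"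
proof (induction p q rule: poly_induct2)
  case (pCons c p d q)
  have "poly_act G \<phi> p b \<in> carrier G" "poly_act G \<phi> q b \<in> carrier G"
    using poly_act_closed[OF assms] by blast+
  moreover from this have "\<phi> (poly_act G \<phi> p b) \<in> carrier G" "\<phi> (poly_act G \<phi> q b) \<in> carrier G"
    using hom_in_carrier[OF assms(1)] by blast+
  ultimately show ?case
    using pCons assms hom_mult[OF assms(1)] by (simp add: poly_act_pCons int_pow_mult m_ac)
qed simp

lemma hom_int_pow_self:
  assumes "\<phi> \<in> hom G G" "b \<in> carrier G"
  shows "\<phi> (b [^] (c::int)) = \<phi> b [^] c"
  using hom_int_pow[OF assms is_group is_group] .

lemma poly_act_smult:
  assumes "\<phi> \<in> hom G G" "b \<in> carrier G"
  shows "poly_act G \<phi> (smult c p) b = poly_act G \<phi> p b [^] c"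
proof (induction p)
  case (pCons a p)
  have c: "poly_act G \<phi> p b \<in> carrier G" using poly_act_closed[OF assms] .
  then have "\<phi> (poly_act G \<phi> p b) \<in> carrier G" using hom_in_carrier[OF assms(1)] by blast
  then show ?case
    using pCons assms c
    by (simp add: poly_act_pCons int_pow_distrib int_pow_pow hom_int_pow_self mult.commute)
qed simp

lemma poly_act_mult:
  assumes "\<phi> \<in> hom G G" "b \<in> carrier G"
  shows "poly_act G \<phi> (p * q) b = poly_act G \<phi> p (poly_act G \<phi> q b)"
proof (induction p)
  case (pCons a p)
  have "poly_act G \<phi> q b \<in> carrier G" using poly_act_closed[OF assms] .
  moreover from this have "\<phi> (poly_act G \<phi> p (poly_act G \<phi> q b)) \<in> carrier G"
    using poly_act_closed[OF assms(1)] hom_in_carrier[OF assms(1)] by blast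
  ultimately show ?case using pCons assms by (simp add: poly_act_add poly_act_smult poly_act_pCons)
qed simp

lemma poly_act_const:
  assumes "\<phi> \<in> hom G G" "b \<in> carrier G"
  shows "poly_act G \<phi> [:c:] b = b [^] c"
  using assms hom_one[OF assms(1) is_group is_group] by (simp add: poly_act_pCons)

lemma poly_act_x:
  assumes "\<phi> \<in> hom G G" "b \<in> carrier G"
  shows "poly_act G \<phi> [:0, 1:] b = \<phi> b"
  using assms hom_one[OF assms(1) is_group is_group] hom_in_carrier[OF assms] by (simp add: poly_act_pCons)

lemma poly_act_mult_elem:
  assumes "\<phi> \<in> hom G G" "a \<in> carrier G" "b \<in> carrier G"
  shows "poly_act G \<phi> p (a \<otimes> b) = poly_act G \<phi> p a \<otimes> poly_act G \<phi> p b"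
proof (induction p)
  case (pCons c p)
  have "poly_act G \<phi> p a \<in> carrier G" "poly_act G \<phi> p b \<in> carrier G"
    using poly_act_closed[OF assms(1)] assms by blast+
  moreover from this have "\<phi> (poly_act G \<phi> p a) \<in> carrier G" "\<phi> (poly_act G \<phi> p b) \<in> carrier G"
    using hom_in_carrier[OF assms(1)] by blast+
  ultimately show ?case using pCons assms hom_mult[OF assms(1)]
    by (simp add: poly_act_pCons int_pow_distrib m_ac)
qed simp

lemma poly_act_hom:
  assumes "\<phi> \<in> hom G G"
  shows "poly_act G \<phi> p \<in> hom G G"
  using poly_act_closed[OF assms] poly_act_mult_elem[OF assms] by (auto intro: homI)

text \<open>Makes the kernel of a polynomial in \<open>\<phi>\<close> invariant under every
  endomorphism \<open>\<gamma>\<close> that commutes with \<open>\<phi>\<close>.\<close>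

lemma poly_act_commute:
  assumes "\<phi> \<in> hom G G" "\<gamma> \<in> hom G G" "b \<in> carrier G"
    and "\<And>b. b \<in> carrier G \<Longrightarrow> \<gamma> (\<phi> b) = \<phi> (\<gamma> b)"
  shows "\<gamma> (poly_act G \<phi> p b) = poly_act G \<phi> p (\<gamma> b)"
proof (induction p)
  case 0
  show ?case using hom_one[OF assms(2) is_group is_group] by simp
next
  case (pCons c p)
  have c: "poly_act G \<phi> p b \<in> carrier G" using poly_act_closed[OF assms(1,3)] .
  have "\<phi> (poly_act G \<phi> p b) \<in> carrier G" using c hom_in_carrier[OF assms(1)] by blast
  then show ?case
    using pCons assms c hom_in_carrier[OF assms(2,3)] hom_mult[OF assms(2)]
    by (simp add: poly_act_pCons hom_int_pow_self)
qed

lemma funpow_hom: "\<phi> \<in> hom G G \<Longrightarrow> (\<phi> ^^ n) \<in> hom G G"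
proof (induction n)
  case 0
  show ?case by (auto intro: homI)
next
  case (Suc n)
  then show ?case using Group.hom_compose[of "\<phi> ^^ n" G G \<phi> G] by (simp add: comp_def)
qed

lemma poly_act_monom:
  assumes "\<phi> \<in> hom G G" "b \<in> carrier G"
  shows "poly_act G \<phi> (monom 1 n) b = (\<phi> ^^ n) b"
proof (induction n)
  case 0
  show ?case using poly_act_const[OF assms, of 1] assms(2) by (simp add: monom_0)
next
  case (Suc n)
  have "(\<phi> ^^ Suc n) b \<in> carrier G" using hom_in_carrier[OF funpow_hom[OF assms(1)] assms(2)] .
  then show ?case using Suc assms by (simp add: monom_Suc poly_act_pCons)
qed

lemma poly_act_pcompose_monom:
  assumes "\<phi> \<in> hom G G" "b \<in> carrier G"
  shows "poly_act G \<phi> (pcompose p (monom 1 n)) b = poly_act G (\<phi> ^^ n) p b"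
proof (induction p)
  case (pCons c p)
  have cl: "poly_act G (\<phi> ^^ n) p b \<in> carrier G" using poly_act_closed[OF funpow_hom[OF assms(1)] assms(2)] .
  then have "(\<phi> ^^ n) (poly_act G (\<phi> ^^ n) p b) \<in> carrier G"
    using hom_in_carrier[OF funpow_hom[OF assms(1)]] by blast
  then show ?case
    using pCons assms funpow_hom[OF assms(1)] cl
      hom_one[OF assms(1) is_group is_group]
    by (simp add: pcompose_pCons poly_act_add poly_act_mult poly_act_monom poly_act_pCons)
qed simp

primrec iterates :: "('a \<Rightarrow> 'a) \<Rightarrow> 'a \<Rightarrow> nat \<Rightarrow> 'a list" where
  "iterates \<phi> b 0 = []"
| "iterates \<phi> b (Suc n) = b # iterates \<phi> (\<phi> b) n"

lemma length_iterates [simp]: "length (iterates \<phi> b n) = n"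
  by (induction n arbitrary: b) auto

lemma iterates_closed:
  "\<phi> \<in> hom G G \<Longrightarrow> b \<in> carrier G \<Longrightarrow> set (iterates \<phi> b n) \<subseteq> carrier G"
  by (induction n arbitrary: b) (auto simp: hom_in_carrier)

text \<open>Reads an integer relation among the iterates of \<open>b\<close> as a polynomial that
  annihilates \<open>b\<close>; a relation of length \<open>Suc r\<close> gives degree at most
  \<open>r\<close>.\<close>

lemma prod_pow_iterates:
  assumes "\<phi> \<in> hom G G" "b \<in> carrier G"
  shows "prod_pow G (iterates \<phi> b (length zs)) zs = poly_act G \<phi> (Poly zs) b"
  using assms(2)
proof (induction zs arbitrary: b)
  case (Cons z zs)
  have "\<phi> b \<in> carrier G" using hom_in_carrier[OF assms(1) Cons.prems] .
  then have "prod_pow G (iterates \<phi> (\<phi> b) (length zs)) zs = \<phi> (poly_act G \<phi> (Poly zs) b)"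
    using Cons.IH poly_act_commute[OF assms(1,1) Cons.prems] by simp
  then show ?case using Cons.prems assms(1) by (simp add: poly_act_pCons)
qed simp

text \<open>If every kernel of a polynomial in \<open>\<phi>\<close> is trivial or everything, then the annihilator of a
  nonzero element is a prime ideal.\<close>

lemma kronecker_endomorphism:
  assumes \<phi>: "\<phi> \<in> hom G G" and b: "b \<in> carrier G" "b \<noteq> \<one>" "\<phi> b \<noteq> \<one>"
    and tf: "\<And>c::int. b [^] c = \<one> \<Longrightarrow> c = 0"
    and irr: "\<And>p a. a \<in> carrier G \<Longrightarrow> a \<noteq> \<one> \<Longrightarrow> poly_act G \<phi> p a = \<one> \<Longrightarrow>
      \<forall>a\<in>carrier G. poly_act G \<phi> p a = \<one>"
    and rank: "\<And>ms. set ms \<subseteq> carrier G \<Longrightarrow> length ms = Suc r \<Longrightarrow>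
      \<exists>zs. length zs = Suc r \<and> (\<exists>z\<in>set zs. z \<noteq> 0) \<and> prod_pow G ms zs = \<one>"
    and digit: "\<And>q. 1 \<le> q \<Longrightarrow> q \<le> power_bound r \<Longrightarrow> \<exists>p. digit_poly p \<and> poly_act G (\<phi> ^^ q) p b = \<one>"
    and a: "a \<in> carrier G"
  shows "(\<phi> ^^ fact (power_bound r)) a = a"
proof -
  define J where "J = {p. poly_act G \<phi> p b = \<one>}"
  have kill: "poly_act G \<phi> p \<one> = \<one>" for p
    using hom_one[OF poly_act_hom[OF \<phi>] is_group is_group] .
  have J: "prime_over_zero J" unfolding prime_over_zero_def
  proof (intro conjI ballI allI impI)
    fix p q assume "p \<in> J" "q \<in> J"
    then show "p + q \<in> J" by (simp add: J_def poly_act_add[OF \<phi> b(1)])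
  next
    fix p q assume "p \<in> J"
    then show "q * p \<in> J" using kill by (simp add: J_def poly_act_mult[OF \<phi> b(1)])
  next
    fix p q assume "p * q \<in> J"
    then have pq: "poly_act G \<phi> p (poly_act G \<phi> q b) = \<one>" by (simp add: J_def poly_act_mult[OF \<phi> b(1)])
    \<comment> \<open>If \<open>q\<close> does not annihilate \<open>b\<close>, then
      \<open>p\<close> has a nontrivial kernel, which by \<open>irr\<close> is the whole group and
      contains \<open>b\<close>.\<close>
    show "p \<in> J \<or> q \<in> J"
      using irr[OF poly_act_closed[OF \<phi> b(1)] _ pq] b(1) by (auto simp: J_def)
  next
    fix c assume "[:c:] \<in> J"
    then show "c = 0" using tf by (simp add: J_def poly_act_const[OF \<phi> b(1)])
  qed
  have "monom 1 (fact (power_bound r)) - 1 \<in> J"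
  proof (rule kronecker_prime_ideal[OF J])
    show "[:0, 1:] \<notin> J" using b(3) by (simp add: J_def poly_act_x[OF \<phi> b(1)])
  next
    fix q :: nat
    have \<psi>: "\<phi> ^^ q \<in> hom G G" by (rule funpow_hom[OF \<phi>])
    obtain zs where zs: "length zs = Suc r" "\<exists>z\<in>set zs. z \<noteq> 0"
      "prod_pow G (iterates (\<phi> ^^ q) b (Suc r)) zs = \<one>"
      using rank[OF iterates_closed[OF \<psi> b(1)] length_iterates] by blast
    have "poly_act G (\<phi> ^^ q) (Poly zs) b = \<one>" using prod_pow_iterates[OF \<psi> b(1), of zs] zs(1,3) by simp
    then have "pcompose (Poly zs) (monom 1 q) \<in> J" by (simp add: J_def poly_act_pcompose_monom[OF \<phi> b(1)])
    moreover have "degree (Poly zs) \<le> r"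
      using zs(1) by (intro degree_le) (simp add: nth_default_def)
    moreover have "Poly zs \<noteq> 0"
    proof -
      obtain i where "i < length zs" "zs ! i \<noteq> 0" using zs(2) by (metis in_set_conv_nth)
      then have "coeff (Poly zs) i \<noteq> 0" by (simp add: nth_default_def)
      then show ?thesis by (metis coeff_0)
    qed
    ultimately show "\<exists>g. g \<noteq> 0 \<and> degree g \<le> r \<and> pcompose g (monom 1 q) \<in> J" by blast
  next
    fix q :: nat assume "1 \<le> q" "q \<le> power_bound r"
    then obtain p where "digit_poly p" "poly_act G (\<phi> ^^ q) p b = \<one>" using digit by blast
    then show "\<exists>p. digit_poly p \<and> pcompose p (monom 1 q) \<in> J"
      by (auto simp: J_def poly_act_pcompose_monom[OF \<phi> b(1)])
  qed
  \<comment> \<open>Irreducibility spreads the relation from \<open>b\<close> to the whole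
    group.\<close>
  then have "\<forall>a\<in>carrier G. poly_act G \<phi> (monom 1 (fact (power_bound r)) - 1) a = \<one>"
    using irr[OF b(1,2)] by (simp add: J_def)
  then have "poly_act G \<phi> (monom 1 (fact (power_bound r)) - 1) a = \<one>" using a by blast
  then have "poly_act G \<phi> ((monom 1 (fact (power_bound r)) - 1) + [:1:]) a = a"
    unfolding poly_act_add[OF \<phi> a] using poly_act_const[OF \<phi> a, of 1] a by simp
  then show ?thesis by (simp add: poly_act_monom[OF \<phi> a] one_pCons)
qed

end

text \<open>For abelian \<open>M / H\<close> this bounds the torsion-free rank. It is phrased in the
  ambient group, so that \<open>M\<close> and \<open>H\<close> can vary without forming
  quotients.\<close>

definition (in group) rank_le :: "'a set \<Rightarrow> 'a set \<Rightarrow> nat \<Rightarrow> bool" where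
  "rank_le M H r \<longleftrightarrow> (\<forall>ms. set ms \<subseteq> M \<longrightarrow> length ms = Suc r \<longrightarrow>
     (\<exists>zs. length zs = Suc r \<and> (\<exists>z\<in>set zs. z \<noteq> 0) \<and> prod_pow G ms zs \<in> H))"

text \<open>Here the quotient \<open>M / H\<close> is formed as a group, because the module
  structure lives on it; results are pulled back along \<open>pr\<close>.\<close>

locale abelian_section = group +
  fixes M H :: "'a set"
  assumes H_normal: "normal_in H M"
    and commutator_H: "\<And>x y. x \<in> M \<Longrightarrow> y \<in> M \<Longrightarrow> commutator x y \<in> H"
begin

abbreviation quot :: "'a set monoid" where "quot \<equiv> (G\<lparr>carrier := M\<rparr>) Mod H"

abbreviation pr :: "'a \<Rightarrow> 'a set" where "pr m \<equiv> H #> m"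

lemma M_subgroup: "subgroup M G" and H_subgroup: "subgroup H G" and H_M: "H \<subseteq> M"
  using normal_inD[OF H_normal] by blast+

lemma M_carrier: "M \<subseteq> carrier G" using subgroup.subset[OF M_subgroup] .

lemma M_group: "group (G\<lparr>carrier := M\<rparr>)"
  using subgroup.subgroup_is_group[OF M_subgroup is_group] .

lemma H_normal_M: "H \<lhd> (G\<lparr>carrier := M\<rparr>)"
proof -
  have "subgroup H (G\<lparr>carrier := M\<rparr>)" using subgroup_incl[OF H_subgroup M_subgroup H_M] .
  moreover have "x \<otimes> h \<otimes> inv\<^bsub>G\<lparr>carrier := M\<rparr>\<^esub> x \<in> H" if "x \<in> M" "h \<in> H" for x h
  proof -
    have "inv\<^bsub>G\<lparr>carrier := M\<rparr>\<^esub> x = inv x" using m_inv_consistent[OF M_subgroup that(1)] .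
    then show ?thesis using normal_in_conjg[OF H_normal that] by (simp add: conjg_def)
  qed
  ultimately show ?thesis using group.normal_inv_iff[OF M_group, of H] by simp
qed

lemma carrier_quot: "carrier quot = pr ` M"
  by (simp add: carrier_FactGroup)

lemma pr_hom: "pr \<in> hom (G\<lparr>carrier := M\<rparr>) quot"
  using normal.r_coset_hom_Mod[OF H_normal_M] by simp

lemma quot_group: "group quot"
  using normal.factorgroup_is_group[OF H_normal_M] .

lemma pr_group_hom: "group_hom (G\<lparr>carrier := M\<rparr>) quot pr"
  using M_group quot_group pr_hom by (intro group_hom.intro group_hom_axioms.intro)

lemma pr_mult: "x \<in> M \<Longrightarrow> y \<in> M \<Longrightarrow> pr (x \<otimes> y) = pr x \<otimes>\<^bsub>quot\<^esub> pr y"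
  using hom_mult[OF pr_hom, of x y] by simp

lemma pr_eq_iff: "x \<in> M \<Longrightarrow> y \<in> M \<Longrightarrow> pr x = pr y \<longleftrightarrow> x \<otimes> inv y \<in> H"
  using r_coset_eq_iff[OF H_subgroup] M_carrier by blast

lemma pr_one_iff: "x \<in> M \<Longrightarrow> pr x = \<one>\<^bsub>quot\<^esub> \<longleftrightarrow> x \<in> H"
  using pr_eq_iff[of x "\<one>"] subgroup.one_closed[OF M_subgroup] M_carrier subgroup.subset[OF H_subgroup]
  by auto

lemma pr_closed: "x \<in> M \<Longrightarrow> pr x \<in> carrier quot"
  by (simp add: carrier_quot)

lemma pr_int_pow: "x \<in> M \<Longrightarrow> pr (x [^] (i::int)) = pr x [^]\<^bsub>quot\<^esub> i"
  using group_hom.hom_int_pow[OF pr_group_hom, of x i] int_pow_consistent[OF M_subgroup, of x i] by simp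

lemma quot_comm: "comm_group quot"
proof (rule group.group_comm_groupI[OF quot_group])
  fix a b assume "a \<in> carrier quot" "b \<in> carrier quot"
  then obtain x y where xy: "x \<in> M" "y \<in> M" "a = pr x" "b = pr y" by (auto simp: carrier_quot)
  have G: "x \<in> carrier G" "y \<in> carrier G" using xy M_carrier by blast+
  have m: "x \<otimes> y \<in> M" "y \<otimes> x \<in> M" using subgroup.m_closed[OF M_subgroup] xy by blast+
  have "(x \<otimes> y) \<otimes> inv (y \<otimes> x) = commutator x y" using G by (simp add: commutator_def group_simps)
  then have "pr (x \<otimes> y) = pr (y \<otimes> x)" using pr_eq_iff[OF m] commutator_H[OF xy(1,2)] by simp
  then show "a \<otimes>\<^bsub>quot\<^esub> b = b \<otimes>\<^bsub>quot\<^esub> a" using pr_mult xy by simp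
qed

lemma pr_prod_pow:
  assumes "set ms \<subseteq> M"
  shows "pr (prod_pow G ms zs) = prod_pow quot (map pr ms) zs"
  using assms
proof (induction ms arbitrary: zs)
  case Nil
  show ?case using pr_one_iff subgroup.one_closed[OF M_subgroup] subgroup.one_closed[OF H_subgroup] by simp
next
  case (Cons m ms)
  show ?case
  proof (cases zs)
    case Nil
    then show ?thesis
      using pr_one_iff subgroup.one_closed[OF M_subgroup] subgroup.one_closed[OF H_subgroup] by simp
  next
    case (Cons z zs')
    have "prod_pow G ms zs' \<in> M" using Cons.prems by (intro prod_pow_in_subgroup[OF M_subgroup]) simp
    moreover have "m [^] z \<in> M" using Cons.prems by (intro subgroup_int_pow_closed[OF M_subgroup]) simp
    ultimately show ?thesis unfolding Cons prod_pow_Cons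
      using pr_mult pr_int_pow Cons.IH[of zs'] Cons.prems by simp
  qed
qed

text \<open>Elements of the quotient are cosets, hence sets, so the automorphism induced by
  \<open>g\<close> is literally the image map.\<close>

lemma conjg_image_pr:
  assumes "g \<in> carrier G" "normalizes g H" "m \<in> M"
  shows "conjg g ` pr m = pr (conjg g m)"
proof -
  have mG: "m \<in> carrier G" using assms(3) M_carrier by blast
  have HG: "H \<subseteq> carrier G" using subgroup.subset[OF H_subgroup] .
  have "conjg g ` pr m = (\<lambda>h. conjg g h \<otimes> conjg g m) ` H"
    unfolding r_coset_def using mG HG assms(1) by (auto simp: conjg_mult subset_iff image_iff)
  also have "\<dots> = (\<lambda>h. h \<otimes> conjg g m) ` (conjg g ` H)" by (simp add: image_image)
  also have "\<dots> = (\<lambda>h. h \<otimes> conjg g m) ` H" using conjg_image_normalized[OF assms(1) HG assms(2)] by simp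
  also have "\<dots> = pr (conjg g m)" unfolding r_coset_def by auto
  finally show ?thesis .
qed

lemma conjg_image_hom:
  assumes "g \<in> carrier G" "normalizes g H" "normalizes g M"
  shows "(`) (conjg g) \<in> hom quot quot"
proof (rule homI)
  have gM: "conjg g m \<in> M" if "m \<in> M" for m
    using assms(3) that M_carrier unfolding normalizes_def by blast
  fix a assume "a \<in> carrier quot"
  then obtain x where x: "x \<in> M" "a = pr x" by (auto simp: carrier_quot)
  show "conjg g ` a \<in> carrier quot"
    unfolding x(2) conjg_image_pr[OF assms(1,2) x(1)] by (rule pr_closed[OF gM[OF x(1)]])
  fix b assume "b \<in> carrier quot"
  then obtain y where y: "y \<in> M" "b = pr y" by (auto simp: carrier_quot)
  have xy: "x \<otimes> y \<in> M" using subgroup.m_closed[OF M_subgroup x(1) y(1)] .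
  have G: "x \<in> carrier G" "y \<in> carrier G" using x y M_carrier by blast+
  show "conjg g ` (a \<otimes>\<^bsub>quot\<^esub> b) = (conjg g ` a) \<otimes>\<^bsub>quot\<^esub> (conjg g ` b)"
    unfolding x(2) y(2) pr_mult[OF x(1) y(1), symmetric]
      conjg_image_pr[OF assms(1,2) x(1)] conjg_image_pr[OF assms(1,2) y(1)] conjg_image_pr[OF assms(1,2) xy]
      conjg_mult[OF assms(1) G]
    by (rule pr_mult[OF gM[OF x(1)] gM[OF y(1)]])
qed

text \<open>The number of generators of \<open>M\<close> bounds the rank of the section.\<close>

lemma rank_le_fg:
  assumes "fg_subgroup M"
  shows "\<exists>r. rank_le M H r"
proof -
  interpret Q: comm_group quot by (rule quot_comm)
  obtain Y where Y: "finite Y" "Y \<subseteq> carrier G" "generate G Y = M" using assms by (rule fg_subgroupE)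
  obtain ys where ys: "set ys = Y" using finite_list[OF Y(1)] by blast
  have YM: "Y \<subseteq> M" unfolding Y(3)[symmetric] by (auto intro: generate.incl)
  have "generate (G\<lparr>carrier := M\<rparr>) Y = M" using generate_consistent[OF YM M_subgroup] Y(3) by simp
  then have "pr ` M = generate quot (pr ` Y)"
    using group_hom.generate_img[OF pr_group_hom, of Y] YM by simp
  then have gen: "generate quot (set (map pr ys)) = carrier quot" using ys by (simp add: carrier_quot)
  have "rank_le M H (length ys)" unfolding rank_le_def
  proof (intro allI impI)
    fix ms assume ms: "set ms \<subseteq> M" "length ms = Suc (length ys)"
    have "set (map pr ys) \<subseteq> carrier quot" "set (map pr ms) \<subseteq> carrier quot"
      using ys YM ms(1) pr_closed by auto
    from Q.prod_pow_dependence[OF this(1) gen this(2)] obtain zs where zs: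
      "length zs = Suc (length ys)" "\<exists>z\<in>set zs. z \<noteq> 0" "prod_pow quot (map pr ms) zs = \<one>\<^bsub>quot\<^esub>"
      using ms(2) by auto
    have "prod_pow G ms zs \<in> M" by (rule prod_pow_in_subgroup[OF M_subgroup ms(1)])
    then have "prod_pow G ms zs \<in> H" using zs(3) pr_prod_pow[OF ms(1), of zs] pr_one_iff by simp
    then show "\<exists>zs. length zs = Suc (length ys) \<and> (\<exists>z\<in>set zs. z \<noteq> 0) \<and> prod_pow G ms zs \<in> H"
      using zs(1,2) by blast
  qed
  then show ?thesis by blast
qed

text \<open>The words \<open>a ^ d\<^sub>1 t a ^ d\<^sub>2 t \<dots>\<close> with digits \<open>d\<^sub>i \<in> {0, 1}\<close> cannot all be different, and a
  coincidence is a digit polynomial in the conjugation by \<open>t\<close> that kills \<open>a\<close>.\<close>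

lemma digit_relation:
  assumes X: "finite X" "X \<subseteq> carrier G" and slow: "\<exists>n0. \<forall>n\<ge>n0. card (word_ball X (D * n)) < 2 ^ n"
    and t: "t \<in> word_ball X p" "normalizes t M" and a: "a \<in> word_ball X s" "a \<in> M" and D: "p + s \<le> D"
    and \<psi>: "\<psi> \<in> hom quot quot" "\<And>m. m \<in> M \<Longrightarrow> \<psi> (pr m) = pr (conjg t m)"
  shows "\<exists>p. digit_poly p \<and> poly_act quot \<psi> p (pr a) = \<one>\<^bsub>quot\<^esub>"
proof -
  interpret Q: comm_group quot by (rule quot_comm)
  define dig where "dig d = (if d then a else \<one>)" for d
  define wv where "wv e = foldr (\<lambda>d x. dig d \<otimes> t \<otimes> x) e \<one>" for e
  define om where "om e = foldr (\<lambda>d x. dig d \<otimes> conjg t x) e \<one>" for e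
  have tG: "t \<in> carrier G" and aG: "a \<in> carrier G" using t(1) a(1) word_ball_subset[OF X(2)] by blast+
  have digM: "dig d \<in> M" and digG: "dig d \<in> carrier G" for d
    using a(2) aG subgroup.one_closed[OF M_subgroup] by (simp_all add: dig_def)
  have conjM: "conjg t m \<in> M" if "m \<in> M" for m using t(2) that M_carrier unfolding normalizes_def by blast
  have omM: "om e \<in> M" for e
  proof (induction e)
    case (Cons d e)
    then show ?case unfolding om_def foldr_Cons comp_def
      by (intro subgroup.m_closed[OF M_subgroup] digM conjM)
  qed (simp add: om_def subgroup.one_closed[OF M_subgroup])
  have omG: "om e \<in> carrier G" for e using omM M_carrier by blast
  have ball: "wv e \<in> word_ball X (D * length e)" for e
  proof (induction e)
    case (Cons d e)
    have "dig d \<in> word_ball X s" using a(1) by (simp add: dig_def)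
    then have "dig d \<otimes> t \<otimes> wv e \<in> word_ball X (s + p + D * length e)"
      by (intro word_ball_mult[OF X(2)] t(1) Cons)
    moreover have "s + p + D * length e \<le> D * length (d # e)" using D by simp
    ultimately have "dig d \<otimes> t \<otimes> wv e \<in> word_ball X (D * length (d # e))"
      using word_ball_mono by blast
    then show ?case by (simp add: wv_def)
  qed (simp add: wv_def)
  \<comment> \<open>Moving all letters \<open>t\<close> to the right leaves a product of conjugates
    of the digits. In the quotient this is a polynomial in the conjugation by \<open>t\<close>,
    applied to \<open>a\<close>.\<close>
  have wv_om: "wv e = om e \<otimes> t [^] length e" for e
  proof (induction e)
    case (Cons d e)
    have "wv (d # e) = dig d \<otimes> t \<otimes> (om e \<otimes> t [^] length e)" using Cons by (simp add: wv_def)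
    also have "\<dots> = dig d \<otimes> conjg t (om e) \<otimes> (t \<otimes> t [^] length e)"
      using digG omG tG by (simp add: conjg_def group_simps)
    also have "t \<otimes> t [^] length e = t [^] length (d # e)" using tG nat_pow_Suc2 by simp
    finally show ?case by (simp add: om_def)
  qed (simp add: wv_def om_def)
  define ip where "ip e = Poly (map (\<lambda>d. if d then 1 else (0::int)) e)" for e
  have act: "pr (om e) = poly_act quot \<psi> (ip e) (pr a)" for e
  proof (induction e)
    case Nil
    then show ?case using pr_one_iff subgroup.one_closed[OF M_subgroup] subgroup.one_closed[OF H_subgroup]
      by (simp add: om_def ip_def)
  next
    case (Cons d e)
    have "pr (om (d # e)) = pr (dig d) \<otimes>\<^bsub>quot\<^esub> pr (conjg t (om e))"
      unfolding om_def foldr_Cons comp_def using omM[of e] conjM digM by (intro pr_mult) (simp_all add: om_def)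
    also have "pr (dig d) = pr a [^]\<^bsub>quot\<^esub> (if d then 1 else 0 :: int)"
      using pr_closed[OF a(2)] pr_one_iff subgroup.one_closed[OF M_subgroup] subgroup.one_closed[OF H_subgroup]
      by (simp add: dig_def)
    also have "pr (conjg t (om e)) = \<psi> (poly_act quot \<psi> (ip e) (pr a))"
      unfolding Cons[symmetric] by (rule \<psi>(2)[OF omM, symmetric])
    finally show ?case using Q.poly_act_pCons[OF \<psi>(1) pr_closed[OF a(2)]] by (simp add: ip_def)
  qed
  obtain n where n: "card (word_ball X (D * n)) < 2 ^ n" using slow by blast
  let ?E = "{e :: bool list. set e \<subseteq> UNIV \<and> length e = n}"
  have "\<not> inj_on wv ?E"
  proof
    assume "inj_on wv ?E"
    then have "card ?E \<le> card (word_ball X (D * n))"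
      using ball by (intro card_inj_on_le[OF _ _ finite_word_ball[OF X(1)]]) auto
    moreover have "card ?E = 2 ^ n" using card_lists_length_eq[of "UNIV :: bool set" n] by simp
    ultimately show False using n by simp
  qed
  then obtain e f where ef: "length e = n" "length f = n" "wv e = wv f" "e \<noteq> f"
    unfolding inj_on_def by blast
  \<comment> \<open>Both words contain \<open>t\<close> exactly \<open>n\<close> times, so these
    letters cancel.\<close>
  have "om e = om f" using ef(1-3) wv_om[of e] wv_om[of f] omG tG by simp
  then have eq: "poly_act quot \<psi> (ip e) (pr a) = poly_act quot \<psi> (ip f) (pr a)" using act by metis
  define P where "P = ip e - ip f"
  have "poly_act quot \<psi> (P + ip f) (pr a) = poly_act quot \<psi> P (pr a) \<otimes>\<^bsub>quot\<^esub> poly_act quot \<psi> (ip f) (pr a)"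
    by (rule Q.poly_act_add[OF \<psi>(1) pr_closed[OF a(2)]])
  then have "poly_act quot \<psi> (ip f) (pr a) = poly_act quot \<psi> P (pr a) \<otimes>\<^bsub>quot\<^esub> poly_act quot \<psi> (ip f) (pr a)"
    using eq by (simp add: P_def)
  then have "poly_act quot \<psi> P (pr a) = \<one>\<^bsub>quot\<^esub>"
    using Q.poly_act_closed[OF \<psi>(1) pr_closed[OF a(2)]] by (metis Q.r_cancel_one')
  moreover have "digit_poly P" unfolding digit_poly_def
  proof (intro conjI allI)
    obtain i where i: "i < n" "e ! i \<noteq> f ! i" using ef(1,2) ef(4)[unfolded list_eq_iff_nth_eq] by auto
    then have "coeff P i \<noteq> 0" using ef(1,2) by (simp add: P_def ip_def nth_default_def)
    then show "P \<noteq> 0" by (metis coeff_0)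
    show "coeff P i \<in> {-1, 0, 1}" for i by (simp add: P_def ip_def nth_default_def)
  qed
  ultimately show ?thesis by blast
qed

lemma pr_commutator_trivial:
  assumes "g \<in> carrier G" "m \<in> M" "commutator g m \<in> H"
  shows "pr (conjg g m) = pr m" "conjg g m \<in> M"
proof -
  have mG: "m \<in> carrier G" using assms(2) M_carrier by blast
  have eq: "conjg g m = commutator g m \<otimes> m" using assms(1) mG by (rule conjg_eq_commutator)
  show M: "conjg g m \<in> M"
    unfolding eq using subgroup.m_closed[OF M_subgroup _ assms(2)] assms(3) H_M by blast
  have "conjg g m \<otimes> inv m = commutator g m" by (simp add: conjg_def commutator_def)
  then show "pr (conjg g m) = pr m" using pr_eq_iff[OF M assms(2)] assms(3) by simp
qed

end

context group
begin

text \<open>With \<open>l\<close> put in front of the given elements, a relation cannot involve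
  \<open>l\<close> alone, since no nonzero power of \<open>l\<close> lies in \<open>H\<close>.
  Modulo \<open>L\<close> the element \<open>l\<close> disappears from the relation, so the rank
  drops.\<close>

lemma rank_le_quotient:
  assumes "rank_le M H r" and L: "subgroup L G" "H \<subseteq> L" and l: "l \<in> L" "l \<in> M"
    and nt: "\<And>k::int. l [^] k \<in> H \<Longrightarrow> k = 0" and M: "subgroup M G"
  obtains r' where "r = Suc r'" "rank_le M L r'"
proof -
  have lG: "l \<in> carrier G" using subgroup.mem_carrier[OF L(1) l(1)] .
  have "r \<noteq> 0"
  proof
    assume "r = 0"
    then have "\<exists>zs. length zs = Suc 0 \<and> (\<exists>z\<in>set zs. z \<noteq> 0) \<and> prod_pow G [l] zs \<in> H"
      using assms(1)[unfolded rank_le_def, rule_format, of "[l]"] l(2) by simp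
    then obtain z where z: "z \<noteq> 0" "prod_pow G [l] [z] \<in> H" by (auto simp: length_Suc_conv)
    then have "l [^] z \<in> H" using lG by simp
    then show False using nt z(1) by blast
  qed
  then obtain r' where r': "r = Suc r'" using not0_implies_Suc by blast
  have "rank_le M L r'" unfolding rank_le_def
  proof (intro allI impI)
    fix ms assume ms: "set ms \<subseteq> M" "length ms = Suc r'"
    have "set (l # ms) \<subseteq> M" "length (l # ms) = Suc r" using ms l(2) r' by auto
    then obtain zs where zs: "length zs = Suc r" "\<exists>z\<in>set zs. z \<noteq> 0" "prod_pow G (l # ms) zs \<in> H"
      using assms(1) unfolding rank_le_def by blast
    obtain z zs' where zz: "zs = z # zs'" "length zs' = Suc r'" using zs(1) r' by (auto simp: length_Suc_conv)
    let ?p = "prod_pow G ms zs'"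
    have pG: "?p \<in> carrier G" using prod_pow_in_subgroup[OF M ms(1)] subgroup.mem_carrier[OF M] by blast
    have zp: "l [^] z \<otimes> ?p \<in> H" using zs(3) zz(1) by simp
    have "\<exists>z\<in>set zs'. z \<noteq> 0"
    proof (rule ccontr)
      assume neg: "\<not> (\<exists>z\<in>set zs'. z \<noteq> 0)"
      then have "?p = \<one>" using prod_pow_zero by blast
      then have "l [^] z \<in> H" using zp lG by simp
      then have "z = 0" by (rule nt)
      then show False using neg zs(2) zz(1) by auto
    qed
    moreover have "?p \<in> L"
    proof -
      have lz: "l [^] z \<in> L" by (rule subgroup_int_pow_closed[OF L(1) l(1)])
      have "inv (l [^] z) \<otimes> (l [^] z \<otimes> ?p) \<in> L"
        using subgroup.m_closed[OF L(1) subgroup.m_inv_closed[OF L(1) lz]] zp L(2) by blast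
      then show ?thesis using lG pG by (simp add: inv_mult_cancel)
    qed
    ultimately show "\<exists>zs. length zs = Suc r' \<and> (\<exists>z\<in>set zs. z \<noteq> 0) \<and> prod_pow G ms zs \<in> L"
      using zz(2) by blast
  qed
  with r' show thesis by (rule that)
qed

text \<open>With \<open>m\<close> put in front of elements of \<open>L\<close>, a relation has
  exponent 0 at \<open>m\<close>, since no nonzero power of \<open>m\<close> lies in
  \<open>L\<close>.\<close>

lemma rank_le_subgroup:
  assumes "rank_le M H (Suc r)" and L: "subgroup L G" "H \<subseteq> L" "L \<subseteq> M" and m: "m \<in> M"
    and nt: "\<And>k::int. m [^] k \<in> L \<Longrightarrow> k = 0" and M: "subgroup M G"
  shows "rank_le L H r"
  unfolding rank_le_def
proof (intro allI impI)
  have mG: "m \<in> carrier G" using subgroup.mem_carrier[OF M m] .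
  fix ms assume ms: "set ms \<subseteq> L" "length ms = Suc r"
  have "set (m # ms) \<subseteq> M" "length (m # ms) = Suc (Suc r)" using ms m L(3) by auto
  then obtain zs where zs: "length zs = Suc (Suc r)" "\<exists>z\<in>set zs. z \<noteq> 0" "prod_pow G (m # ms) zs \<in> H"
    using assms(1) unfolding rank_le_def by blast
  obtain z zs' where zz: "zs = z # zs'" "length zs' = Suc r" using zs(1) by (auto simp: length_Suc_conv)
  let ?p = "prod_pow G ms zs'"
  have pL: "?p \<in> L" by (rule prod_pow_in_subgroup[OF L(1) ms(1)])
  have pG: "?p \<in> carrier G" using subgroup.mem_carrier[OF L(1) pL] .
  have zp: "m [^] z \<otimes> ?p \<in> H" using zs(3) zz(1) by simp
  then have "m [^] z \<otimes> ?p \<otimes> inv ?p \<in> L"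
    using subgroup.m_closed[OF L(1) _ subgroup.m_inv_closed[OF L(1) pL]] L(2) by blast
  then have "m [^] z \<in> L" using mG pG by (simp add: m_assoc)
  then have z0: "z = 0" by (rule nt)
  then have "?p \<in> H" using zp pG by simp
  moreover have "\<exists>z\<in>set zs'. z \<noteq> 0" using zs(2) zz(1) z0 by auto
  ultimately show "\<exists>zs. length zs = Suc r \<and> (\<exists>z\<in>set zs. z \<noteq> 0) \<and> prod_pow G ms zs \<in> H"
    using zz(2) by blast
qed

end

section \<open>Abelian sections of slow groups\<close>

context group
begin

text \<open>An irreducible abelian section is centralized by a subgroup of finite index: going through a
  short polycyclic series of \<open>P / M\<close> from the bottom, each \<open>t\<close> is central up to finite index, so that
  the kernels of polynomials in \<open>t\<close> are invariant, and Kronecker's theorem applies.\<close>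

lemma virtually_nilpotent_irreducible:
  assumes P: "slow P" and MP: "normal_in M P" and HP: "normal_in H P" and HM: "H \<subseteq> M"
    and ab: "\<And>x y. x \<in> M \<Longrightarrow> y \<in> M \<Longrightarrow> commutator x y \<in> H"
    and tf: "\<And>m k. m \<in> M \<Longrightarrow> m [^] (k::int) \<in> H \<Longrightarrow> k = 0 \<or> m \<in> H"
    and rank: "rank_le M H r" and nil: "nilpotent_mod P c M"
    and irr: "\<And>K L. finite_index K P \<Longrightarrow> M \<subseteq> K \<Longrightarrow> normal_in L K \<Longrightarrow> H \<subseteq> L \<Longrightarrow> L \<subseteq> M \<Longrightarrow>
      (\<forall>l\<in>L. \<exists>k::int. k \<noteq> 0 \<and> l [^] k \<in> H) \<or> (\<forall>m\<in>M. \<exists>k::int. k \<noteq> 0 \<and> m [^] k \<in> L)"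
  shows "virtually_nilpotent P H"
proof -
  let ?l = "4 ^ (2 * Suc c) :: nat"
  have subP: "subgroup P G" and subM: "subgroup M G" and subH: "subgroup H G" and MsubP: "M \<subseteq> P"
    using normal_inD[OF MP] normal_inD[OF HP] by blast+
  have PG: "x \<in> carrier G" if "x \<in> P" for x using subgroup.mem_carrier[OF subP that] .
  have MG: "x \<in> carrier G" if "x \<in> M" for x using subgroup.mem_carrier[OF subM that] .
  have HM': "normal_in H M" by (rule normal_in_subgroup[OF HP subM MsubP HM])
  interpret S: abelian_section G M H
    using HM' ab by unfold_locales
  interpret Q: comm_group S.quot by (rule S.quot_comm)
  have nil': "nilpotent_mod P (Suc c) M" using nilpotent_mod_mono[OF nil] by simp
  \<comment> \<open>The words to be compared are built from powers \<open>t [^] q\<close> with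
    \<open>q \<le> power_bound r\<close> and from one element of \<open>A\<close>, all over balls of
    radius \<open>?l\<close>; this explains \<open>D\<close>. The rank \<open>r\<close> is known
    before \<open>X\<close> is chosen.\<close>
  obtain X ts A where ts: "finite X" "X \<subseteq> carrier G"
    "A \<subseteq> word_ball X ?l" "set ts \<subseteq> word_ball X ?l"
    "\<exists>n0. \<forall>n\<ge>n0. card (word_ball X ((power_bound r + 1) * ?l * n)) < 2 ^ n"
    "generate G (set ts) = P" "chain_list A ts" "A \<subseteq> M" "fg_subgroup (closure_under A (set ts) {\<one>})"
    by (rule slow_chain_list[OF P _ MP nil', where D = "(power_bound r + 1) * ?l"]) auto
  have tsG: "set ts \<subseteq> carrier G" using ts(7) by (simp add: chain_list_def)
  have tsP: "t \<in> P" if "t \<in> set ts" for t unfolding ts(6)[symmetric] using that by (rule generate.incl)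
  show ?thesis
  proof (cases "A \<subseteq> H")
    \<comment> \<open>If all relators lie in \<open>H\<close>, the list is a central series for
      \<open>P / H\<close> as well.\<close>
    case True
    have "normal_in H (generate G (set ts))" unfolding ts(6) by (rule HP)
    from chain_list_nilpotent[OF ts(7) this True] obtain d where "nilpotent_mod P d H" unfolding ts(6) by blast
    then show ?thesis unfolding virtually_nilpotent_def
      using HP finite_index_refl[OF subP] normal_inD(3)[OF HP] by blast
  next
    case False
    \<comment> \<open>A short element that is nontrivial in \<open>M / H\<close>: all digit
      relations are obtained for this one vector.\<close>
    then obtain a where a: "a \<in> A" "a \<notin> H" by blast
    have aM: "a \<in> M" and aball: "a \<in> word_ball X ?l" using a(1) ts(3,8) by blast+
    \<comment> \<open>The centralizer of \<open>M / H\<close> in \<open>P\<close>; the aim is to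
      show that its index is finite.\<close>
    define C where "C = {g \<in> P. \<forall>m\<in>M. commutator g m \<in> H}"
    have C_eq: "C = P \<inter> \<Inter>((\<lambda>m. {g \<in> P. commutator g m \<in> H}) ` M)" unfolding C_def by blast
    have subC: "subgroup C G"
    proof -
      have "subgroup (\<Inter>(insert P ((\<lambda>m. {g \<in> P. commutator g m \<in> H}) ` M))) G"
        using subP commutator_kernel_normal[OF HP] MsubP by (intro subgroups_Inter) auto
      then show ?thesis unfolding C_eq by simp
    qed
    have MC: "M \<subseteq> C" unfolding C_def using MsubP ab by blast
    have CP: "C \<subseteq> P" unfolding C_def by blast
    have normC: "normal_in C P"
    proof (rule normal_inI[OF subC subP CP])
      fix g x assume g: "g \<in> P" and x: "x \<in> C"
      have xP: "x \<in> P" using x CP by blast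
      have G: "g \<in> carrier G" "x \<in> carrier G" using g xP PG by blast+
      have "commutator (conjg g x) m \<in> H" if m: "m \<in> M" for m
      proof -
        have "conjg (inv g) m \<in> M" using normal_in_conjg[OF MP subgroup.m_inv_closed[OF subP g] m] .
        then have "commutator x (conjg (inv g) m) \<in> H" using x unfolding C_def by blast
        then have "conjg g (commutator x (conjg (inv g) m)) \<in> H" by (rule normal_in_conjg[OF HP g])
        then show ?thesis using G MG[OF m] by (simp add: conjg_commutator)
      qed
      moreover have "conjg g x \<in> P"
        unfolding conjg_def using g xP subgroup.m_closed[OF subP] subgroup.m_inv_closed[OF subP] by blast
      ultimately show "conjg g x \<in> C" unfolding C_def by blast
    qed
    have AC: "A \<subseteq> C" using ts(8) MC by blast
    have normC': "normal_in C (generate G (set ts))" unfolding ts(6) by (rule normC)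
    have CG: "C \<subseteq> carrier G" using subgroup.subset[OF subC] .
    have "ts = us @ vs \<Longrightarrow> finite_index C (generate G (C \<union> set vs))" for us vs
    proof (induction vs arbitrary: us)
      case Nil
      show ?case using finite_index_refl[OF subC] generate_subgroup_id[OF subC] by simp
    next
      case (Cons t vs)
      let ?K = "generate G (C \<union> set vs)"
      have fiK: "finite_index C ?K" using Cons.IH[of "us @ [t]"] Cons.prems by simp
      have tts: "t \<in> set ts" using Cons.prems by simp
      have tP: "t \<in> P" using tsP[OF tts] .
      have tG: "t \<in> carrier G" using PG[OF tP] .
      have tvG: "set (t # vs) \<subseteq> carrier G" using tsG Cons.prems by auto
      have subK: "subgroup ?K G" using CG tvG by (intro generate_is_subgroup) auto
      have ntK: "normalizes t ?K"
      proof (rule chain_list_normalizes[OF ts(7) subC AC normal_inD(4)[OF normC tsP]])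
        show "ts = (us @ [t]) @ vs" using Cons.prems by simp
        show "t \<in> generate G (set ts)" unfolding ts(6) by (rule tP)
      qed
      have com: "commutator g t \<in> ?K" if "g \<in> P" for g
      proof -
        have "t \<in> generate G (C \<union> set (t # vs))" by (intro generate.incl) simp
        with chain_list_central[OF ts(7) normC' AC Cons.prems _ this] that show ?thesis
          unfolding ts(6) by blast
      qed
      \<comment> \<open>Modulo \<open>?K\<close> the element \<open>t\<close> is central, and
        \<open>C\<close> has finite index in \<open>?K\<close>, so a subgroup of finite index
        commutes with \<open>t\<close> modulo \<open>C\<close>.\<close>
      define G2 where "G2 = {g \<in> P. commutator g t \<in> C}"
      have fiG2: "finite_index G2 P" unfolding G2_def
        by (rule commutator_kernel_finite_index[OF normC tP fiK com])
      have subG2: "subgroup G2 G" and G2P: "G2 \<subseteq> P" using finite_indexD[OF fiG2] by blast+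
      have MG2: "M \<subseteq> G2" unfolding G2_def using MC MsubP normal_in_commutator(2)[OF normC tP] by blast
      have nH: "normalizes g H" and nM: "normalizes g M" if "g \<in> P" for g
        using normal_inD(4)[OF HP that] normal_inD(4)[OF MP that] by blast+
      let ?\<phi> = "(`) (conjg t)"
      have \<phi>: "?\<phi> \<in> hom S.quot S.quot" by (rule S.conjg_image_hom[OF tG nH[OF tP] nM[OF tP]])
      have pow_pr: "(?\<phi> ^^ q) (S.pr m) = S.pr (conjg (t [^] q) m)" if m: "m \<in> M" for q m
      proof (induction q)
        case 0
        then show ?case using MG[OF m] by simp
      next
        case (Suc q)
        have "t [^] q \<in> P" using tP subgroup_int_pow_closed[OF subP tP, of "int q"] by (simp add: int_pow_int)
        then have "conjg (t [^] q) m \<in> M" by (rule normal_in_conjg[OF MP _ m])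
        then have "(?\<phi> ^^ Suc q) (S.pr m) = S.pr (conjg t (conjg (t [^] q) m))"
          using Suc S.conjg_image_pr[OF tG nH[OF tP]] by simp
        also have "conjg t (conjg (t [^] q) m) = conjg (t [^] Suc q) m"
          using tG MG[OF m] nat_pow_Suc2[OF tG] by (simp add: conjg_mult_left)
        finally show ?case .
      qed
      have ker: "(\<forall>m\<in>M. poly_act S.quot ?\<phi> p (S.pr m) = \<one>\<^bsub>S.quot\<^esub>) \<or>
        (\<forall>m\<in>M. poly_act S.quot ?\<phi> p (S.pr m) = \<one>\<^bsub>S.quot\<^esub> \<longrightarrow> m \<in> H)" for p
      proof -
        let ?act = "poly_act S.quot ?\<phi> p"
        \<comment> \<open>The kernel of the polynomial, pulled back to \<open>M\<close>. Its
          invariance is known under \<open>G2\<close> only, which is why \<open>irr\<close> speaks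
          of all subgroups of finite index.\<close>
        define L where "L = {m \<in> M. ?act (S.pr m) = \<one>\<^bsub>S.quot\<^esub>}"
        have act_hom: "?act \<in> hom S.quot S.quot" by (rule Q.poly_act_hom[OF \<phi>])
        have act_one: "?act \<one>\<^bsub>S.quot\<^esub> = \<one>\<^bsub>S.quot\<^esub>"
          using hom_one[OF act_hom S.quot_group S.quot_group] .
        have HL: "H \<subseteq> L"
        proof
          fix h assume h: "h \<in> H"
          then have "S.pr h = \<one>\<^bsub>S.quot\<^esub>" using S.pr_one_iff HM by blast
          then show "h \<in> L" unfolding L_def using h HM act_one by auto
        qed
        have "subgroup L G"
        proof (rule subgroupI)
          show "L \<subseteq> carrier G" unfolding L_def using MG by blast
          show "L \<noteq> {}" using HL subgroup.one_closed[OF subH] by blast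
        next
          fix x assume x: "x \<in> L"
          then have xM: "x \<in> M" "?act (S.pr x) = \<one>\<^bsub>S.quot\<^esub>" by (auto simp: L_def)
          have ixM: "inv x \<in> M" using subgroup.m_inv_closed[OF subM xM(1)] .
          have "\<one>\<^bsub>S.quot\<^esub> = ?act (S.pr (x \<otimes> inv x))"
            using act_one S.pr_one_iff[OF subgroup.one_closed[OF subM]] subgroup.one_closed[OF subH] MG[OF xM(1)] by simp
          also have "\<dots> = ?act (S.pr x) \<otimes>\<^bsub>S.quot\<^esub> ?act (S.pr (inv x))"
            unfolding S.pr_mult[OF xM(1) ixM] by (rule hom_mult[OF act_hom S.pr_closed[OF xM(1)] S.pr_closed[OF ixM]])
          also have "\<dots> = ?act (S.pr (inv x))"
            unfolding xM(2) by (rule Q.l_one[OF hom_in_carrier[OF act_hom S.pr_closed[OF ixM]]])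
          finally show "inv x \<in> L" unfolding L_def using ixM by simp
          fix y assume y: "y \<in> L"
          then have yM: "y \<in> M" "?act (S.pr y) = \<one>\<^bsub>S.quot\<^esub>" by (auto simp: L_def)
          have "?act (S.pr (x \<otimes> y)) = ?act (S.pr x) \<otimes>\<^bsub>S.quot\<^esub> ?act (S.pr y)"
            unfolding S.pr_mult[OF xM(1) yM(1)] by (rule hom_mult[OF act_hom S.pr_closed[OF xM(1)] S.pr_closed[OF yM(1)]])
          also have "\<dots> = \<one>\<^bsub>S.quot\<^esub>" unfolding xM(2) yM(2) by (rule Q.l_one[OF Q.one_closed])
          finally show "x \<otimes> y \<in> L" unfolding L_def using subgroup.m_closed[OF subM xM(1) yM(1)] by simp
        qed
        moreover have "conjg g x \<in> L" if g: "g \<in> G2" and x: "x \<in> L" for g x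
        proof -
          have xM: "x \<in> M" "?act (S.pr x) = \<one>\<^bsub>S.quot\<^esub>" using x by (auto simp: L_def)
          have gP: "g \<in> P" and gt: "commutator g t \<in> C" using g by (auto simp: G2_def)
          have gG: "g \<in> carrier G" using PG[OF gP] .
          let ?\<gamma> = "(`) (conjg g)"
          have \<gamma>: "?\<gamma> \<in> hom S.quot S.quot" by (rule S.conjg_image_hom[OF gG nH[OF gP] nM[OF gP]])
          have "?\<gamma> (?\<phi> b) = ?\<phi> (?\<gamma> b)" if bc: "b \<in> carrier S.quot" for b
          proof -
            obtain m where m: "m \<in> M" "b = S.pr m" using bc unfolding S.carrier_quot by blast
            have mG: "m \<in> carrier G" using MG[OF m(1)] .
            have tm: "conjg t m \<in> M" and gm: "conjg g m \<in> M"
              using normal_in_conjg[OF MP] tP gP m(1) by blast+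
            have tgm: "conjg t (conjg g m) \<in> M" using normal_in_conjg[OF MP tP gm] .
            have "?\<gamma> (?\<phi> b) = S.pr (conjg g (conjg t m))"
              unfolding m(2) S.conjg_image_pr[OF tG nH[OF tP] m(1)] by (rule S.conjg_image_pr[OF gG nH[OF gP] tm])
            also have "conjg g (conjg t m) = conjg (commutator g t) (conjg t (conjg g m))"
              using gG tG mG by (simp add: conjg_def commutator_def group_simps)
            \<comment> \<open>\<open>g\<close> and \<open>t\<close> commute up to an element of
              \<open>C\<close>, which acts trivially on \<open>M / H\<close>.\<close>
            also have "S.pr \<dots> = S.pr (conjg t (conjg g m))"
            proof (rule S.pr_commutator_trivial(1)[OF _ tgm])
              show "commutator g t \<in> carrier G" using gG tG by simp
              show "commutator (commutator g t) (conjg t (conjg g m)) \<in> H" using gt tgm unfolding C_def by blast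
            qed
            also have "\<dots> = ?\<phi> (?\<gamma> b)"
              unfolding m(2) S.conjg_image_pr[OF gG nH[OF gP] m(1)] by (rule S.conjg_image_pr[OF tG nH[OF tP] gm, symmetric])
            finally show ?thesis .
          qed
          from Q.poly_act_commute[OF \<phi> \<gamma> S.pr_closed[OF xM(1)] this, of p]
          have "?act (?\<gamma> (S.pr x)) = ?\<gamma> \<one>\<^bsub>S.quot\<^esub>" unfolding xM(2) by simp
          also have "\<dots> = \<one>\<^bsub>S.quot\<^esub>" using hom_one[OF \<gamma> S.quot_group S.quot_group] .
          finally have "?act (S.pr (conjg g x)) = \<one>\<^bsub>S.quot\<^esub>"
            unfolding S.conjg_image_pr[OF gG nH[OF gP] xM(1)] .
          then show ?thesis unfolding L_def using normal_in_conjg[OF MP gP xM(1)] by blast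
        qed
        moreover have LM: "L \<subseteq> M" unfolding L_def by blast
        ultimately have "normal_in L G2" using subG2 MG2 by (intro normal_inI) blast+
        from irr[OF fiG2 MG2 this HL LM] show ?thesis
        proof
          assume tor: "\<forall>l\<in>L. \<exists>k::int. k \<noteq> 0 \<and> l [^] k \<in> H"
          have "m \<in> H" if "m \<in> M" "?act (S.pr m) = \<one>\<^bsub>S.quot\<^esub>" for m
          proof -
            have "m \<in> L" using that by (simp add: L_def)
            then obtain k :: int where "k \<noteq> 0" "m [^] k \<in> H" using tor by blast
            then show ?thesis using tf[OF that(1)] by blast
          qed
          then show ?thesis by blast
        next
          \<comment> \<open>Now the image of the polynomial is a torsion group inside the
            torsion-free group \<open>M / H\<close>.\<close>
          assume tor: "\<forall>m\<in>M. \<exists>k::int. k \<noteq> 0 \<and> m [^] k \<in> L"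
          have "?act (S.pr m) = \<one>\<^bsub>S.quot\<^esub>" if m: "m \<in> M" for m
          proof -
            obtain k :: int where k: "k \<noteq> 0" "m [^] k \<in> L" using tor m by blast
            have "?act (S.pr m) \<in> carrier S.quot" using hom_in_carrier[OF act_hom S.pr_closed[OF m]] .
            then obtain m' where m': "m' \<in> M" "?act (S.pr m) = S.pr m'" unfolding S.carrier_quot by blast
            have mk: "m' [^] k \<in> M" using subgroup_int_pow_closed[OF subM m'(1)] .
            have "S.pr (m' [^] k) = ?act (S.pr m) [^]\<^bsub>S.quot\<^esub> k" unfolding m'(2) by (rule S.pr_int_pow[OF m'(1)])
            also have "\<dots> = ?act (S.pr m [^]\<^bsub>S.quot\<^esub> k)"
              by (rule Q.hom_int_pow_self[OF act_hom S.pr_closed[OF m], symmetric])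
            also have "\<dots> = ?act (S.pr (m [^] k))" unfolding S.pr_int_pow[OF m] ..
            also have "\<dots> = \<one>\<^bsub>S.quot\<^esub>" using k(2) by (simp add: L_def)
            finally have "m' [^] k \<in> H" using S.pr_one_iff[OF mk] by blast
            then have "m' \<in> H" using tf[OF m'(1)] k(1) by blast
            then show ?thesis unfolding m'(2) using S.pr_one_iff[OF m'(1)] by blast
          qed
          then show ?thesis by blast
        qed
      qed
      let ?N = "fact (power_bound r) :: nat"
      have tN: "(?\<phi> ^^ ?N) b = b" if b: "b \<in> carrier S.quot" for b
      proof (rule Q.kronecker_endomorphism[OF \<phi> S.pr_closed[OF aM] _ _ _ _ _ _ b])
        show "S.pr a \<noteq> \<one>\<^bsub>S.quot\<^esub>" using a(2) S.pr_one_iff[OF aM] by blast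
        have cM: "conjg t a \<in> M" using normal_in_conjg[OF MP tP aM] .
        have "conjg t a \<notin> H" using a(2) nH[OF tP] MG[OF aM] unfolding normalizes_def by blast
        then show "conjg t ` S.pr a \<noteq> \<one>\<^bsub>S.quot\<^esub>"
          unfolding S.conjg_image_pr[OF tG nH[OF tP] aM] using S.pr_one_iff[OF cM] by blast
      next
        fix k :: int assume "S.pr a [^]\<^bsub>S.quot\<^esub> k = \<one>\<^bsub>S.quot\<^esub>"
        then have "S.pr (a [^] k) = \<one>\<^bsub>S.quot\<^esub>" unfolding S.pr_int_pow[OF aM] .
        then have "a [^] k \<in> H" using S.pr_one_iff[OF subgroup_int_pow_closed[OF subM aM]] by blast
        then show "k = 0" using tf[OF aM] a(2) by blast
      next
        fix p b assume b: "b \<in> carrier S.quot" "b \<noteq> \<one>\<^bsub>S.quot\<^esub>" "poly_act S.quot ?\<phi> p b = \<one>\<^bsub>S.quot\<^esub>"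
        obtain m where m: "m \<in> M" "b = S.pr m" using b(1) unfolding S.carrier_quot by blast
        have "m \<notin> H" using b(2) S.pr_one_iff[OF m(1)] unfolding m(2) by blast
        then show "\<forall>a\<in>carrier S.quot. poly_act S.quot ?\<phi> p a = \<one>\<^bsub>S.quot\<^esub>"
          using ker[of p] b(3) m unfolding S.carrier_quot by blast
      next
        fix bs assume bs: "set bs \<subseteq> carrier S.quot" "length bs = Suc r"
        have "\<exists>ms. set ms \<subseteq> M \<and> map S.pr ms = bs"
          using bs(1) unfolding S.carrier_quot
        proof (induction bs)
          case Nil
          show ?case by (intro exI[of _ "[]"]) simp
        next
          case (Cons b bs)
          then obtain ms m where "set ms \<subseteq> M" "map S.pr ms = bs" "m \<in> M" "b = S.pr m" by auto
          then show ?case by (intro exI[of _ "m # ms"]) simp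
        qed
        then obtain ms where ms: "set ms \<subseteq> M" "map S.pr ms = bs" by blast
        have "length ms = Suc r" using bs(2) ms(2) by (metis length_map)
        then obtain zs where zs: "length zs = Suc r" "\<exists>z\<in>set zs. z \<noteq> 0" "prod_pow G ms zs \<in> H"
          using rank ms(1) unfolding rank_le_def by blast
        have "prod_pow G ms zs \<in> M" using zs(3) HM by blast
        then have "prod_pow S.quot bs zs = \<one>\<^bsub>S.quot\<^esub>"
          using S.pr_prod_pow[OF ms(1), of zs] S.pr_one_iff zs(3) ms(2) by metis
        then show "\<exists>zs. length zs = Suc r \<and> (\<exists>z\<in>set zs. z \<noteq> 0) \<and> prod_pow S.quot bs zs = \<one>\<^bsub>S.quot\<^esub>"
          using zs(1,2) by blast
      next
        fix q assume q: "1 \<le> q" "q \<le> power_bound r"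
        have tq: "t [^] q \<in> word_ball X (?l * q)"
        proof (induction q)
          case (Suc q)
          have "t [^] q \<otimes> t \<in> word_ball X (?l * q + ?l)"
            using ts(4) tts by (intro word_ball_mult[OF ts(2)] Suc) blast
          then show ?case by (simp add: algebra_simps)
        qed simp
        have tqP: "t [^] q \<in> P" using subgroup_int_pow_closed[OF subP tP, of "int q"] by (simp add: int_pow_int)
        show "\<exists>p. digit_poly p \<and> poly_act S.quot (?\<phi> ^^ q) p (S.pr a) = \<one>\<^bsub>S.quot\<^esub>"
        proof (rule S.digit_relation[OF ts(1,2,5) tq nM[OF tqP] aball aM _ Q.funpow_hom[OF \<phi>] pow_pr])
          have "?l * q \<le> ?l * power_bound r" using q(2) by simp
          then show "?l * q + ?l \<le> (power_bound r + 1) * ?l" by (simp add: algebra_simps)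
        qed
      qed
      \<comment> \<open>This power of \<open>t\<close> acts trivially on \<open>M / H\<close>, so
        adding \<open>t\<close> to \<open>?K\<close> enlarges it by a finite index only.\<close>
      have "t [^] ?N \<in> C"
      proof -
        have tNP: "t [^] ?N \<in> P" using subgroup_int_pow_closed[OF subP tP, of "int ?N"] by (simp only: int_pow_int)
        have "commutator (t [^] ?N) m \<in> H" if m: "m \<in> M" for m
        proof -
          have cM: "conjg (t [^] ?N) m \<in> M" by (rule normal_in_conjg[OF MP tNP m])
          have "S.pr (conjg (t [^] ?N) m) = S.pr m" using tN[OF S.pr_closed[OF m]] pow_pr[OF m] by simp
          then have "conjg (t [^] ?N) m \<otimes> inv m \<in> H" using S.pr_eq_iff[OF cM m] by blast
          then show ?thesis by (simp add: conjg_def commutator_def)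
        qed
        then show ?thesis unfolding C_def using tNP by blast
      qed
      then have "t [^] ?N \<in> ?K" by (intro generate.incl) blast
      moreover have "?N > 0" by simp
      ultimately have "finite_index ?K (generate G (insert t ?K))"
        by (rule finite_index_generate_insert[OF tG subK ntK])
      then show ?case
        unfolding generate_insert_suffix[OF CG tvG] by (rule finite_index_trans[OF fiK])
    qed
    from this[of "[]" ts] have fi: "finite_index C (generate G (C \<union> set ts))" by simp
    have "P \<subseteq> generate G (C \<union> set ts)" unfolding ts(6)[symmetric] by (intro mono_generate) auto
    moreover have "generate G (C \<union> set ts) \<subseteq> P" using CP tsP by (intro generate_subgroup_incl subP) auto
    ultimately have fiC: "finite_index C P" using fi by (metis subset_antisym)
    \<comment> \<open>\<open>C\<close> is nilpotent modulo \<open>M\<close>, and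
      \<open>M / H\<close> is central in \<open>C / H\<close>, which adds one step.\<close>
    have "nilpotent_mod C c M" by (rule nilpotent_mod_mono[OF nil _ _ CP]) auto
    then have "nilpotent_mod C (2 * c + 1) H"
      by (rule nilpotent_mod_step[OF subC _ subH]) (simp add: C_def)
    moreover have "H \<subseteq> C" using HM MC by blast
    ultimately show ?thesis unfolding virtually_nilpotent_def using HP fiC by blast
  qed
qed

end

section \<open>Elementary amenable quotients\<close>

context group
begin

text \<open>Slowness makes \<open>M\<close> finitely generated, and a finitely generated abelian
  torsion group is finite.\<close>

lemma virtually_nilpotent_torsion_section:
  assumes P: "slow P" and M: "virtually_nilpotent P M" and H: "normal_in H P" "H \<subseteq> M"
    and ab: "\<And>x y. x \<in> M \<Longrightarrow> y \<in> M \<Longrightarrow> commutator x y \<in> H"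
    and tor: "\<And>m. m \<in> M \<Longrightarrow> \<exists>k::int. k \<noteq> 0 \<and> m [^] k \<in> H"
  shows "virtually_nilpotent P H"
proof -
  have MP: "normal_in M P" using M unfolding virtually_nilpotent_def by blast
  have sub: "subgroup M G" "M \<subseteq> P" "subgroup H G" using normal_inD[OF MP] normal_inD[OF H(1)] by blast+
  have fg: "fg_subgroup M" by (rule fg_above_virtually_nilpotent[OF P M sub(1) subset_refl sub(2)])
  have "finite_index H M"
  proof (rule finite_index_torsion_abelian[OF fg normal_in_subgroup[OF H(1) sub(1,2) H(2)] ab])
    fix m assume m: "m \<in> M"
    have mG: "m \<in> carrier G" using subgroup.mem_carrier[OF sub(1) m] .
    obtain k :: int where k: "k \<noteq> 0" "m [^] k \<in> H" using tor[OF m] by blast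
    have "m [^] \<bar>k\<bar> \<in> H"
    proof (cases "k \<ge> 0")
      case False
      then have "m [^] \<bar>k\<bar> = inv (m [^] k)" using mG by (simp add: int_pow_neg)
      then show ?thesis using subgroup.m_inv_closed[OF sub(3) k(2)] by simp
    qed (use k in simp)
    moreover have "\<bar>k\<bar> = int (nat \<bar>k\<bar>)" by simp
    ultimately have "m [^] nat \<bar>k\<bar> \<in> H" using int_pow_int[of G m "nat \<bar>k\<bar>"] by metis
    moreover have "nat \<bar>k\<bar> > 0" using k(1) by simp
    ultimately show "\<exists>n::nat. n > 0 \<and> m [^] n \<in> H" by blast
  qed
  then show ?thesis by (rule virtually_nilpotent_finite_section[OF M H(1)])
qed

lemma conjg_int_pow:
  assumes "g \<in> carrier G" "m \<in> carrier G"
  shows "conjg g (m [^] (k::int)) = conjg g m [^] k"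
  using group_hom.hom_int_pow[OF conjg_group_hom[OF assms(1)] assms(2)] .

text \<open>This is the preimage of the torsion subgroup of \<open>M / H\<close>, which every
  automorphism preserves.\<close>

lemma torsion_normal:
  assumes MP: "normal_in M P" and HP: "normal_in H P" and HM: "H \<subseteq> M"
    and ab: "\<And>x y. x \<in> M \<Longrightarrow> y \<in> M \<Longrightarrow> commutator x y \<in> H"
  shows "normal_in {m \<in> M. \<exists>k::int. k \<noteq> 0 \<and> m [^] k \<in> H} P"
proof -
  let ?T = "{m \<in> M. \<exists>k::int. k \<noteq> 0 \<and> m [^] k \<in> H}"
  have sub: "subgroup M G" "M \<subseteq> P" "subgroup H G" "subgroup P G"
    using normal_inD[OF MP] normal_inD[OF HP] by blast+
  have MG: "m \<in> carrier G" if "m \<in> M" for m using subgroup.mem_carrier[OF sub(1) that] .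
  interpret S: abelian_section G M H
    using normal_in_subgroup[OF HP sub(1,2) HM] ab by unfold_locales
  interpret Q: comm_group S.quot by (rule S.quot_comm)
  have "subgroup ?T G"
  proof (rule subgroupI)
    show "?T \<subseteq> carrier G" using MG by blast
    have "\<one> [^] (1::int) \<in> H" using subgroup.one_closed[OF sub(3)] by simp
    then show "?T \<noteq> {}" using subgroup.one_closed[OF sub(1)] one_neq_zero by blast
    fix x assume "x \<in> ?T"
    then obtain k :: int where x: "x \<in> M" "k \<noteq> 0" "x [^] k \<in> H" by blast
    have "inv x [^] k = inv (x [^] k)" using MG[OF x(1)] by (rule int_pow_inv)
    then have "inv x [^] k \<in> H" using subgroup.m_inv_closed[OF sub(3) x(3)] by simp
    then show "inv x \<in> ?T" using subgroup.m_inv_closed[OF sub(1) x(1)] x(2) by blast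
    fix y assume "y \<in> ?T"
    then obtain j :: int where y: "y \<in> M" "j \<noteq> 0" "y [^] j \<in> H" by blast
    have xy: "x \<otimes> y \<in> M" using subgroup.m_closed[OF sub(1) x(1) y(1)] .
    have cl: "S.pr x \<in> carrier S.quot" "S.pr y \<in> carrier S.quot" using S.pr_closed x(1) y(1) by blast+
    have px: "S.pr x [^]\<^bsub>S.quot\<^esub> k = \<one>\<^bsub>S.quot\<^esub>" and py: "S.pr y [^]\<^bsub>S.quot\<^esub> j = \<one>\<^bsub>S.quot\<^esub>"
      unfolding S.pr_int_pow[OF x(1), symmetric] S.pr_int_pow[OF y(1), symmetric]
      using S.pr_one_iff[OF subgroup_int_pow_closed[OF sub(1) x(1)]] x(3)
        S.pr_one_iff[OF subgroup_int_pow_closed[OF sub(1) y(1)]] y(3) by blast+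
    have "S.pr ((x \<otimes> y) [^] (k * j)) = S.pr x [^]\<^bsub>S.quot\<^esub> (k * j) \<otimes>\<^bsub>S.quot\<^esub> S.pr y [^]\<^bsub>S.quot\<^esub> (j * k)"
      unfolding S.pr_int_pow[OF xy] S.pr_mult[OF x(1) y(1)] mult.commute[of j k]
      by (rule Q.int_pow_distrib[OF cl])
    also have "\<dots> = (S.pr x [^]\<^bsub>S.quot\<^esub> k) [^]\<^bsub>S.quot\<^esub> j \<otimes>\<^bsub>S.quot\<^esub> (S.pr y [^]\<^bsub>S.quot\<^esub> j) [^]\<^bsub>S.quot\<^esub> k"
      unfolding Q.int_pow_pow[OF cl(1)] Q.int_pow_pow[OF cl(2)] ..
    also have "\<dots> = \<one>\<^bsub>S.quot\<^esub>" unfolding px py Q.int_pow_one by (rule Q.l_one[OF Q.one_closed])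
    finally have "(x \<otimes> y) [^] (k * j) \<in> H"
      using S.pr_one_iff[OF subgroup_int_pow_closed[OF sub(1) xy]] by blast
    moreover have "k * j \<noteq> 0" using x(2) y(2) by simp
    ultimately show "x \<otimes> y \<in> ?T" using xy by blast
  qed
  then show ?thesis
  proof (rule normal_inI[OF _ sub(4)])
    show "?T \<subseteq> P" using sub(2) by blast
    fix g x assume g: "g \<in> P" and "x \<in> ?T"
    then obtain k :: int where x: "x \<in> M" "k \<noteq> 0" "x [^] k \<in> H" by blast
    have "conjg g (x [^] k) = conjg g x [^] k"
      using conjg_int_pow[OF subgroup.mem_carrier[OF sub(4) g] MG[OF x(1)]] .
    then have "conjg g x [^] k \<in> H" using normal_in_conjg[OF HP g x(3)] by simp
    then show "conjg g x \<in> ?T" using normal_in_conjg[OF MP g x(1)] x(2) by blast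
  qed
qed

text \<open>Induction on the rank. If over some subgroup of finite index there is an intermediate
  \<open>L\<close> with neither \<open>L / H\<close> nor \<open>M / L\<close> torsion, both pieces
  have smaller rank, and \<open>M / L\<close> and then \<open>L / H\<close> are treated over that
  subgroup. Otherwise the section is irreducible once its torsion \<open>T\<close> is divided out,
  and \<open>T / H\<close> is dealt with separately.\<close>

lemma virtually_nilpotent_abelian_section:
  assumes "slow P" "virtually_nilpotent P M" "normal_in H P" "H \<subseteq> M"
    and "\<And>x y. x \<in> M \<Longrightarrow> y \<in> M \<Longrightarrow> commutator x y \<in> H" and "rank_le M H r"
  shows "virtually_nilpotent P H"
  using assms
proof (induction r arbitrary: P M H rule: less_induct)
  case (less r)
  note P = less.prems(1) and M = less.prems(2) and HP = less.prems(3) and HM = less.prems(4)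
    and ab = less.prems(5) and rank = less.prems(6)
  obtain K c where K: "finite_index K P" "M \<subseteq> K" "nilpotent_mod K c M" and MP: "normal_in M P"
    using M unfolding virtually_nilpotent_def by blast
  have sub: "subgroup M G" "M \<subseteq> P" "subgroup H G" "subgroup P G"
    using normal_inD[OF MP] normal_inD[OF HP] by blast+
  have subK: "subgroup K G" "K \<subseteq> P" using finite_indexD[OF K(1)] by blast+
  define T where "T = {m \<in> M. \<exists>k::int. k \<noteq> 0 \<and> m [^] k \<in> H}"
  have TP: "normal_in T P" unfolding T_def by (rule torsion_normal[OF MP HP HM ab])
  have TM: "T \<subseteq> M" unfolding T_def by blast
  have HT: "H \<subseteq> T"
  proof
    fix h assume h: "h \<in> H"
    have "h [^] (1::int) \<in> H" using h subgroup.mem_carrier[OF sub(3) h] by simp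
    then show "h \<in> T" unfolding T_def using h HM one_neq_zero by blast
  qed
  have abT: "commutator x y \<in> T" if "x \<in> M" "y \<in> M" for x y using ab[OF that] HT by blast
  show ?case
  \<comment> \<open>Reducibility over any subgroup of finite index counts, because such subgroups
    occur in the irreducible case.\<close>
  proof (cases "\<exists>N L. finite_index N P \<and> M \<subseteq> N \<and> normal_in L N \<and> H \<subseteq> L \<and> L \<subseteq> M \<and>
      \<not> (\<forall>l\<in>L. \<exists>k::int. k \<noteq> 0 \<and> l [^] k \<in> H) \<and> \<not> (\<forall>m\<in>M. \<exists>k::int. k \<noteq> 0 \<and> m [^] k \<in> L)")
    case True
    then obtain N L l m where N: "finite_index N P" "M \<subseteq> N" and L: "normal_in L N" "H \<subseteq> L" "L \<subseteq> M"
      and l: "l \<in> L" "\<And>k::int. l [^] k \<in> H \<Longrightarrow> k = 0" and m: "m \<in> M" "\<And>k::int. m [^] k \<in> L \<Longrightarrow> k = 0"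
      by metis
    have subL: "subgroup L G" and subN: "subgroup N G" "N \<subseteq> P"
      using normal_inD[OF L(1)] finite_indexD[OF N(1)] by blast+
    obtain r' where r': "r = Suc r'" "rank_le M L r'"
      using rank_le_quotient[OF rank subL L(2) l(1) _ l(2) sub(1)] l(1) L(3) by blast
    have rank': "rank_le L H r'"
      using rank_le_subgroup[OF rank[unfolded r'(1)] subL L(2,3) m sub(1)] .
    have N_slow: "slow N" by (rule finite_index_slow[OF N(1) P])
    have HN: "normal_in H N" using normal_in_subgroup[OF HP subN] HM N(2) by blast
    have vL: "virtually_nilpotent N L"
    proof (rule less.IH[OF _ N_slow _ L(1,3) _ r'(2)])
      show "r' < r" using r'(1) by simp
      show "virtually_nilpotent N M" by (rule virtually_nilpotent_down[OF M N])
      show "commutator x y \<in> L" if "x \<in> M" "y \<in> M" for x y using ab[OF that] L(2) by blast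
    qed
    have "virtually_nilpotent N H"
    proof (rule less.IH[OF _ N_slow vL HN L(2) _ rank'])
      show "r' < r" using r'(1) by simp
      show "commutator x y \<in> H" if "x \<in> L" "y \<in> L" for x y using ab that L(3) by blast
    qed
    then show ?thesis by (rule virtually_nilpotent_up[OF _ N(1) HP])
  next
    case False
    have "virtually_nilpotent K T"
    proof (rule virtually_nilpotent_irreducible[OF finite_index_slow[OF K(1) P] _ _ TM abT _ _ K(3)])
      show "normal_in M K" by (rule normal_in_subgroup[OF MP subK K(2)])
      show "normal_in T K" using normal_in_subgroup[OF TP subK] TM K(2) by blast
      show "rank_le M T r" using rank HT unfolding rank_le_def by blast
      show "k = 0 \<or> m \<in> T" if m: "m \<in> M" "m [^] k \<in> T" for m and k :: int
      proof -
        obtain j :: int where j: "j \<noteq> 0" "(m [^] k) [^] j \<in> H" using m(2) unfolding T_def by blast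
        have "m [^] (k * j) \<in> H" using j(2) int_pow_pow[OF subgroup.mem_carrier[OF sub(1) m(1)]] by simp
        then have "k * j \<noteq> 0 \<Longrightarrow> m \<in> T" unfolding T_def using m(1) by blast
        then show ?thesis using j(1) by (cases "k = 0") simp_all
      qed
      fix N L assume N: "finite_index N K" "M \<subseteq> N" "normal_in L N" "T \<subseteq> L" "L \<subseteq> M"
      have "finite_index N P" by (rule finite_index_trans[OF N(1) K(1)])
      moreover have "H \<subseteq> L" using HT N(4) by blast
      ultimately have "(\<forall>l\<in>L. \<exists>k::int. k \<noteq> 0 \<and> l [^] k \<in> H) \<or> (\<forall>m\<in>M. \<exists>k::int. k \<noteq> 0 \<and> m [^] k \<in> L)"
        using False N(2,3,5) by blast
      then show "(\<forall>l\<in>L. \<exists>k::int. k \<noteq> 0 \<and> l [^] k \<in> T) \<or> (\<forall>m\<in>M. \<exists>k::int. k \<noteq> 0 \<and> m [^] k \<in> L)"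
        using HT by blast
    qed
    then have vT: "virtually_nilpotent P T" by (rule virtually_nilpotent_up[OF _ K(1) TP])
    show ?thesis
    proof (rule virtually_nilpotent_torsion_section[OF P vT HP HT])
      show "commutator x y \<in> H" if "x \<in> T" "y \<in> T" for x y using ab that TM by blast
      show "\<exists>k::int. k \<noteq> 0 \<and> m [^] k \<in> H" if "m \<in> T" for m using that unfolding T_def by blast
    qed
  qed
qed

text \<open>Intersect all subgroups of \<open>M\<close> with at most \<open>card T\<close> cosets.
  Schreier's bound leaves only finitely many, and conjugation by \<open>P\<close> permutes
  them.\<close>

lemma finite_index_normal_core:
  assumes fg: "fg_subgroup M" and MP: "normal_in M P" and K: "finite_index K M"
  obtains H where "normal_in H P" "H \<subseteq> K" "finite_index H M"
proof -
  obtain T where T: "finite T" "T \<subseteq> M" "\<forall>g\<in>M. \<exists>t\<in>T. g \<otimes> inv t \<in> K"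
    and sub: "subgroup K G" "subgroup M G" "K \<subseteq> M" using K by (rule finite_indexE)
  obtain X where X: "finite X" "X \<subseteq> carrier G" "generate G X = M" using fg by (rule fg_subgroupE)
  have subP: "subgroup P G" using normal_inD(2)[OF MP] .
  define F where "F = {L. subgroup L G \<and> L \<subseteq> M \<and>
    (\<exists>S. finite S \<and> S \<subseteq> M \<and> card S \<le> card T \<and> (\<forall>g\<in>M. \<exists>t\<in>S. g \<otimes> inv t \<in> L))}"
  let ?B = "word_ball X (2 * card T + 1)"
  \<comment> \<open>Each of these subgroups is generated by its elements in one fixed ball.\<close>
  have "F \<subseteq> generate G ` Pow ?B"
  proof
    fix L assume "L \<in> F"
    then obtain S where L: "subgroup L G" "L \<subseteq> M"
      and S: "finite S" "S \<subseteq> M" "card S \<le> card T" "\<forall>g\<in>M. \<exists>t\<in>S. g \<otimes> inv t \<in> L"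
      unfolding F_def by blast
    have "L = generate G (L \<inter> word_ball X (2 * card S + 1))"
      using schreier_generators[OF X(2,3) L S(1,2,4)] by simp
    also have "\<dots> \<subseteq> generate G (L \<inter> ?B)"
      using S(3) word_ball_mono[of "2 * card S + 1" "2 * card T + 1" X] by (intro mono_generate) auto
    finally have "L \<subseteq> generate G (L \<inter> ?B)" .
    moreover have "generate G (L \<inter> ?B) \<subseteq> L" by (rule generate_subgroup_incl[OF _ L(1)]) simp
    ultimately have "L = generate G (L \<inter> ?B)" by (rule subset_antisym)
    then show "L \<in> generate G ` Pow ?B" by (rule image_eqI) simp
  qed
  moreover have "finite (generate G ` Pow ?B)" using finite_word_ball[OF X(1)] by simp
  ultimately have finF: "finite F" by (rule finite_subset)
  have F_index: "finite_index L M" if "L \<in> F" for L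
    using that sub(2) unfolding F_def finite_index_def by blast
  have KF: "K \<in> F" unfolding F_def using sub T by blast
  have F_conj: "conjg g ` L \<in> F" if g: "g \<in> P" and L: "L \<in> F" for g L
  proof -
    have gG: "g \<in> carrier G" using subgroup.mem_carrier[OF subP g] .
    have gM: "conjg g x \<in> M" if "x \<in> M" for x using normal_in_conjg[OF MP g that] .
    have igM: "conjg (inv g) x \<in> M" if "x \<in> M" for x
      using normal_in_conjg[OF MP subgroup.m_inv_closed[OF subP g] that] .
    obtain S where L': "subgroup L G" "L \<subseteq> M"
      and S: "finite S" "S \<subseteq> M" "card S \<le> card T" "\<forall>g\<in>M. \<exists>t\<in>S. g \<otimes> inv t \<in> L"
      using L unfolding F_def by blast
    have MG: "x \<in> carrier G" if "x \<in> M" for x using subgroup.mem_carrier[OF sub(2) that] .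
    have "\<exists>t\<in>conjg g ` S. x \<otimes> inv t \<in> conjg g ` L" if x: "x \<in> M" for x
    proof -
      obtain t where t: "t \<in> S" "conjg (inv g) x \<otimes> inv t \<in> L" using S(4) igM[OF x] by blast
      have tG: "t \<in> carrier G" using t(1) S(2) MG by blast
      have "x \<otimes> inv (conjg g t) = conjg g (conjg (inv g) x \<otimes> inv t)"
        using gG tG MG[OF x] by (simp add: conjg_mult conjg_inv)
      then show ?thesis using t by blast
    qed
    moreover have "card (conjg g ` S) \<le> card T" using card_image_le[OF S(1), of "conjg g"] S(3) by linarith
    moreover have "subgroup (conjg g ` L) G" by (rule conjg_image_subgroup[OF gG L'(1)])
    moreover have "conjg g ` L \<subseteq> M" "conjg g ` S \<subseteq> M" using gM L'(2) S(2) by blast+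
    moreover have "finite (conjg g ` S)" using S(1) by simp
    ultimately show ?thesis unfolding F_def by blast
  qed
  have fi: "finite_index (M \<inter> \<Inter>F) M" by (rule finite_index_Inter[OF finF sub(2) F_index])
  have "normal_in (M \<inter> \<Inter>F) P"
  proof (rule normal_inI[OF finite_indexD(1)[OF fi] subP])
    show "M \<inter> \<Inter>F \<subseteq> P" using normal_inD(3)[OF MP] by blast
    fix g x assume g: "g \<in> P" and x: "x \<in> M \<inter> \<Inter>F"
    have gG: "g \<in> carrier G" using subgroup.mem_carrier[OF subP g] .
    have igP: "inv g \<in> P" using subgroup.m_inv_closed[OF subP g] .
    have "conjg g x \<in> L" if L: "L \<in> F" for L
    proof -
      have "x \<in> conjg (inv g) ` L" using x F_conj[OF igP L] by blast
      then obtain y where y: "y \<in> L" "x = conjg (inv g) y" by blast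
      have "y \<in> carrier G" using y(1) subgroup.mem_carrier[OF finite_indexD(1)[OF F_index[OF L]]] by blast
      then show ?thesis using y gG by simp
    qed
    then show "conjg g x \<in> M \<inter> \<Inter>F" using normal_in_conjg[OF MP g] x by blast
  qed
  then show thesis using that[OF _ _ fi] KF by blast
qed

text \<open>A subgroup \<open>\<rho>\<close> of \<open>E \<times> G\<close> exhibits \<open>M / N\<close> as a section of \<open>E\<close>, where \<open>M\<close> is the second
  projection of \<open>\<rho>\<close> and \<open>N = {h. (1, h) \<in> \<rho>}\<close>. This notion is stable under all the operations that
  generate the elementary amenable groups.\<close>

definition section_relation :: "('e, 'f) monoid_scheme \<Rightarrow> ('e \<times> 'a) set \<Rightarrow> bool" where
  "section_relation E \<rho> \<longleftrightarrow> \<rho> \<subseteq> carrier E \<times> carrier G \<and> (\<one>\<^bsub>E\<^esub>, \<one>) \<in> \<rho> \<and>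
     (\<forall>e g e' g'. (e, g) \<in> \<rho> \<longrightarrow> (e', g') \<in> \<rho> \<longrightarrow> (e \<otimes>\<^bsub>E\<^esub> e', g \<otimes> g') \<in> \<rho>) \<and>
     (\<forall>e g. (e, g) \<in> \<rho> \<longrightarrow> (inv\<^bsub>E\<^esub> e, inv g) \<in> \<rho>)"

lemma section_relationD:
  assumes "section_relation E \<rho>"
  shows "(e, g) \<in> \<rho> \<Longrightarrow> e \<in> carrier E" "(e, g) \<in> \<rho> \<Longrightarrow> g \<in> carrier G" "(\<one>\<^bsub>E\<^esub>, \<one>) \<in> \<rho>"
    "(e, g) \<in> \<rho> \<Longrightarrow> (e', g') \<in> \<rho> \<Longrightarrow> (e \<otimes>\<^bsub>E\<^esub> e', g \<otimes> g') \<in> \<rho>"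
    "(e, g) \<in> \<rho> \<Longrightarrow> (inv\<^bsub>E\<^esub> e, inv g) \<in> \<rho>"
  using assms unfolding section_relation_def by blast+

lemma section_relation_snd:
  assumes "section_relation E \<rho>"
  shows "subgroup (snd ` \<rho>) G"
proof (rule subgroupI)
  note D = section_relationD[OF assms]
  show "snd ` \<rho> \<subseteq> carrier G" using D(2) by auto
  show "snd ` \<rho> \<noteq> {}" using D(3) by blast
  fix x assume "x \<in> snd ` \<rho>"
  then obtain e where x: "(e, x) \<in> \<rho>" by auto
  show "inv x \<in> snd ` \<rho>" using D(5)[OF x] by (metis image_eqI snd_conv)
  fix y assume "y \<in> snd ` \<rho>"
  then obtain e' where y: "(e', y) \<in> \<rho>" by auto
  show "x \<otimes> y \<in> snd ` \<rho>" using D(4)[OF x y] by (metis image_eqI snd_conv)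
qed

lemma section_relation_kernel:
  assumes "section_relation E \<rho>" "group E"
  shows "subgroup {h. (\<one>\<^bsub>E\<^esub>, h) \<in> \<rho>} G"
proof (rule subgroupI)
  note D = section_relationD[OF assms(1)]
  interpret E: group E by fact
  show "{h. (\<one>\<^bsub>E\<^esub>, h) \<in> \<rho>} \<subseteq> carrier G" using D(2) by blast
  show "{h. (\<one>\<^bsub>E\<^esub>, h) \<in> \<rho>} \<noteq> {}" using D(3) by blast
  fix x assume x: "x \<in> {h. (\<one>\<^bsub>E\<^esub>, h) \<in> \<rho>}"
  then show "inv x \<in> {h. (\<one>\<^bsub>E\<^esub>, h) \<in> \<rho>}" using D(5)[of "\<one>\<^bsub>E\<^esub>" x] by simp
  fix y assume "y \<in> {h. (\<one>\<^bsub>E\<^esub>, h) \<in> \<rho>}"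
  then show "x \<otimes> y \<in> {h. (\<one>\<^bsub>E\<^esub>, h) \<in> \<rho>}" using x D(4)[of "\<one>\<^bsub>E\<^esub>" x "\<one>\<^bsub>E\<^esub>" y] by simp
qed

text \<open>Quantifying over all relations makes this a property of \<open>E\<close> relative to
  \<open>P\<close>, as an induction over \<open>EG\<close> requires. The kernel of
  \<open>\<rho>\<close> is normal in the projection but perhaps not in \<open>P\<close>, so a
  smaller \<open>H\<close> is allowed.\<close>

definition tame :: "'a set \<Rightarrow> ('e, 'f) monoid_scheme \<Rightarrow> bool" where
  "tame P E \<longleftrightarrow> (\<forall>\<rho>. section_relation E \<rho> \<longrightarrow> virtually_nilpotent P (snd ` \<rho>) \<longrightarrow>
     (\<exists>H. virtually_nilpotent P H \<and> (\<forall>h\<in>H. (\<one>\<^bsub>E\<^esub>, h) \<in> \<rho>)))"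

lemma tameD:
  assumes "tame P E" "section_relation E \<rho>" "virtually_nilpotent P (snd ` \<rho>)"
  obtains H where "virtually_nilpotent P H" "\<forall>h\<in>H. (\<one>\<^bsub>E\<^esub>, h) \<in> \<rho>"
  using assms unfolding tame_def by blast

lemma fg_virtually_nilpotent:
  assumes "slow P" "virtually_nilpotent P M"
  shows "fg_subgroup M"
proof -
  have M: "normal_in M P" using assms(2) unfolding virtually_nilpotent_def by blast
  show ?thesis
    by (rule fg_above_virtually_nilpotent[OF assms normal_inD(1)[OF M] subset_refl normal_inD(3)[OF M]])
qed

text \<open>\<open>H\<close> is the derived subgroup of the projection \<open>?M\<close>. It is
  normal in \<open>P\<close>, lies in the kernel because \<open>E\<close> is abelian, and
  \<open>?M / H\<close> has finite rank because \<open>?M\<close> is finitely generated.\<close>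

lemma tame_abelian:
  assumes P: "slow P" and E: "comm_group E"
  shows "tame P E"
  unfolding tame_def
proof (intro allI impI)
  fix \<rho> assume \<rho>: "section_relation E \<rho>" and v: "virtually_nilpotent P (snd ` \<rho>)"
  note D = section_relationD[OF \<rho>]
  interpret E: comm_group E by fact
  let ?M = "snd ` \<rho>" and ?N = "{h. (\<one>\<^bsub>E\<^esub>, h) \<in> \<rho>}"
  have MP: "normal_in ?M P" using v unfolding virtually_nilpotent_def by blast
  have sub: "subgroup ?M G" "subgroup P G" "?M \<subseteq> P" using normal_inD[OF MP] by blast+
  have MG: "x \<in> carrier G" if "x \<in> ?M" for x using subgroup.mem_carrier[OF sub(1) that] .
  let ?S = "{commutator x y | x y. x \<in> ?M \<and> y \<in> ?M}"
  define H where "H = generate G ?S"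
  have SG: "?S \<subseteq> carrier G" using MG commutator_closed by blast
  have com: "commutator x y \<in> H" if "x \<in> ?M" "y \<in> ?M" for x y
    unfolding H_def using that by (intro generate.incl) blast
  have SM: "?S \<subseteq> ?M" using commutator_in_subgroup[OF sub(1)] by blast
  then have HM: "H \<subseteq> ?M" unfolding H_def by (rule generate_subgroup_incl[OF _ sub(1)])
  have conj: "conjg g s \<in> H" if g: "g \<in> P" and s: "s \<in> ?S" for g s
  proof -
    obtain x y where xy: "x \<in> ?M" "y \<in> ?M" "s = commutator x y" using s by blast
    have "conjg g s = commutator (conjg g x) (conjg g y)"
      unfolding xy(3) using conjg_commutator[OF subgroup.mem_carrier[OF sub(2) g] MG[OF xy(1)] MG[OF xy(2)]] .
    then show ?thesis using com normal_in_conjg[OF MP g] xy by simp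
  qed
  have HP: "normal_in H P"
    unfolding normal_in_def
  proof (intro conjI ballI)
    show "subgroup H G" unfolding H_def by (rule generate_is_subgroup[OF SG])
    show "subgroup P G" "H \<subseteq> P" using sub(2,3) HM by blast+
    fix g assume g: "g \<in> P"
    show "normalizes g H"
      unfolding H_def
      by (rule normalizes_generated[OF SG subgroup.mem_carrier[OF sub(2) g]])
        (use conj g subgroup.m_inv_closed[OF sub(2) g] in \<open>simp_all add: H_def\<close>)
  qed
  interpret S: abelian_section G ?M H
    using normal_in_subgroup[OF HP sub(1,3) HM] com by unfold_locales
  obtain r where "rank_le ?M H r" using S.rank_le_fg[OF fg_virtually_nilpotent[OF P v]] by blast
  then have "virtually_nilpotent P H"
    using virtually_nilpotent_abelian_section[OF P v HP HM com] by blast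
  moreover have "H \<subseteq> ?N"
    unfolding H_def
  proof (rule generate_subgroup_incl[OF _ section_relation_kernel[OF \<rho> E.is_group]])
    show "?S \<subseteq> ?N"
    proof
      fix s assume "s \<in> ?S"
      then obtain x y e f where xy: "(e, x) \<in> \<rho>" "(f, y) \<in> \<rho>" "s = commutator x y" by auto
      have ef: "e \<in> carrier E" "f \<in> carrier E" using D(1) xy by blast+
      have "(e \<otimes>\<^bsub>E\<^esub> f \<otimes>\<^bsub>E\<^esub> inv\<^bsub>E\<^esub> e \<otimes>\<^bsub>E\<^esub> inv\<^bsub>E\<^esub> f, commutator x y) \<in> \<rho>"
        unfolding commutator_def by (intro D(4) D(5) xy)
      moreover have "e \<otimes>\<^bsub>E\<^esub> f \<otimes>\<^bsub>E\<^esub> inv\<^bsub>E\<^esub> e \<otimes>\<^bsub>E\<^esub> inv\<^bsub>E\<^esub> f = \<one>\<^bsub>E\<^esub>"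
      proof -
        have "e \<otimes>\<^bsub>E\<^esub> f \<otimes>\<^bsub>E\<^esub> inv\<^bsub>E\<^esub> e \<otimes>\<^bsub>E\<^esub> inv\<^bsub>E\<^esub> f = (e \<otimes>\<^bsub>E\<^esub> f) \<otimes>\<^bsub>E\<^esub> inv\<^bsub>E\<^esub> (f \<otimes>\<^bsub>E\<^esub> e)"
          using ef by (simp add: E.inv_mult_group E.m_assoc)
        also have "f \<otimes>\<^bsub>E\<^esub> e = e \<otimes>\<^bsub>E\<^esub> f" using ef by (rule E.m_comm[symmetric])
        finally show ?thesis using ef by simp
      qed
      ultimately show "s \<in> ?N" using xy(3) by simp
    qed
  qed
  ultimately show "\<exists>H. virtually_nilpotent P H \<and> (\<forall>h\<in>H. (\<one>\<^bsub>E\<^esub>, h) \<in> \<rho>)" by blast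
qed

text \<open>Elements of the projection with a common partner in \<open>E\<close> agree modulo the
  kernel, so the kernel has finite index; its normal core serves as \<open>H\<close>.\<close>

lemma tame_finite:
  assumes P: "slow P" and E: "group E" "finite (carrier E)"
  shows "tame P E"
  unfolding tame_def
proof (intro allI impI)
  fix \<rho> assume \<rho>: "section_relation E \<rho>" and v: "virtually_nilpotent P (snd ` \<rho>)"
  note D = section_relationD[OF \<rho>]
  interpret E: group E by fact
  let ?M = "snd ` \<rho>" and ?N = "{h. (\<one>\<^bsub>E\<^esub>, h) \<in> \<rho>}"
  have MP: "normal_in ?M P" using v unfolding virtually_nilpotent_def by blast
  define f where "f m = (SOME e. (e, m) \<in> \<rho>)" for m
  have f: "(f m, m) \<in> \<rho>" if "m \<in> ?M" for m
  proof -
    from that obtain e where "(e, m) \<in> \<rho>" by auto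
    then show ?thesis unfolding f_def by (rule someI)
  qed
  have "finite_index ?N ?M"
  proof (rule finite_indexI[where f = f])
    show "subgroup ?N G" by (rule section_relation_kernel[OF \<rho> E(1)])
    show "subgroup ?M G" by (rule section_relation_snd[OF \<rho>])
    show "?N \<subseteq> ?M" by force
    have "f ` ?M \<subseteq> carrier E" using f D(1) by blast
    then show "finite (f ` ?M)" using E(2) by (rule finite_subset)
    fix g h assume gh: "g \<in> ?M" "h \<in> ?M" "f g = f h"
    have "(f g \<otimes>\<^bsub>E\<^esub> inv\<^bsub>E\<^esub> (f h), g \<otimes> inv h) \<in> \<rho>" by (intro D(4) D(5) f gh(1,2))
    then show "g \<otimes> inv h \<in> ?N" using gh(3) D(1)[OF f[OF gh(2)]] by simp
  qed
  from finite_index_normal_core[OF fg_virtually_nilpotent[OF P v] MP this]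
  obtain H where H: "normal_in H P" "H \<subseteq> ?N" "finite_index H ?M" by blast
  have "virtually_nilpotent P H" by (rule virtually_nilpotent_finite_section[OF v H(1,3)])
  then show "\<exists>H. virtually_nilpotent P H \<and> (\<forall>h\<in>H. (\<one>\<^bsub>E\<^esub>, h) \<in> \<rho>)" using H(2) by blast
qed

lemma section_relation_subgroup:
  assumes "group E" "subgroup K E"
  shows "section_relation (E\<lparr>carrier := K\<rparr>) \<rho> \<longleftrightarrow> section_relation E \<rho> \<and> \<rho> \<subseteq> K \<times> carrier G"
proof -
  have KE: "K \<subseteq> carrier E" using subgroup.subset[OF assms(2)] .
  have inv: "inv\<^bsub>E\<lparr>carrier := K\<rparr>\<^esub> e = inv\<^bsub>E\<^esub> e" if "e \<in> K" for e
    using group.m_inv_consistent[OF assms that] .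
  show ?thesis
  proof
    assume l: "section_relation (E\<lparr>carrier := K\<rparr>) \<rho>"
    note D = section_relationD[OF l]
    have sub: "\<rho> \<subseteq> K \<times> carrier G" using D(1,2) by auto
    have "(inv\<^bsub>E\<^esub> e, inv g) \<in> \<rho>" if "(e, g) \<in> \<rho>" for e g
      using D(5)[OF that] inv[of e] sub that by auto
    moreover have "\<rho> \<subseteq> carrier E \<times> carrier G" using sub KE by blast
    ultimately show "section_relation E \<rho> \<and> \<rho> \<subseteq> K \<times> carrier G"
      using sub D(3,4) unfolding section_relation_def by simp
  next
    assume r: "section_relation E \<rho> \<and> \<rho> \<subseteq> K \<times> carrier G"
    then have r1: "section_relation E \<rho>" and sub: "\<rho> \<subseteq> K \<times> carrier G" by blast+
    note D = section_relationD[OF r1]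
    have "(inv\<^bsub>E\<lparr>carrier := K\<rparr>\<^esub> e, inv g) \<in> \<rho>" if "(e, g) \<in> \<rho>" for e g
      using D(5)[OF that] inv[of e] sub that by auto
    then show "section_relation (E\<lparr>carrier := K\<rparr>) \<rho>"
      using sub D(3,4) unfolding section_relation_def by simp
  qed
qed

lemma tame_subgroup:
  assumes "group E" "tame P E" "subgroup K E"
  shows "tame P (E\<lparr>carrier := K\<rparr>)"
  using assms(2) section_relation_subgroup[OF assms(1,3)] unfolding tame_def by simp

lemma section_relation_vimage:
  assumes "group E" "group Q" "\<pi> \<in> hom E Q" "section_relation Q \<rho>"
  shows "section_relation E {(e, g). e \<in> carrier E \<and> (\<pi> e, g) \<in> \<rho>}"
proof -
  note D = section_relationD[OF assms(4)]
  interpret \<pi>: group_hom E Q \<pi> using assms(1-3) by (intro group_hom.intro group_hom_axioms.intro)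
  show ?thesis unfolding section_relation_def using D by auto
qed

lemma section_relation_image:
  assumes "group E" "group Q" "\<pi> \<in> hom E Q" "section_relation E \<rho>"
  shows "section_relation Q ((\<lambda>(e, g). (\<pi> e, g)) ` \<rho>)"
proof -
  note D = section_relationD[OF assms(4)]
  interpret \<pi>: group_hom E Q \<pi> using assms(1-3) by (intro group_hom.intro group_hom_axioms.intro)
  let ?f = "\<lambda>(e, g). (\<pi> e, g)"
  show ?thesis unfolding section_relation_def
  proof (intro conjI allI impI)
    show "?f ` \<rho> \<subseteq> carrier Q \<times> carrier G" using D(1,2) by auto
    show "(\<one>\<^bsub>Q\<^esub>, \<one>) \<in> ?f ` \<rho>" using imageI[OF D(3), of ?f] by simp
  next
    fix e g e' g' assume "(e, g) \<in> ?f ` \<rho>" "(e', g') \<in> ?f ` \<rho>"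
    then obtain x x' where x: "(x, g) \<in> \<rho>" "(x', g') \<in> \<rho>" "e = \<pi> x" "e' = \<pi> x'" by auto
    then show "(e \<otimes>\<^bsub>Q\<^esub> e', g \<otimes> g') \<in> ?f ` \<rho>" using imageI[OF D(4)[OF x(1,2)], of ?f] D(1) by simp
  next
    fix e g assume "(e, g) \<in> ?f ` \<rho>"
    then obtain x where x: "(x, g) \<in> \<rho>" "e = \<pi> x" by auto
    then show "(inv\<^bsub>Q\<^esub> e, inv g) \<in> ?f ` \<rho>" using imageI[OF D(5)[OF x(1)], of ?f] D(1) by simp
  qed
qed

end

text \<open>Combines the projection and the isomorphism onto the copy \<open>Q\<close> into one
  surjection with kernel \<open>N\<close>.\<close>

lemma quotient_map:
  assumes "group E" "N \<lhd> E" "group Q" "E Mod N \<cong> Q"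
  obtains \<pi> where "\<pi> \<in> hom E Q" "\<pi> ` carrier E = carrier Q" "\<forall>x\<in>carrier E. \<pi> x = \<one>\<^bsub>Q\<^esub> \<longleftrightarrow> x \<in> N"
proof -
  interpret E: group E by fact
  interpret N: normal N E by fact
  obtain \<theta> where \<theta>: "\<theta> \<in> iso (E Mod N) Q" using assms(4) unfolding is_iso_def by blast
  have \<theta>h: "\<theta> \<in> hom (E Mod N) Q" and bij: "bij_betw \<theta> (carrier (E Mod N)) (carrier Q)"
    using \<theta> unfolding iso_def by blast+
  have Qgrp: "group (E Mod N)" by (rule N.factorgroup_is_group)
  have one: "\<theta> N = \<one>\<^bsub>Q\<^esub>" using hom_one[OF \<theta>h Qgrp assms(3)] by simp
  have Nc: "N \<in> carrier (E Mod N)" using group.is_monoid[OF Qgrp, THEN monoid.one_closed] by simp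
  let ?\<pi> = "\<theta> \<circ> (\<lambda>x. N #>\<^bsub>E\<^esub> x)"
  show thesis
  proof (rule that[of ?\<pi>])
    show "?\<pi> \<in> hom E Q" by (rule Group.hom_compose[OF N.r_coset_hom_Mod \<theta>h])
    show "?\<pi> ` carrier E = carrier Q"
      using bij unfolding bij_betw_def carrier_FactGroup by (simp add: image_image)
    show "\<forall>x\<in>carrier E. ?\<pi> x = \<one>\<^bsub>Q\<^esub> \<longleftrightarrow> x \<in> N"
    proof
      fix x assume x: "x \<in> carrier E"
      have xc: "N #>\<^bsub>E\<^esub> x \<in> carrier (E Mod N)" using x unfolding carrier_FactGroup by blast
      have "?\<pi> x = \<one>\<^bsub>Q\<^esub> \<longleftrightarrow> N #>\<^bsub>E\<^esub> x = N"
        using bij xc Nc one unfolding bij_betw_def by (metis comp_apply inj_on_eq_iff)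
      also have "\<dots> \<longleftrightarrow> x \<in> N"
        using E.coset_join1[OF _ x N.subgroup_axioms] E.coset_join2[OF x N.subgroup_axioms] N.subset by blast
      finally show "?\<pi> x = \<one>\<^bsub>Q\<^esub> \<longleftrightarrow> x \<in> N" .
    qed
  qed
qed

context group
begin

text \<open>Pull the relation back along \<open>\<pi>\<close>. The projection to \<open>G\<close> is
  unchanged because \<open>\<pi>\<close> is onto, and so is the kernel because \<open>\<pi>\<close>
  preserves the identity.\<close>

lemma tame_quotient:
  assumes E: "group E" "tame P E" and N: "N \<lhd> E" and Q: "group Q" "E Mod N \<cong> Q"
  shows "tame P Q"
  unfolding tame_def
proof (intro allI impI)
  fix \<rho> assume \<rho>: "section_relation Q \<rho>" and v: "virtually_nilpotent P (snd ` \<rho>)"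
  obtain \<pi> where \<pi>: "\<pi> \<in> hom E Q" "\<pi> ` carrier E = carrier Q"
    "\<forall>x\<in>carrier E. \<pi> x = \<one>\<^bsub>Q\<^esub> \<longleftrightarrow> x \<in> N" by (rule quotient_map[OF E(1) N Q])
  let ?\<rho> = "{(e, g). e \<in> carrier E \<and> (\<pi> e, g) \<in> \<rho>}"
  have "snd ` ?\<rho> = snd ` \<rho>"
  proof
    show "snd ` \<rho> \<subseteq> snd ` ?\<rho>"
    proof
      fix g assume "g \<in> snd ` \<rho>"
      then obtain q where q: "(q, g) \<in> \<rho>" by auto
      then have "q \<in> \<pi> ` carrier E" using section_relationD(1)[OF \<rho>] \<pi>(2) by blast
      then obtain e where "e \<in> carrier E" "q = \<pi> e" by blast
      then have "(e, g) \<in> ?\<rho>" using q by simp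
      then show "g \<in> snd ` ?\<rho>" by force
    qed
  qed force
  then have v': "virtually_nilpotent P (snd ` ?\<rho>)" using v by simp
  obtain H where H: "virtually_nilpotent P H" "\<forall>h\<in>H. (\<one>\<^bsub>E\<^esub>, h) \<in> ?\<rho>"
    by (rule tameD[OF E(2) section_relation_vimage[OF E(1) Q(1) \<pi>(1) \<rho>] v'])
  have "\<pi> \<one>\<^bsub>E\<^esub> = \<one>\<^bsub>Q\<^esub>" by (rule hom_one[OF \<pi>(1) E(1) Q(1)])
  then have "\<forall>h\<in>H. (\<one>\<^bsub>Q\<^esub>, h) \<in> \<rho>" using H(2) by simp
  then show "\<exists>H. virtually_nilpotent P H \<and> (\<forall>h\<in>H. (\<one>\<^bsub>Q\<^esub>, h) \<in> \<rho>)" using H(1) by blast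
qed

text \<open>Tameness of \<open>Q\<close> yields an \<open>H\<close> each of whose elements is
  related to an element of \<open>N\<close>. The relation restricted to \<open>N\<close> and
  \<open>H\<close> still projects onto \<open>H\<close>, and tameness of \<open>N\<close> applies to
  it.\<close>

lemma tame_extension:
  assumes E: "group E" and N: "N \<lhd> E" "tame P (E\<lparr>carrier := N\<rparr>)" and Q: "group Q" "E Mod N \<cong> Q" "tame P Q"
  shows "tame P E"
  unfolding tame_def
proof (intro allI impI)
  fix \<rho> assume \<rho>: "section_relation E \<rho>" and v: "virtually_nilpotent P (snd ` \<rho>)"
  note D = section_relationD[OF \<rho>]
  have subN: "subgroup N E" by (rule normal_imp_subgroup[OF N(1)])
  obtain \<pi> where \<pi>: "\<pi> \<in> hom E Q" "\<pi> ` carrier E = carrier Q"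
    "\<forall>x\<in>carrier E. \<pi> x = \<one>\<^bsub>Q\<^esub> \<longleftrightarrow> x \<in> N" by (rule quotient_map[OF E N(1) Q(1,2)])
  let ?\<rho>Q = "(\<lambda>(e, g). (\<pi> e, g)) ` \<rho>"
  have "snd ` ?\<rho>Q = snd ` \<rho>" by (force simp: image_image split_def)
  then have vQ: "virtually_nilpotent P (snd ` ?\<rho>Q)" using v by simp
  obtain H where H: "virtually_nilpotent P H" "\<forall>h\<in>H. (\<one>\<^bsub>Q\<^esub>, h) \<in> ?\<rho>Q"
    by (rule tameD[OF Q(3) section_relation_image[OF E Q(1) \<pi>(1) \<rho>] vQ])
  have subH: "subgroup H G" using H(1) normal_inD(1) unfolding virtually_nilpotent_def by blast
  define \<rho>1 where "\<rho>1 = {(e, h). (e, h) \<in> \<rho> \<and> e \<in> N \<and> h \<in> H}"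
  have "section_relation E \<rho>1"
    unfolding section_relation_def
  proof (intro conjI allI impI)
    show "\<rho>1 \<subseteq> carrier E \<times> carrier G" using D(1,2) by (auto simp: \<rho>1_def)
    show "(\<one>\<^bsub>E\<^esub>, \<one>) \<in> \<rho>1"
      using D(3) subgroup.one_closed[OF subN] subgroup.one_closed[OF subH] by (simp add: \<rho>1_def)
  next
    fix e g e' g' assume "(e, g) \<in> \<rho>1" "(e', g') \<in> \<rho>1"
    then show "(e \<otimes>\<^bsub>E\<^esub> e', g \<otimes> g') \<in> \<rho>1"
      using D(4) subgroup.m_closed[OF subN] subgroup.m_closed[OF subH] by (simp add: \<rho>1_def)
  next
    fix e g assume "(e, g) \<in> \<rho>1"
    then show "(inv\<^bsub>E\<^esub> e, inv g) \<in> \<rho>1"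
      using D(5) subgroup.m_inv_closed[OF subN] subgroup.m_inv_closed[OF subH] by (simp add: \<rho>1_def)
  qed
  moreover have "\<rho>1 \<subseteq> N \<times> carrier G" using D(2) by (auto simp: \<rho>1_def)
  ultimately have \<rho>1: "section_relation (E\<lparr>carrier := N\<rparr>) \<rho>1"
    using section_relation_subgroup[OF E subN] by blast
  have "snd ` \<rho>1 = H"
  proof
    show "snd ` \<rho>1 \<subseteq> H" by (auto simp: \<rho>1_def)
    show "H \<subseteq> snd ` \<rho>1"
    proof
      fix h assume h: "h \<in> H"
      then obtain e where e: "(e, h) \<in> \<rho>" "\<pi> e = \<one>\<^bsub>Q\<^esub>" using H(2) by force
      then have "e \<in> N" using \<pi>(3) D(1)[OF e(1)] by blast
      then have "(e, h) \<in> \<rho>1" using e(1) h by (simp add: \<rho>1_def)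
      then show "h \<in> snd ` \<rho>1" by force
    qed
  qed
  then have "virtually_nilpotent P (snd ` \<rho>1)" using H(1) by simp
  from tameD[OF N(2) \<rho>1 this] obtain H' where "virtually_nilpotent P H'" "\<forall>h\<in>H'. (\<one>\<^bsub>E\<^esub>, h) \<in> \<rho>1"
    by auto
  then show "\<exists>H. virtually_nilpotent P H \<and> (\<forall>h\<in>H. (\<one>\<^bsub>E\<^esub>, h) \<in> \<rho>)" by (auto simp: \<rho>1_def)
qed

lemma directed_finite_subset:
  assumes "finite S" "S \<subseteq> \<Union>\<F>" "\<F> \<noteq> {}" "\<And>K L. K \<in> \<F> \<Longrightarrow> L \<in> \<F> \<Longrightarrow> \<exists>M\<in>\<F>. K \<union> L \<subseteq> M"
  shows "\<exists>K\<in>\<F>. S \<subseteq> K"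
  using assms(1,2)
proof (induction S)
  case empty
  then show ?case using assms(3) by blast
next
  case (insert x S)
  obtain K where K: "K \<in> \<F>" "S \<subseteq> K" using insert by auto
  obtain L where L: "L \<in> \<F>" "x \<in> L" using insert.prems by auto
  obtain M where "M \<in> \<F>" "K \<union> L \<subseteq> M" using assms(4)[OF K(1) L(1)] by blast
  then show ?case using K L by blast
qed

text \<open>Slowness makes the projection finitely generated, so partners of its generators lie in a
  single member of the family, and the relation restricted to that member has the same
  projection.\<close>

lemma tame_directed_union:
  assumes P: "slow P" and E: "group E"
    and F: "\<And>K. K \<in> \<F> \<Longrightarrow> subgroup K E \<and> tame P (E\<lparr>carrier := K\<rparr>)"
    and dir: "\<And>K L. K \<in> \<F> \<Longrightarrow> L \<in> \<F> \<Longrightarrow> \<exists>M\<in>\<F>. K \<union> L \<subseteq> M" and un: "\<Union>\<F> = carrier E"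
  shows "tame P E"
  unfolding tame_def
proof (intro allI impI)
  fix \<rho> assume \<rho>: "section_relation E \<rho>" and v: "virtually_nilpotent P (snd ` \<rho>)"
  note D = section_relationD[OF \<rho>]
  obtain Y where Y: "finite Y" "Y \<subseteq> carrier G" "generate G Y = snd ` \<rho>"
    using fg_virtually_nilpotent[OF P v] by (rule fg_subgroupE)
  have "\<forall>y\<in>Y. \<exists>e. (e, y) \<in> \<rho>"
  proof
    fix y assume "y \<in> Y"
    then have "y \<in> snd ` \<rho>" unfolding Y(3)[symmetric] by (rule generate.incl)
    then show "\<exists>e. (e, y) \<in> \<rho>" by auto
  qed
  then obtain f where f: "\<And>y. y \<in> Y \<Longrightarrow> (f y, y) \<in> \<rho>" by metis
  have "finite (f ` Y)" "f ` Y \<subseteq> \<Union>\<F>" using Y(1) f D(1) un by auto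
  moreover have "\<F> \<noteq> {}" using un D(1)[OF D(3)] by blast
  ultimately obtain K where K: "K \<in> \<F>" "f ` Y \<subseteq> K" using directed_finite_subset[OF _ _ _ dir] by blast
  have subK: "subgroup K E" and tK: "tame P (E\<lparr>carrier := K\<rparr>)" using F[OF K(1)] by blast+
  define \<rho>0 where "\<rho>0 = {(e, g). (e, g) \<in> \<rho> \<and> e \<in> K}"
  have \<rho>0: "section_relation E \<rho>0"
    unfolding section_relation_def
  proof (intro conjI allI impI)
    show "\<rho>0 \<subseteq> carrier E \<times> carrier G" using D(1,2) by (auto simp: \<rho>0_def)
    show "(\<one>\<^bsub>E\<^esub>, \<one>) \<in> \<rho>0" using D(3) subgroup.one_closed[OF subK] by (simp add: \<rho>0_def)
  next
    fix e g e' g' assume "(e, g) \<in> \<rho>0" "(e', g') \<in> \<rho>0"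
    then show "(e \<otimes>\<^bsub>E\<^esub> e', g \<otimes> g') \<in> \<rho>0" using D(4) subgroup.m_closed[OF subK] by (simp add: \<rho>0_def)
  next
    fix e g assume "(e, g) \<in> \<rho>0"
    then show "(inv\<^bsub>E\<^esub> e, inv g) \<in> \<rho>0" using D(5) subgroup.m_inv_closed[OF subK] by (simp add: \<rho>0_def)
  qed
  moreover have "\<rho>0 \<subseteq> K \<times> carrier G" using D(2) by (auto simp: \<rho>0_def)
  ultimately have \<rho>0K: "section_relation (E\<lparr>carrier := K\<rparr>) \<rho>0"
    using section_relation_subgroup[OF E subK] by blast
  have "snd ` \<rho>0 = snd ` \<rho>"
  proof
    show "snd ` \<rho>0 \<subseteq> snd ` \<rho>" by (auto simp: \<rho>0_def)
    have "Y \<subseteq> snd ` \<rho>0"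
    proof
      fix y assume "y \<in> Y"
      then have "(f y, y) \<in> \<rho>0" using f K(2) by (auto simp: \<rho>0_def)
      then show "y \<in> snd ` \<rho>0" by force
    qed
    then show "snd ` \<rho> \<subseteq> snd ` \<rho>0"
      unfolding Y(3)[symmetric] by (rule generate_subgroup_incl[OF _ section_relation_snd[OF \<rho>0]])
  qed
  then have "virtually_nilpotent P (snd ` \<rho>0)" using v by simp
  from tameD[OF tK \<rho>0K this] obtain H where "virtually_nilpotent P H" "\<forall>h\<in>H. (\<one>\<^bsub>E\<^esub>, h) \<in> \<rho>0"
    by auto
  then show "\<exists>H. virtually_nilpotent P H \<and> (\<forall>h\<in>H. (\<one>\<^bsub>E\<^esub>, h) \<in> \<rho>)" by (auto simp: \<rho>0_def)
qed

text \<open>\<open>group E\<close> is carried along because the rule for subgroups assumes it only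
  through \<open>EG\<close>.\<close>

lemma tame_EG:
  assumes "slow P" "EG E"
  shows "group E \<and> tame P E"
  using assms(2)
proof induction
  case (abelian E)
  then show ?case using tame_abelian[OF assms(1)] comm_group.axioms(2) by blast
next
  case (finite E)
  then show ?case using tame_finite[OF assms(1)] by blast
next
  case (subgroup E K)
  then show ?case using tame_subgroup subgroup.subgroup_is_group by blast
next
  case (quotient E N Q)
  then show ?case using tame_quotient by blast
next
  case (extension E N Q)
  then show ?case using tame_extension by blast
next
  case (directed_union E \<F>)
  have "tame P E"
  proof (rule tame_directed_union[OF assms(1)])
    show "group E" by fact
    show "subgroup K E \<and> tame P (E\<lparr>carrier := K\<rparr>)" if "K \<in> \<F>" for K
      using directed_union.IH[OF that] by blast
    show "\<exists>M\<in>\<F>. K \<union> L \<subseteq> M" if "K \<in> \<F>" "L \<in> \<F>" for K L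
      using directed_union.hyps that by blast
    show "\<Union>\<F> = carrier E" by fact
  qed
  then show ?case using directed_union.hyps by blast
qed

end

theorem theorem2p2:
  fixes G :: "('a, 'b) monoid_scheme" and H :: "'a set"
  assumes "group G"
    and "finitely_generated G"
    and "entropy G = 0"
    and "H \<lhd> G"
    and "elementary_amenable TYPE('u) (G Mod H)"
  shows "finitely_generated (G\<lparr>carrier := H\<rparr>)"
proof -
  interpret group G by fact
  have slow: "slow (carrier G)" by (rule slow_of_entropy_zero[OF assms(2,3)])
  obtain E :: "'u monoid" where E: "EG E" "G Mod H \<cong> E"
    using assms(5) unfolding elementary_amenable_def by blast
  have grp: "group E" and tame: "tame (carrier G) E" using tame_EG[OF slow E(1)] by blast+
  have subH: "subgroup H G" by (rule normal_imp_subgroup[OF assms(4)])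
  obtain \<pi> where \<pi>: "\<pi> \<in> hom G E" "\<pi> ` carrier G = carrier E"
    "\<forall>x\<in>carrier G. \<pi> x = \<one>\<^bsub>E\<^esub> \<longleftrightarrow> x \<in> H" by (rule quotient_map[OF assms(1,4) grp E(2)])
  interpret \<pi>: group_hom G E \<pi> using assms(1) grp \<pi>(1) by (intro group_hom.intro group_hom_axioms.intro)
  \<comment> \<open>The transposed graph of the projection. Its own projection is all of
    \<open>G\<close>, which starts the process with a trivial quotient, and its kernel is
    \<open>H\<close>.\<close>
  define \<rho> where "\<rho> = {(e, g). g \<in> carrier G \<and> e = \<pi> g}"
  have \<rho>: "section_relation E \<rho>" unfolding section_relation_def \<rho>_def by auto
  have "snd ` \<rho> = carrier G" by (force simp: \<rho>_def)
  moreover have "virtually_nilpotent (carrier G) (carrier G)"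
  proof -
    have "normal_in (carrier G) (carrier G)" by (rule normal_inI) (auto simp: subgroup_self)
    moreover have "nilpotent_mod (carrier G) 0 (carrier G)"
      unfolding nilpotent_mod_def using weighted_commutator_in_subgroup[OF _ subgroup_self subset_refl] by blast
    ultimately show ?thesis
      unfolding virtually_nilpotent_def using finite_index_refl[OF subgroup_self] by blast
  qed
  ultimately have "virtually_nilpotent (carrier G) (snd ` \<rho>)" by simp
  from tameD[OF tame \<rho> this] obtain N
    where N: "virtually_nilpotent (carrier G) N" "\<forall>h\<in>N. (\<one>\<^bsub>E\<^esub>, h) \<in> \<rho>" by blast
  have "N \<subseteq> H"
  proof
    fix h assume "h \<in> N"
    then have "h \<in> carrier G" "\<pi> h = \<one>\<^bsub>E\<^esub>" using N(2) by (auto simp: \<rho>_def)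
    then show "h \<in> H" using \<pi>(3) by blast
  qed
  \<comment> \<open>\<open>H\<close> may be larger than \<open>N\<close>; every subgroup between
    \<open>N\<close> and \<open>G\<close> is finitely generated.\<close>
  then have "fg_subgroup H"
    by (rule fg_above_virtually_nilpotent[OF slow N(1) subH _ subgroup.subset[OF subH]])
  then obtain X where X: "finite X" "X \<subseteq> carrier G" "generate G X = H" by (rule fg_subgroupE)
  have XH: "X \<subseteq> H" unfolding X(3)[symmetric] by (auto intro: generate.incl)
  have "generate (G\<lparr>carrier := H\<rparr>) X = H" using generate_consistent[OF XH subH] X(3) by simp
  then show ?thesis unfolding finitely_generated_def generates_def using X(1) XH by auto
qed

end
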